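(* Let $\mathbb{F}$ be a field, $V$ a non-zero finite-dimensional $\mathbb{F}$-vector space, and $\Bbbk$ a connected commutative ring. Then the $\Bbbk[\mathrm{GL}(V)]$-module $\Bbbk\otimes_{\mathbb{Z}}\mathrm{St}(V)$ is indecomposable, i.e. it contains no non-zero proper $\Bbbk[\mathrm{GL}(V)]$-module direct summands.
   Context: A commutative ring is connected if it has no non-trivial idempotents. The Tits building $T(V)$ is the realisation of the nerve of the poset of proper non-zero linear subspaces of $V$, ordered by inclusion; it is homotopy equivalent to a wedge of spheres of dimension $\dim(V)-2$. The Steinberg module is the $\mathbb{Z}[\mathrm{GL}(V)]$-module $\mathrm{St}(V)=\widetilde{H}_{\dim(V)-2}(T(V);\mathbb{Z})$ (for $\dim V=1$, $T(V)=\varnothing$ and $\mathrm{St}(V)=\widetilde H_{-1}(\varnothing)=\mathbb{Z}$). *)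

theory Defs
  imports "HOL-Homology.Homology" "HOL-Algebra.Module"
begin

section \<open>Realisation of the nerve of a poset\<close>

text \<open>The set of \<open>p\<close>-simplices of the nerve, degenerate ones included.\<close>

definition nerve_simplices :: "'a::order set \<Rightarrow> nat \<Rightarrow> (nat \<Rightarrow> 'a) set" where
  "nerve_simplices P p = {x. x \<in> {..p} \<rightarrow>\<^sub>E P \<and> mono_on {..p} x}"

text \<open>
  Points of the realisation are written in barycentric coordinates: the point \<open>s\<close> of the standard
  simplex attached to \<open>x\<^sub>0 \<le> \<dots> \<le> x\<^sub>p\<close> is the function that assigns to a vertex \<open>v\<close> the total
  weight of the positions where \<open>v\<close> occurs. Two pairs \<open>(x, s)\<close> yield the same function iff the
  face and degeneracy relations identify them, so that the final topology below is the quotient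
  topology of the disjoint union of the simplices (the weak topology; it is not the product
  topology when the nerve is not locally finite).
\<close>

definition simplex_point :: "nat \<Rightarrow> (nat \<Rightarrow> 'a) \<Rightarrow> (nat \<Rightarrow> real) \<Rightarrow> 'a \<Rightarrow> real" where
  "simplex_point p x s = (\<lambda>v. \<Sum>i | i \<le> p \<and> x i = v. s i)"

definition realisation_points :: "'a::order set \<Rightarrow> ('a \<Rightarrow> real) set" where
  "realisation_points P = (\<Union>p. \<Union>x \<in> nerve_simplices P p. simplex_point p x ` standard_simplex p)"

definition nerve_realisation :: "'a::order set \<Rightarrow> ('a \<Rightarrow> real) topology" where
  "nerve_realisation P = topology (\<lambda>U. U \<subseteq> realisation_points P \<and>
     (\<forall>p. \<forall>x \<in> nerve_simplices P p.
        openin (subtopology (powertop_real UNIV) (standard_simplex p))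
          {s \<in> standard_simplex p. simplex_point p x s \<in> U}))"

lemma openin_nerve_realisation:
  "openin (nerve_realisation P) U \<longleftrightarrow> U \<subseteq> realisation_points P \<and>
     (\<forall>p. \<forall>x \<in> nerve_simplices P p.
        openin (subtopology (powertop_real UNIV) (standard_simplex p))
          {s \<in> standard_simplex p. simplex_point p x s \<in> U})"
proof -
  let ?D = "\<lambda>p. subtopology (powertop_real UNIV) (standard_simplex p)"
  let ?pre = "\<lambda>p x U. {s \<in> standard_simplex p. simplex_point p x s \<in> U}"
  let ?O = "\<lambda>U. U \<subseteq> realisation_points P \<and>
     (\<forall>p. \<forall>x \<in> nerve_simplices P p. openin (?D p) (?pre p x U))"
  have "istopology ?O"
    unfolding istopology_def
  proof (intro conjI allI impI ballI)
    fix S T assume S: "?O S" and T: "?O T"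
    show "S \<inter> T \<subseteq> realisation_points P" using S by blast
    show "openin (?D p) (?pre p x (S \<inter> T))" if "x \<in> nerve_simplices P p" for p x
    proof -
      have eq: "?pre p x (S \<inter> T) = ?pre p x S \<inter> ?pre p x T" by blast
      show ?thesis unfolding eq using S T that by (intro openin_Int) blast+
    qed
  next
    fix K assume K: "\<forall>U \<in> K. ?O U"
    show "\<Union>K \<subseteq> realisation_points P" using K by blast
    show "openin (?D p) (?pre p x (\<Union>K))" if "x \<in> nerve_simplices P p" for p x
    proof -
      have eq: "?pre p x (\<Union>K) = (\<Union>U \<in> K. ?pre p x U)" by blast
      show ?thesis unfolding eq using K that by (intro openin_Union) blast
    qed
  qed
  then show ?thesis
    unfolding nerve_realisation_def by (rule fun_cong[OF topology_inverse'])
qed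

lemma topspace_nerve_realisation: "topspace (nerve_realisation P) = realisation_points P"
proof
  show "topspace (nerve_realisation P) \<subseteq> realisation_points P"
    by (meson openin_nerve_realisation openin_topspace)
  have "openin (subtopology (powertop_real UNIV) (standard_simplex p))
          {s \<in> standard_simplex p. simplex_point p x s \<in> realisation_points P}"
    if "x \<in> nerve_simplices P p" for p x
  proof -
    have "{s \<in> standard_simplex p. simplex_point p x s \<in> realisation_points P} = standard_simplex p"
      using that unfolding realisation_points_def by blast
    then show ?thesis
      by (metis openin_topspace topspace_standard_simplex)
  qed
  then have "openin (nerve_realisation P) (realisation_points P)"
    unfolding openin_nerve_realisation by blast
  then show "realisation_points P \<subseteq> topspace (nerve_realisation P)"
    by (rule openin_subset)
qed


section \<open>Reduced homology, including degree -1\<close>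

text \<open>
  The library's \<^const>\<open>reduced_homology_group\<close> is trivial in negative degrees, also for the empty
  space. In the augmented singular complex of the empty space the only non-zero group is the free
  abelian group, in degree -1, on the unique extensional map out of the empty (-1)-simplex, namely
  \<open>\<lambda>_. undefined\<close>. Dividing by the zero group gives the same type of cosets as in other degrees.
\<close>

definition reduced_homology :: "int \<Rightarrow> 'a topology \<Rightarrow> 'a chain set monoid" where
  "reduced_homology p X =
     (if p = -1 \<and> topspace X = {} then free_Abelian_group {\<lambda>_. undefined} Mod {0}
      else reduced_homology_group p X)"

definition reduced_hom_induced ::
    "int \<Rightarrow> 'a topology \<Rightarrow> ('a \<Rightarrow> 'a) \<Rightarrow> 'a chain set \<Rightarrow> 'a chain set" where
  "reduced_hom_induced p X f =
     (if p = -1 \<and> topspace X = {} then (\<lambda>c. c) else hom_induced p X {} X {} f)"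


section \<open>The Tits building and the Steinberg module\<close>

definition proper_subspaces :: "('f::field \<Rightarrow> 'v::ab_group_add \<Rightarrow> 'v) \<Rightarrow> 'v set set" where
  "proper_subspaces smul = {W. module.subspace smul W \<and> W \<noteq> {0} \<and> W \<noteq> UNIV}"

definition tits_building ::
    "('f::field \<Rightarrow> 'v::ab_group_add \<Rightarrow> 'v) \<Rightarrow> ('v set \<Rightarrow> real) topology" where
  "tits_building smul = nerve_realisation (proper_subspaces smul)"

definition GL :: "('f::field \<Rightarrow> 'v::ab_group_add \<Rightarrow> 'v) \<Rightarrow> ('v \<Rightarrow> 'v) set" where
  "GL smul = {g. Vector_Spaces.linear smul smul g \<and> bij g}"

text \<open>Since \<open>g\<close> is bijective, this moves the weight of the vertex \<open>W\<close> to the vertex \<open>g ` W\<close>.\<close>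

definition building_map :: "('v \<Rightarrow> 'v) \<Rightarrow> ('v set \<Rightarrow> real) \<Rightarrow> ('v set \<Rightarrow> real)" where
  "building_map g t = (\<lambda>W. t (g -` W))"

definition steinberg ::
    "('f::field \<Rightarrow> 'v::ab_group_add \<Rightarrow> 'v) \<Rightarrow> ('v set \<Rightarrow> real) chain set monoid" where
  "steinberg smul =
     reduced_homology (int (vector_space.dim smul (UNIV :: 'v set)) - 2) (tits_building smul)"

definition steinberg_act ::
    "('f::field \<Rightarrow> 'v::ab_group_add \<Rightarrow> 'v) \<Rightarrow> ('v \<Rightarrow> 'v) \<Rightarrow>
     ('v set \<Rightarrow> real) chain set \<Rightarrow> ('v set \<Rightarrow> real) chain set" where
  "steinberg_act smul g =
     reduced_hom_induced (int (vector_space.dim smul (UNIV :: 'v set)) - 2) (tits_building smul)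
       (building_map g)"


section \<open>Extension of scalars along the integers\<close>

text \<open>
  The tensor product over the integers of (the additive group of) a ring \<open>R\<close> and an abelian group
  \<open>A\<close>, written multiplicatively: the free abelian group on \<open>R \<times> A\<close> modulo the bilinearity relations.
\<close>

definition tensor_relations ::
    "('k, 'm) ring_scheme \<Rightarrow> ('a, 'n) monoid_scheme \<Rightarrow> ('k \<times> 'a \<Rightarrow>\<^sub>0 int) set" where
  "tensor_relations R A =
     generate (free_Abelian_group (carrier R \<times> carrier A))
       ({frag_of (r \<oplus>\<^bsub>R\<^esub> s, x) - frag_of (r, x) - frag_of (s, x) | r s x.
           r \<in> carrier R \<and> s \<in> carrier R \<and> x \<in> carrier A} \<union>
        {frag_of (r, x \<otimes>\<^bsub>A\<^esub> y) - frag_of (r, x) - frag_of (r, y) | r x y.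
           r \<in> carrier R \<and> x \<in> carrier A \<and> y \<in> carrier A})"

text \<open>
  The map of cosets induced by a map \<open>h\<close> of generators (which has to respect the relations):
  the sum of the relations and the image of a coset is the coset of the image.
\<close>

definition tensor_induced ::
    "('k, 'm) ring_scheme \<Rightarrow> ('a, 'n) monoid_scheme \<Rightarrow> ('k \<times> 'a \<Rightarrow> 'k \<times> 'a) \<Rightarrow>
     ('k \<times> 'a \<Rightarrow>\<^sub>0 int) set \<Rightarrow> ('k \<times> 'a \<Rightarrow>\<^sub>0 int) set" where
  "tensor_induced R A h C =
     tensor_relations R A <#>\<^bsub>free_Abelian_group (carrier R \<times> carrier A)\<^esub>
       (frag_extend (\<lambda>z. frag_of (h z)) ` C)"

text \<open>The fields \<open>mult\<close> and \<open>one\<close> are part of the library's record type but play no role for modules.\<close>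

definition tensor_module ::
    "('k, 'm) ring_scheme \<Rightarrow> ('a, 'n) monoid_scheme \<Rightarrow> ('k, ('k \<times> 'a \<Rightarrow>\<^sub>0 int) set) module" where
  "tensor_module R A =
     (let Q = free_Abelian_group (carrier R \<times> carrier A) Mod tensor_relations R A
      in \<lparr>carrier = carrier Q, monoid.mult = undefined, one = undefined,
          zero = \<one>\<^bsub>Q\<^esub>, add = monoid.mult Q,
          smult = (\<lambda>r. tensor_induced R A (\<lambda>(s, x). (r \<otimes>\<^bsub>R\<^esub> s, x)))\<rparr>)"

definition tensor_map ::
    "('k, 'm) ring_scheme \<Rightarrow> ('a, 'n) monoid_scheme \<Rightarrow> ('a \<Rightarrow> 'a) \<Rightarrow>
     ('k \<times> 'a \<Rightarrow>\<^sub>0 int) set \<Rightarrow> ('k \<times> 'a \<Rightarrow>\<^sub>0 int) set" where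
  "tensor_map R A f = tensor_induced R A (\<lambda>(s, x). (s, f x))"


section \<open>Connected rings and indecomposable modules over a group ring\<close>

text \<open>No idempotents other than 0 and 1; the zero ring is not excluded.\<close>

definition connected_ring :: "('k, 'm) ring_scheme \<Rightarrow> bool" where
  "connected_ring R \<longleftrightarrow>
     (\<forall>e \<in> carrier R. e \<otimes>\<^bsub>R\<^esub> e = e \<longrightarrow> e = \<zero>\<^bsub>R\<^esub> \<or> e = \<one>\<^bsub>R\<^esub>)"

text \<open>
  An element of the group ring \<open>R[G]\<close> is a finitely supported function \<open>a\<close> on \<open>G\<close>; it acts on an
  \<open>R\<close>-module \<open>M\<close> with linear \<open>G\<close>-action \<open>\<rho>\<close> by \<open>x \<mapsto> \<Sum>\<^sub>g a(g) \<rho>(g)(x)\<close>.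
\<close>

definition group_ring_elements :: "'g set \<Rightarrow> ('k, 'm) ring_scheme \<Rightarrow> ('g \<Rightarrow> 'k) set" where
  "group_ring_elements G R = {a \<in> G \<rightarrow> carrier R. finite {g \<in> G. a g \<noteq> \<zero>\<^bsub>R\<^esub>}}"

definition group_ring_smult ::
    "'g set \<Rightarrow> ('k, 'm) ring_scheme \<Rightarrow> ('k, 'a, 'n) module_scheme \<Rightarrow> ('g \<Rightarrow> 'a \<Rightarrow> 'a) \<Rightarrow>
     ('g \<Rightarrow> 'k) \<Rightarrow> 'a \<Rightarrow> 'a" where
  "group_ring_smult G R M \<rho> a x =
     (\<Oplus>\<^bsub>M\<^esub>g \<in> {g \<in> G. a g \<noteq> \<zero>\<^bsub>R\<^esub>}. a g \<odot>\<^bsub>M\<^esub> \<rho> g x)"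

definition group_ring_submodule ::
    "'g set \<Rightarrow> ('k, 'm) ring_scheme \<Rightarrow> ('k, 'a, 'n) module_scheme \<Rightarrow> ('g \<Rightarrow> 'a \<Rightarrow> 'a) \<Rightarrow>
     'a set \<Rightarrow> bool" where
  "group_ring_submodule G R M \<rho> N \<longleftrightarrow> subgroup N (add_monoid M) \<and>
     (\<forall>a \<in> group_ring_elements G R. \<forall>x \<in> N. group_ring_smult G R M \<rho> a x \<in> N)"

definition group_ring_direct_summand ::
    "'g set \<Rightarrow> ('k, 'm) ring_scheme \<Rightarrow> ('k, 'a, 'n) module_scheme \<Rightarrow> ('g \<Rightarrow> 'a \<Rightarrow> 'a) \<Rightarrow>
     'a set \<Rightarrow> bool" where
  "group_ring_direct_summand G R M \<rho> N \<longleftrightarrow> group_ring_submodule G R M \<rho> N \<and>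
     (\<exists>N'. group_ring_submodule G R M \<rho> N' \<and>
           N \<inter> N' = {\<zero>\<^bsub>M\<^esub>} \<and> N <+>\<^bsub>M\<^esub> N' = carrier M)"

definition group_ring_indecomposable ::
    "'g set \<Rightarrow> ('k, 'm) ring_scheme \<Rightarrow> ('k, 'a, 'n) module_scheme \<Rightarrow> ('g \<Rightarrow> 'a \<Rightarrow> 'a) \<Rightarrow> bool" where
  "group_ring_indecomposable G R M \<rho> \<longleftrightarrow>
     \<not> (\<exists>N. group_ring_direct_summand G R M \<rho> N \<and> N \<noteq> {\<zero>\<^bsub>M\<^esub>} \<and> N \<noteq> carrier M)"

end

theory Submission
  imports Defs "HOL-Analysis.Abstract_Topological_Spaces" "HOL-Combinatorics.Permutations"
begin

text \<open>
  Let \<open>V\<close> have dimension \<open>N + 1\<close>. The proof replaces the Steinberg module by a group of flags,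
  finds a basis of it on which enough of \<open>GL(V)\<close> acts transitively, and then shows that the
  projection to a direct summand is multiplication by an idempotent scalar.

  The proper non-zero subspaces form a poset that is graded by the dimension, with \<open>N\<close> levels. For
  every such poset the reduced homology of the realisation vanishes from degree \<open>N\<close> on, and in degree
  \<open>N - 1\<close> it is the group of integral cycles of full flags (\<open>homology_by_flags\<close>). This is proved by
  induction on the number of levels: modulo the part below the top level, the realisation is a wedge
  of cones modulo their bases, one for each element \<open>m\<close> of the top level, and the base of the cone
  with apex \<open>m\<close> is the realisation of the elements below \<open>m\<close>. Excision is made explicit by a
  deformation \<open>push_off\<close> that moves points away from the top level. As a consequence \<open>St(V)\<close> is
  equivariantly isomorphic to the group of cycles of full flags of \<open>V\<close> (\<open>steinberg_flags\<close>); in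
  dimension one this is the free group on the flag without members.

  Now fix a basis \<open>v\<^sub>0, \<dots>, v\<^sub>N\<close> of \<open>V\<close> and let \<open>F\<close> be the flag of the spans of its initial segments.
  A cycle of flags is determined by its coefficients at the flags opposite to \<open>F\<close>
  (\<open>cycle_vanishes\<close>). The apartment \<open>a\<close>, the alternating sum of the flags obtained by permuting the
  basis, is a cycle; the only flag opposite to \<open>F\<close> that it contains is the one of the reversed basis
  (\<open>apartment_cycle\<close>, \<open>opposite_apartment_flag\<close>). The stabiliser of \<open>F\<close> is transitive on the flags
  opposite to \<open>F\<close> (\<open>opposite_transport\<close>). Hence, with elements \<open>b\<^sub>x\<close> of the stabiliser that take
  the reversed flag to \<open>x\<close>, the cycles \<open>b\<^sub>x a\<close> form a basis of \<open>St(V)\<close> which is dual, up to a sign,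
  to the coefficients at the flags \<open>x\<close> opposite to \<open>F\<close>.

  Let \<open>\<Phi>\<close> be the coefficient at \<open>F\<close>, extended to \<open>R \<otimes> St(V)\<close>, and let \<open>\<pi>\<close> be an equivariant projection
  to a direct summand. Both \<open>\<Phi>\<close> and \<open>\<Phi> \<circ> \<pi>\<close> are invariant under the elements \<open>b\<^sub>x\<close>, and \<open>\<Phi>(a) = 1\<close>;
  since the elements \<open>b\<^sub>x a\<close> generate, \<open>\<Phi> \<circ> \<pi> = c \<Phi>\<close> for \<open>c = \<Phi>(\<pi>(a))\<close>. The coefficient at any other flag
  is a translate of \<open>\<Phi>\<close>, so that \<open>\<pi>\<close> multiplies every coefficient by \<open>c\<close>, that is, \<open>\<pi> = c\<close>.
  From \<open>\<pi> \<circ> \<pi> = \<pi>\<close> it follows that \<open>c\<close> is idempotent, hence 0 or 1, and the summand is trivial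
  (\<open>indecomposable_criterion\<close>).
\<close>

section \<open>Topology of the realisation\<close>

abbreviation simplex_top :: "nat \<Rightarrow> (nat \<Rightarrow> real) topology" where
  "simplex_top p \<equiv> subtopology (powertop_real UNIV) (standard_simplex p)"

text \<open>
  The affine extension of a function on the vertices. Coordinates and the total weight on a set of
  vertices are instances, which is how their continuity is obtained.
\<close>

definition weight :: "('a \<Rightarrow> real) \<Rightarrow> ('a \<Rightarrow> real) \<Rightarrow> real" where
  "weight f t = (\<Sum>v | t v \<noteq> 0. f v * t v)"

lemma weight_simplex_point: "weight f (simplex_point p x s) = (\<Sum>i\<le>p. f (x i) * s i)"
proof -
  have "(\<Sum>i\<le>p. f (x i) * s i) = (\<Sum>v \<in> x ` {..p}. \<Sum>i | i \<in> {..p} \<and> x i = v. f (x i) * s i)"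
    by (rule sum.image_gen) simp
  also have "\<dots> = (\<Sum>v \<in> x ` {..p}. f v * simplex_point p x s v)"
    by (rule sum.cong) (auto simp: simplex_point_def sum_distrib_left intro!: sum.cong)
  also have "\<dots> = (\<Sum>v | simplex_point p x s v \<noteq> 0. f v * simplex_point p x s v)"
  proof (rule sum.mono_neutral_right)
    show "{v. simplex_point p x s v \<noteq> 0} \<subseteq> x ` {..p}"
    proof
      fix v assume "v \<in> {v. simplex_point p x s v \<noteq> 0}"
      show "v \<in> x ` {..p}"
      proof (rule ccontr)
        assume "v \<notin> x ` {..p}"
        then have "{i. i \<le> p \<and> x i = v} = {}" by auto
        then have "simplex_point p x s v = 0" unfolding simplex_point_def by (simp only: sum.empty)
        with \<open>v \<in> {v. simplex_point p x s v \<noteq> 0}\<close> show False by simp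
      qed
    qed
  qed auto
  finally show ?thesis by (simp add: weight_def)
qed

lemma simplex_point_alt: "simplex_point p x s v = (\<Sum>i\<le>p. if x i = v then s i else 0)"
  unfolding simplex_point_def by (subst sum.inter_filter[symmetric]) (auto intro!: sum.cong)

lemma simplex_point_pos_iff:
  assumes "s \<in> standard_simplex p"
  shows "simplex_point p x s v \<noteq> 0 \<longleftrightarrow> (\<exists>i\<le>p. x i = v \<and> s i \<noteq> 0)"
proof -
  have "simplex_point p x s v = 0 \<longleftrightarrow> (\<forall>i \<in> {i. i \<le> p \<and> x i = v}. s i = 0)"
    unfolding simplex_point_def using assms
    by (intro sum_nonneg_eq_0_iff) (auto simp: standard_simplex_def)
  then show ?thesis by auto
qed

lemma realisation_points_support:
  assumes "t \<in> realisation_points P" "t v \<noteq> 0" shows "v \<in> P"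
  using assms by (auto simp: realisation_points_def simplex_point_pos_iff nerve_simplices_def)

lemma realisation_points_chain:
  assumes "t \<in> realisation_points P" "t v \<noteq> 0" "t w \<noteq> 0" shows "v \<le> w \<or> w \<le> v"
proof -
  obtain p x s where x: "x \<in> nerve_simplices P p" and s: "s \<in> standard_simplex p"
    and t: "t = simplex_point p x s"
    using assms(1) by (auto simp: realisation_points_def)
  obtain i j where "i \<le> p" "j \<le> p" "x i = v" "x j = w"
    using assms(2,3) simplex_point_pos_iff[OF s] unfolding t by metis
  then show ?thesis
    using x nle_le[of i j] unfolding nerve_simplices_def mono_on_def by auto
qed

lemma simplex_point_in_realisation:
  "\<lbrakk>x \<in> nerve_simplices P p; s \<in> standard_simplex p\<rbrakk> \<Longrightarrow> simplex_point p x s \<in> realisation_points P"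
  by (auto simp: realisation_points_def)

lemma nerve_simplices_mono: "Q \<subseteq> P \<Longrightarrow> nerve_simplices Q p \<subseteq> nerve_simplices P p"
  by (auto simp: nerve_simplices_def PiE_def Pi_def)

lemma realisation_points_mono: "Q \<subseteq> P \<Longrightarrow> realisation_points Q \<subseteq> realisation_points P"
  unfolding realisation_points_def using nerve_simplices_mono[of Q P] by blast

lemma realisation_points_empty [simp]: "realisation_points {} = {}"
  by (auto simp: realisation_points_def nerve_simplices_def)

subsection \<open>Continuity\<close>

lemma continuous_map_nerve_realisation:
  assumes "\<And>p x. x \<in> nerve_simplices P p \<Longrightarrow> continuous_map (simplex_top p) Y (g \<circ> simplex_point p x)"
  shows "continuous_map (nerve_realisation P) Y g"
  unfolding continuous_map_def topspace_nerve_realisation openin_nerve_realisation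
proof (intro conjI allI impI ballI)
  show "g \<in> realisation_points P \<rightarrow> topspace Y"
    using assms unfolding realisation_points_def
    by (fastforce simp: continuous_map_def Pi_iff)
next
  fix U p x assume U: "openin Y U" and x: "x \<in> nerve_simplices P p"
  have "{s \<in> standard_simplex p. simplex_point p x s \<in> {t \<in> realisation_points P. g t \<in> U}}
      = {s \<in> topspace (simplex_top p). (g \<circ> simplex_point p x) s \<in> U}"
    using x by (auto simp: simplex_point_in_realisation)
  then show "openin (simplex_top p)
       {s \<in> standard_simplex p. simplex_point p x s \<in> {t \<in> realisation_points P. g t \<in> U}}"
    using openin_continuous_map_preimage[OF assms[OF x] U] by simp
qed auto

lemma continuous_map_simplex_point:
  assumes "x \<in> nerve_simplices P p"
  shows "continuous_map (simplex_top p) (nerve_realisation P) (simplex_point p x)"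
  unfolding continuous_map_def topspace_nerve_realisation openin_nerve_realisation
  using assms by (auto simp: simplex_point_in_realisation)

lemma continuous_map_simplex_coordinate:
  "continuous_map (simplex_top p) euclideanreal (\<lambda>s. s i)"
  by (rule continuous_map_from_subtopology, rule continuous_map_product_projection, rule UNIV_I)

lemma continuous_map_weight: "continuous_map (nerve_realisation P) euclideanreal (weight f)"
  by (intro continuous_map_nerve_realisation)
     (auto simp: o_def weight_simplex_point intro!: continuous_map_sum continuous_map_real_mult
       continuous_map_simplex_coordinate)

lemma weight_indicator:
  assumes "t \<in> realisation_points P"
  shows "weight (indicat_real {v}) t = t v"
proof -
  obtain p x s where t: "t = simplex_point p x s"
    using assms by (auto simp: realisation_points_def)
  have "weight (indicat_real {v}) t = (\<Sum>i\<le>p. if x i = v then s i else 0)"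
    unfolding t weight_simplex_point by (intro sum.cong) auto
  also have "\<dots> = t v"
    unfolding t by (rule simplex_point_alt[symmetric])
  finally show ?thesis .
qed

lemma continuous_map_coordinate: "continuous_map (nerve_realisation P) euclideanreal (\<lambda>t. t v)"
  using continuous_map_weight[of P "indicat_real {v}"]
  by (rule continuous_map_eq) (simp add: topspace_nerve_realisation weight_indicator)

lemma quotient_map_nerve_realisation:
  "quotient_map (sum_topology (\<lambda>(p, x). simplex_top p) (Sigma UNIV (nerve_simplices P)))
     (nerve_realisation P) (\<lambda>((p, x), s). simplex_point p x s)"
  unfolding quotient_map_def
proof (intro conjI allI impI)
  show "(\<lambda>((p, x), s). simplex_point p x s) `
      topspace (sum_topology (\<lambda>(p, x). simplex_top p) (Sigma UNIV (nerve_simplices P))) =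
      topspace (nerve_realisation P)"
    unfolding topspace_nerve_realisation realisation_points_def
    by (fastforce simp: image_iff)
next
  fix U assume "U \<subseteq> topspace (nerve_realisation P)"
  then show "openin (sum_topology (\<lambda>(p, x). simplex_top p) (Sigma UNIV (nerve_simplices P)))
      {z \<in> topspace (sum_topology (\<lambda>(p, x). simplex_top p) (Sigma UNIV (nerve_simplices P))).
         (case z of (a, b) \<Rightarrow> (case a of (p, x) \<Rightarrow> simplex_point p x) b) \<in> U}
      = openin (nerve_realisation P) U"
    unfolding openin_nerve_realisation openin_sum_topology topspace_nerve_realisation
    by (auto simp: subset_iff)
qed

lemma continuous_map_prod_sum_topology:
  assumes "\<And>i. i \<in> I \<Longrightarrow> continuous_map (prod_topology Z (X i)) Y (\<lambda>(u, s). h (u, (i, s)))"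
  shows "continuous_map (prod_topology Z (sum_topology X I)) Y h"
proof (rule pasting_lemma[where I = I and T = "\<lambda>i. topspace Z \<times> ({i} \<times> topspace (X i))" and f = "\<lambda>i. h"])
  fix i assume i: "i \<in> I"
  have "openin (sum_topology X I) ({i} \<times> topspace (X i))"
    unfolding openin_sum_topology
  proof (intro conjI ballI)
    fix j assume "j \<in> I"
    show "openin (X j) {x. (j, x) \<in> {i} \<times> topspace (X i)}"
      by (cases "j = i") auto
  qed (use i in auto)
  then show "openin (prod_topology Z (sum_topology X I)) (topspace Z \<times> {i} \<times> topspace (X i))"
    by (simp add: openin_prod_Times_iff)
  let ?S = "subtopology (prod_topology Z (sum_topology X I)) (topspace Z \<times> {i} \<times> topspace (X i))"
  have snd: "continuous_map (subtopology (sum_topology X I) ({i} \<times> topspace (X i))) (X i) snd"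
    unfolding continuous_map_def openin_subtopology
  proof (intro conjI allI impI)
    fix U assume U: "openin (X i) U"
    have "openin (X j) {x. (j, x) \<in> {i} \<times> U}" for j
      using U by (cases "j = i") auto
    then have "openin (sum_topology X I) ({i} \<times> U)"
      using i openin_subset[OF U] unfolding openin_sum_topology by auto
    moreover have "{x \<in> topspace (subtopology (sum_topology X I) ({i} \<times> topspace (X i))). snd x \<in> U}
       = {i} \<times> U \<inter> {i} \<times> topspace (X i)"
      using U i openin_subset by fastforce
    ultimately show "\<exists>T. openin (sum_topology X I) T \<and>
        {x \<in> topspace (subtopology (sum_topology X I) ({i} \<times> topspace (X i))). snd x \<in> U}
        = T \<inter> {i} \<times> topspace (X i)" by metis
  qed (use i in auto)
  have S: "?S = prod_topology Z (subtopology (sum_topology X I) ({i} \<times> topspace (X i)))"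
    by (simp add: prod_topology_subtopology)
  have "continuous_map ?S (prod_topology Z (X i)) (\<lambda>z. (fst z, snd (snd z)))"
    unfolding S
    by (intro continuous_map_pairedI continuous_map_fst continuous_map_compose[OF continuous_map_snd snd, unfolded o_def])
  from continuous_map_compose[OF this assms[OF i]]
  show "continuous_map ?S Y h"
    by (rule continuous_map_eq) auto
qed auto

text \<open>
  Homotopies may be defined simplex by simplex: since the interval is locally compact and Hausdorff,
  its product with the quotient map from the sum of all simplices is again a quotient map.
\<close>

lemma continuous_map_interval_nerve_realisation:
  assumes "\<And>p x. x \<in> nerve_simplices P p \<Longrightarrow>
     continuous_map (prod_topology (top_of_set {0..1::real}) (simplex_top p)) Y
       (\<lambda>(u, s). h (u, simplex_point p x s))"
  shows "continuous_map (prod_topology (top_of_set {0..1::real}) (nerve_realisation P)) Y h"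
proof (rule continuous_compose_quotient_map)
  show "quotient_map (prod_topology (top_of_set {0..1::real})
         (sum_topology (\<lambda>(p, x). simplex_top p) (Sigma UNIV (nerve_simplices P))))
      (prod_topology (top_of_set {0..1::real}) (nerve_realisation P))
      (\<lambda>(u, z). (u, (\<lambda>((p, x), s). simplex_point p x s) z))"
    by (intro quotient_map_prod_right quotient_map_nerve_realisation)
       (auto simp: Hausdorff_space_subtopology intro!: compact_imp_locally_compact_space compact_space_subtopology)
  show "continuous_map (prod_topology (top_of_set {0..1::real})
         (sum_topology (\<lambda>(p, x). simplex_top p) (Sigma UNIV (nerve_simplices P)))) Y
      (h \<circ> (\<lambda>(u, z). (u, (\<lambda>((p, x), s). simplex_point p x s) z)))"
    by (rule continuous_map_prod_sum_topology) (use assms in \<open>auto simp: o_def\<close>)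
qed

subsection \<open>Subcomplexes\<close>

text \<open>
  Degenerate simplices allow a simplex to be replaced by one of the same dimension with vertices in
  \<open>Q\<close>, instead of one of its faces: a vertex outside \<open>Q\<close> has coordinate 0, so that it can be exchanged
  for a neighbouring vertex in \<open>Q\<close>.
\<close>

lemma push_simplex_into_subset:
  assumes x: "x \<in> nerve_simplices P p" and j: "j \<le> p" "x j \<in> Q"
  obtains y where "y \<in> nerve_simplices Q p"
    and "\<And>s. \<lbrakk>s \<in> standard_simplex p; \<And>i. \<lbrakk>i \<le> p; x i \<notin> Q\<rbrakk> \<Longrightarrow> s i = 0\<rbrakk>
       \<Longrightarrow> simplex_point p x s = simplex_point p y s"
proof -
  define j0 where "j0 = (LEAST j. j \<le> p \<and> x j \<in> Q)"
  have j0: "j0 \<le> p" "x j0 \<in> Q" and least: "\<And>i. i \<le> p \<Longrightarrow> x i \<in> Q \<Longrightarrow> j0 \<le> i"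
    unfolding j0_def using LeastI[of "\<lambda>j. j \<le> p \<and> x j \<in> Q" j] j by (auto intro: Least_le)
  \<comment> \<open>the last position up to \<open>i\<close> with a vertex in \<open>Q\<close>, or the first such position of all\<close>
  define \<rho> where "\<rho> i = (if i < j0 then j0 else Max {k. k \<le> i \<and> x k \<in> Q})" for i
  have \<rho>: "\<rho> i \<le> i \<and> x (\<rho> i) \<in> Q" if "j0 \<le> i" for i
  proof -
    have "Max {k. k \<le> i \<and> x k \<in> Q} \<in> {k. k \<le> i \<and> x k \<in> Q}"
      using that j0 by (intro Max_in) auto
    then show ?thesis using that by (simp add: \<rho>_def)
  qed
  have \<rho>Q: "x (\<rho> i) \<in> Q" for i
    using \<rho>[of i] j0 by (cases "i < j0") (auto simp: \<rho>_def)
  have \<rho>p: "\<rho> i \<le> p" if "i \<le> p" for i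
    using \<rho>[of i] j0 that by (cases "i < j0") (auto simp: \<rho>_def)
  have \<rho>id: "\<rho> i = i" if "i \<le> p" "x i \<in> Q" for i
  proof -
    have "i \<le> Max {k. k \<le> i \<and> x k \<in> Q}" using that by (intro Max_ge) auto
    then show ?thesis using \<rho>[of i] least[OF that] by (simp add: \<rho>_def)
  qed
  have \<rho>j0: "j0 \<le> \<rho> i" if "i \<le> p" for i
    using least[of "\<rho> i"] \<rho>p[OF that] \<rho>Q by simp
  have mono: "\<rho> i \<le> \<rho> k" if "i \<le> k" "k \<le> p" for i k
  proof (cases "i < j0")
    case True then show ?thesis using \<rho>j0[of k] that by (simp add: \<rho>_def)
  next
    case False
    then show ?thesis using that j0 by (auto simp: \<rho>_def intro!: Max_mono)
  qed
  let ?y = "restrict (x \<circ> \<rho>) {..p}"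
  show thesis
  proof
    show "?y \<in> nerve_simplices Q p"
      using x mono \<rho>p \<rho>Q unfolding nerve_simplices_def
      by (auto simp: mono_on_def)
    fix s assume s: "s \<in> standard_simplex p" "\<And>i. \<lbrakk>i \<le> p; x i \<notin> Q\<rbrakk> \<Longrightarrow> s i = 0"
    show "simplex_point p x s = simplex_point p ?y s"
    proof
      fix v
      have "simplex_point p x s v = (\<Sum>i\<le>p. if x i = v then s i else 0)"
        by (rule simplex_point_alt)
      also have "\<dots> = (\<Sum>i\<le>p. if ?y i = v then s i else 0)"
        using \<rho>id s(2) by (intro sum.cong) (auto, metis+)
      also have "\<dots> = simplex_point p ?y s v"
        by (rule simplex_point_alt[symmetric])
      finally show "simplex_point p x s v = simplex_point p ?y s v" .
    qed
  qed
qed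

lemma realisation_points_iff_support:
  assumes "Q \<subseteq> P"
  shows "t \<in> realisation_points Q \<longleftrightarrow> t \<in> realisation_points P \<and> (\<forall>v. t v \<noteq> 0 \<longrightarrow> v \<in> Q)"
proof
  assume "t \<in> realisation_points Q"
  then show "t \<in> realisation_points P \<and> (\<forall>v. t v \<noteq> 0 \<longrightarrow> v \<in> Q)"
    using realisation_points_mono[OF assms] realisation_points_support by blast
next
  assume R: "t \<in> realisation_points P \<and> (\<forall>v. t v \<noteq> 0 \<longrightarrow> v \<in> Q)"
  then obtain p x s where x: "x \<in> nerve_simplices P p" and s: "s \<in> standard_simplex p"
    and t: "t = simplex_point p x s"
    by (auto simp: realisation_points_def)
  have z: "\<And>i. \<lbrakk>i \<le> p; x i \<notin> Q\<rbrakk> \<Longrightarrow> s i = 0"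
    using R simplex_point_pos_iff[OF s] unfolding t by metis
  have "sum s {..p} = 1" using s by (simp add: standard_simplex_def)
  then obtain j where "j \<le> p" "s j \<noteq> 0"
    by (metis atMost_iff sum.neutral zero_neq_one)
  with z obtain y where "y \<in> nerve_simplices Q p" "simplex_point p x s = simplex_point p y s"
    using push_simplex_into_subset[OF x] s by metis
  then show "t \<in> realisation_points Q"
    using s t simplex_point_in_realisation by metis
qed

lemma closedin_nerve_realisation:
  "closedin (nerve_realisation P) C \<longleftrightarrow> C \<subseteq> realisation_points P \<and>
     (\<forall>p. \<forall>x \<in> nerve_simplices P p.
        closedin (simplex_top p) {s \<in> standard_simplex p. simplex_point p x s \<in> C})"
proof -
  have "{s \<in> standard_simplex p. simplex_point p x s \<in> realisation_points P - C}
     = standard_simplex p - {s \<in> standard_simplex p. simplex_point p x s \<in> C}"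
    if "x \<in> nerve_simplices P p" for p x
    using that simplex_point_in_realisation by blast
  then show ?thesis
    unfolding closedin_def topspace_nerve_realisation openin_nerve_realisation
    by (auto simp: topspace_standard_simplex)
qed

text \<open>
  Pulled back to a simplex with vertices in \<open>P\<close>, a subset of the subcomplex lives on the closed face
  of the vertices in \<open>Q\<close>, and there it is the pull-back to a simplex with vertices in \<open>Q\<close>.
\<close>

lemma closedin_subcomplex:
  assumes Q: "Q \<subseteq> P" and C: "closedin (nerve_realisation Q) C"
  shows "closedin (nerve_realisation P) C"
  unfolding closedin_nerve_realisation
proof (intro conjI allI ballI)
  show "C \<subseteq> realisation_points P"
    using C realisation_points_mono[OF Q] by (auto simp: closedin_nerve_realisation)
  fix p x assume x: "x \<in> nerve_simplices P p"
  let ?E = "{s \<in> standard_simplex p. simplex_point p x s \<in> C}"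
  have sub: "s i = 0" if "s \<in> ?E" "i \<le> p" "x i \<notin> Q" for s i
    using that C realisation_points_support[of "simplex_point p x s" Q] simplex_point_pos_iff[of s p x]
    by (auto simp: closedin_nerve_realisation subset_iff)
  show "closedin (simplex_top p) ?E"
  proof (cases "\<exists>j\<le>p. x j \<in> Q")
    case True
    then obtain y where y: "y \<in> nerve_simplices Q p"
      and eq: "\<And>s. \<lbrakk>s \<in> standard_simplex p; \<And>i. \<lbrakk>i \<le> p; x i \<notin> Q\<rbrakk> \<Longrightarrow> s i = 0\<rbrakk>
         \<Longrightarrow> simplex_point p x s = simplex_point p y s"
      using push_simplex_into_subset[OF x] by metis
    have E: "?E = {s \<in> standard_simplex p. simplex_point p y s \<in> C} \<inter>
         {s \<in> topspace (simplex_top p). \<forall>i \<in> {i. i \<le> p \<and> x i \<notin> Q}. s i \<in> {0}}" (is "_ = ?A \<inter> ?B")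
    proof (intro equalityI subsetI)
      fix s assume s: "s \<in> ?E"
      then show "s \<in> ?A \<inter> ?B" using sub[OF s] eq[of s] by auto
    next
      fix s assume "s \<in> ?A \<inter> ?B"
      then show "s \<in> ?E" using eq[of s] by auto
    qed
    have "?B = topspace (simplex_top p) \<inter> (\<Inter>i \<in> {i. i \<le> p \<and> x i \<notin> Q}. {s \<in> topspace (simplex_top p). s i \<in> {0}})"
      by auto
    moreover have "closedin (simplex_top p) \<dots>"
    proof (cases "{i. i \<le> p \<and> x i \<notin> Q} = {}")
      case False
      then show ?thesis
        by (intro closedin_Int closedin_INT closedin_topspace
            closedin_continuous_map_preimage[OF continuous_map_simplex_coordinate]) auto
    next
      case True
      show ?thesis unfolding True by simp
    qed
    ultimately show ?thesis
      unfolding E using C y by (auto simp: closedin_nerve_realisation intro!: closedin_Int)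
  next
    case False
    then have "?E = {}"
    proof -
      have "sum s {..p} = 0" if "s \<in> ?E" for s
        using sub[OF that] False by (intro sum.neutral) auto
      then show ?thesis by (auto simp: standard_simplex_def)
    qed
    then show ?thesis by (simp only: closedin_empty)
  qed
qed

text \<open>
  The final topology on the smaller realisation is the subspace topology because of
  \<open>closedin_subcomplex\<close>. Pairs of posets thus become pairs of spaces.
\<close>

lemma subtopology_nerve_realisation:
  assumes "Q \<subseteq> P"
  shows "subtopology (nerve_realisation P) (realisation_points Q) = nerve_realisation Q"
proof (rule topology_eq[THEN iffD2], rule allI)
  fix U
  let ?q = "realisation_points Q" and ?p = "realisation_points P"
  have qp: "?q \<subseteq> ?p" using assms by (rule realisation_points_mono)
  have N: "nerve_simplices Q p \<subseteq> nerve_simplices P p" for p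
    using assms by (rule nerve_simplices_mono)
  show "openin (subtopology (nerve_realisation P) ?q) U \<longleftrightarrow> openin (nerve_realisation Q) U"
  proof
    assume "openin (subtopology (nerve_realisation P) ?q) U"
    then obtain T where T: "openin (nerve_realisation P) T" "U = T \<inter> ?q"
      by (auto simp: openin_subtopology)
    have "{s \<in> standard_simplex p. simplex_point p x s \<in> U}
        = {s \<in> standard_simplex p. simplex_point p x s \<in> T}"
      if "x \<in> nerve_simplices Q p" for p x
      using that simplex_point_in_realisation T(2) by blast
    moreover have "openin (simplex_top p) {s \<in> standard_simplex p. simplex_point p x s \<in> T}"
      if "x \<in> nerve_simplices Q p" for p x
      using that T(1) N[of p] unfolding openin_nerve_realisation by blast
    ultimately show "openin (nerve_realisation Q) U"
      using T(2) unfolding openin_nerve_realisation by auto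
  next
    assume U: "openin (nerve_realisation Q) U"
    then have "closedin (nerve_realisation P) (?q - U)"
      using closedin_subcomplex[OF assms] by (metis closedin_diff closedin_topspace topspace_nerve_realisation)
    then have "openin (nerve_realisation P) (?p - (?q - U))"
      by (metis openin_diff openin_topspace topspace_nerve_realisation)
    moreover have "U = (?p - (?q - U)) \<inter> ?q"
      using U qp by (auto simp: openin_nerve_realisation)
    ultimately show "openin (subtopology (nerve_realisation P) ?q) U"
      unfolding openin_subtopology by blast
  qed
qed

lemma closedin_realisation_points:
  "Q \<subseteq> P \<Longrightarrow> closedin (nerve_realisation P) (realisation_points Q)"
  by (metis closedin_subcomplex closedin_topspace topspace_nerve_realisation)


section \<open>Homotopies\<close>

lemma continuous_map_into_simplex_point:
  assumes y: "y \<in> nerve_simplices P q"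
    and g: "\<And>z i. z \<in> topspace Z \<Longrightarrow> g z \<in> standard_simplex q"
    and c: "\<And>i. continuous_map Z euclideanreal (\<lambda>z. g z i)"
  shows "continuous_map Z (nerve_realisation P) (\<lambda>z. simplex_point q y (g z))"
proof -
  have "continuous_map Z (simplex_top q) g"
    using g c by (auto simp: continuous_map_in_subtopology continuous_map_componentwise_UNIV)
  from continuous_map_compose[OF this continuous_map_simplex_point[OF y]]
  show ?thesis by (simp add: o_def)
qed

lemma continuous_map_fst_interval: "continuous_map (prod_topology (top_of_set S) Z) euclideanreal fst"
  by (metis continuous_map_fst continuous_map_into_fulltopology)

lemma continuous_map_snd_coordinate:
  "continuous_map (prod_topology Z (simplex_top p)) euclideanreal (\<lambda>z. snd z i)"
  using continuous_map_compose[OF continuous_map_snd continuous_map_simplex_coordinate]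
  by (simp add: o_def)

lemma vertex_in_realisation: "m \<in> P \<Longrightarrow> indicat_real {m} \<in> realisation_points P"
proof -
  assume m: "m \<in> P"
  let ?x = "\<lambda>i\<in>{..0::nat}. m" and ?s = "\<lambda>j::nat. if j = 0 then 1 else (0::real)"
  have x: "?x \<in> nerve_simplices P 0" using m by (auto simp: nerve_simplices_def mono_on_def)
  have s: "?s \<in> standard_simplex 0" by (simp add: standard_simplex_0)
  have "simplex_point 0 ?x ?s = indicat_real {m}"
  proof
    fix v
    have "{i. i \<le> 0 \<and> ?x i = v} = (if v = m then {0} else {})" by auto
    then show "simplex_point 0 ?x ?s v = indicat_real {m} v" unfolding simplex_point_def by simp
  qed
  then show ?thesis using simplex_point_in_realisation[OF x s] by simp
qed

text \<open>
  Every chain in \<open>Q\<close> can be prolonged by \<open>m\<close>, so that the segment from a point to the vertex \<open>m\<close> stays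
  in a simplex.
\<close>

lemma homotopic_to_greatest:
  assumes m: "m \<in> Q" "\<And>v. v \<in> Q \<Longrightarrow> v \<le> m"
  shows "homotopic_with (\<lambda>h. True) (nerve_realisation Q) (nerve_realisation Q) id (\<lambda>_. indicat_real {m})"
proof -
  define h where "h z = (\<lambda>v. (1 - fst z) * snd z v + fst z * indicat_real {m} v)"
    for z :: "real \<times> ('a \<Rightarrow> real)"
  have "continuous_map (prod_topology (top_of_set {0..1}) (nerve_realisation Q)) (nerve_realisation Q) h"
  proof (rule continuous_map_interval_nerve_realisation)
    fix p x assume x: "x \<in> nerve_simplices Q p"
    define y where "y = x(Suc p := m)"
    define g where "g z i = (if i = Suc p then fst z else (1 - fst z) * snd z i)"
      for z :: "real \<times> (nat \<Rightarrow> real)" and i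
    have y: "y \<in> nerve_simplices Q (Suc p)"
      using x m by (auto simp: y_def nerve_simplices_def mono_on_def PiE_iff extensional_def le_Suc_eq)
    have "continuous_map (prod_topology (top_of_set {0..1}) (simplex_top p)) (nerve_realisation Q)
       (\<lambda>z. simplex_point (Suc p) y (g z))"
    proof (rule continuous_map_into_simplex_point[OF y])
      fix z :: "real \<times> (nat \<Rightarrow> real)" and i :: nat
      assume z: "z \<in> topspace (prod_topology (top_of_set {0..1}) (simplex_top p))"
      then have u: "0 \<le> fst z" "fst z \<le> 1" and s: "snd z \<in> standard_simplex p" by auto
      have "(\<Sum>i\<le>Suc p. g z i) = (\<Sum>i\<le>p. (1 - fst z) * snd z i) + fst z"
        by (simp add: g_def)
      then have "(\<Sum>i\<le>Suc p. g z i) = 1"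
        using s by (simp add: standard_simplex_def flip: sum_distrib_left)
      then show "g z \<in> standard_simplex (Suc p)"
        using u s by (auto simp: standard_simplex_def g_def mult_le_one)
    next
      fix i
      show "continuous_map (prod_topology (top_of_set {0..1}) (simplex_top p)) euclideanreal (\<lambda>z. g z i)"
        unfolding g_def
        by (cases "i = Suc p")
          (simp_all add: continuous_map_fst_interval continuous_map_snd_coordinate
            continuous_map_real_mult continuous_map_diff)
    qed
    moreover have "h (fst z, simplex_point p x (snd z)) = simplex_point (Suc p) y (g z)" for z
    proof
      fix v
      have "(\<Sum>i\<le>p. if y i = v then g z i else 0)
          = (1 - fst z) * (\<Sum>i\<le>p. if x i = v then snd z i else 0)"
        unfolding sum_distrib_left by (rule sum.cong) (auto simp: g_def y_def)
      then show "h (fst z, simplex_point p x (snd z)) v = simplex_point (Suc p) y (g z) v"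
        unfolding h_def simplex_point_alt by (simp add: g_def y_def indicator_def)
    qed
    ultimately show "continuous_map (prod_topology (top_of_set {0..1}) (simplex_top p)) (nerve_realisation Q)
       (\<lambda>(u, s). h (u, simplex_point p x s))"
      by (simp add: case_prod_unfold)
  qed
  moreover have "h (0, t) = id t" "h (1, t) = indicat_real {m}" for t
    by (auto simp: h_def)
  ultimately show ?thesis
    unfolding homotopic_with_def by blast
qed

text \<open>
  The map \<open>push_off M 1\<close> moves points away from the vertices in \<open>M\<close>. If \<open>w\<close> is the weight of a point
  on \<open>M\<close>, this weight becomes \<open>max 0 (2 * w - 1)\<close>: coordinates in \<open>M\<close> are multiplied by 0 for
  \<open>w \<le> 1/2\<close> and by \<open>(2 * w - 1) / w\<close> otherwise, coordinates off \<open>M\<close> by \<open>1 / (1 - w)\<close> for \<open>w \<le> 1/2\<close>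
  and by 2 otherwise. The maxima in the denominators express these factors as continuous functions of
  \<open>w\<close> on the whole interval. The parameter \<open>u\<close> interpolates between the identity and this map.
\<close>

definition rescale :: "'a set \<Rightarrow> real \<Rightarrow> real \<Rightarrow> 'a \<Rightarrow> real" where
  "rescale M u w v = (if v \<in> M then (1 - u) + u * (max 0 (2 * w - 1) / max w (1/2))
     else (1 - u) + u / max (1 - w) (1/2))"

definition push_off :: "'a set \<Rightarrow> real \<Rightarrow> ('a \<Rightarrow> real) \<Rightarrow> 'a \<Rightarrow> real" where
  "push_off M u t = (\<lambda>v. rescale M u (weight (indicator M) t) v * t v)"

lemma rescale_nonneg: "\<lbrakk>0 \<le> u; u \<le> 1\<rbrakk> \<Longrightarrow> 0 \<le> rescale M u w v"
  by (auto simp: rescale_def intro!: add_nonneg_nonneg divide_nonneg_nonneg mult_nonneg_nonneg)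

lemma rescale_total:
  fixes w :: real
  assumes "0 \<le> w" "w \<le> 1"
  shows "w * ((1 - u) + u * (max 0 (2 * w - 1) / max w (1/2))) + (1 - w) * ((1 - u) + u / max (1 - w) (1/2)) = 1"
proof -
  have 1: "w * (max 0 (2 * w - 1) / max w (1/2)) = max 0 (2 * w - 1)"
    using assms by (cases "w \<le> 1/2") (auto simp: max_def)
  have 2: "(1 - w) / max (1 - w) (1/2) = 1 - max 0 (2 * w - 1)"
    using assms by (cases "w \<le> 1/2") (auto simp: max_def)
  have "?thesis \<longleftrightarrow> (1 - u) + u * (w * (max 0 (2 * w - 1) / max w (1/2)) + (1 - w) / max (1 - w) (1/2)) = 1"
    by (simp add: algebra_simps)
  then show ?thesis unfolding 1 2 by simp
qed

lemma rescale_simplex: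
  assumes u: "0 \<le> u" "u \<le> 1" and s: "s \<in> standard_simplex p"
  shows "(\<lambda>i. rescale M u (\<Sum>i\<le>p. indicator M (x i) * s i) (x i) * s i) \<in> standard_simplex p"
proof -
  define w where "w = (\<Sum>i\<le>p. indicator M (x i) * s i)"
  let ?a = "(1 - u) + u * (max 0 (2 * w - 1) / max w (1/2))" and ?b = "(1 - u) + u / max (1 - w) (1/2)"
  let ?t = "\<lambda>i. rescale M u w (x i) * s i"
  have s': "\<And>i. 0 \<le> s i" "(\<Sum>i\<le>p. s i) = 1" "\<And>i. i > p \<Longrightarrow> s i = 0"
    using s by (auto simp: standard_simplex_def)
  have w1: "1 - w = (\<Sum>i\<le>p. indicator (- M) (x i) * s i)"
  proof -
    have "w + (\<Sum>i\<le>p. indicator (- M) (x i) * s i) = (\<Sum>i\<le>p. s i)"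
      unfolding w_def sum.distrib[symmetric] by (rule sum.cong) (auto simp: indicator_def)
    then show ?thesis using s' by simp
  qed
  have w: "0 \<le> w" "w \<le> 1"
  proof -
    show "0 \<le> w" unfolding w_def using s' by (auto intro!: sum_nonneg)
    have "0 \<le> 1 - w" unfolding w1 using s' by (auto intro!: sum_nonneg)
    then show "w \<le> 1" by simp
  qed
  have "(\<Sum>i\<le>p. ?t i) = (\<Sum>i\<le>p. (indicator M (x i) * s i) * ?a + (indicator (- M) (x i) * s i) * ?b)"
    by (rule sum.cong) (auto simp: rescale_def indicator_def)
  also have "\<dots> = w * ?a + (1 - w) * ?b"
    unfolding w1 by (simp only: sum.distrib sum_distrib_right w_def)
  finally have sum: "(\<Sum>i\<le>p. ?t i) = 1" using rescale_total[OF w] by simp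
  have nn: "0 \<le> ?t i" for i using rescale_nonneg[OF u] s'(1) by (rule mult_nonneg_nonneg)
  have "?t i \<le> 1" for i
  proof (cases "i \<le> p")
    case True
    then show ?thesis using sum member_le_sum[of i "{..p}" ?t] nn by simp
  qed (use s' in simp)
  then show ?thesis
    using sum nn s' unfolding w_def[symmetric] by (auto simp: standard_simplex_def)
qed

lemma push_off_simplex_point:
  "push_off M u (simplex_point p x s) =
   simplex_point p x (\<lambda>i. rescale M u (\<Sum>i\<le>p. indicator M (x i) * s i) (x i) * s i)"
  unfolding push_off_def weight_simplex_point
  by (auto simp: simplex_point_def sum_distrib_left intro!: ext sum.cong)

lemma continuous_map_rescale:
  assumes "continuous_map Z euclideanreal f" "continuous_map Z euclideanreal g"
  shows "continuous_map Z euclideanreal (\<lambda>z. rescale M (f z) (g z) v)"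
proof (cases "v \<in> M")
  case True
  then show ?thesis unfolding rescale_def
    by (simp, intro continuous_map_add continuous_map_diff continuous_map_real_mult continuous_map_real_divide
        continuous_map_real_max assms continuous_map_canonical_const)
      (auto simp: max_def)
next
  case False
  then show ?thesis unfolding rescale_def
    by (simp, intro continuous_map_add continuous_map_diff continuous_map_real_mult continuous_map_real_divide
        continuous_map_real_max assms continuous_map_canonical_const)
      (auto simp: max_def)
qed

lemma push_off_support: "push_off M u t v \<noteq> 0 \<Longrightarrow> t v \<noteq> 0"
  by (auto simp: push_off_def)

lemma push_off_in_realisation:
  assumes "0 \<le> u" "u \<le> 1" "t \<in> realisation_points P"
  shows "push_off M u t \<in> realisation_points P"
proof -
  obtain p x s where "x \<in> nerve_simplices P p" and s: "s \<in> standard_simplex p" and "t = simplex_point p x s"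
    using assms(3) by (auto simp: realisation_points_def)
  then show ?thesis
    unfolding push_off_simplex_point using rescale_simplex[OF assms(1,2) s] simplex_point_in_realisation
    by (metis (no_types, lifting) push_off_simplex_point)
qed

lemma push_off_clears:
  assumes t: "t \<in> realisation_points P" and w: "weight (indicator M) t \<le> 1/2"
  shows "push_off M 1 t \<in> realisation_points (P - M)"
proof -
  have "push_off M 1 t v = 0" if "v \<in> M" for v
    using that w by (auto simp: push_off_def rescale_def max_def)
  then show ?thesis
    using push_off_in_realisation[OF _ _ t, of 1 M] push_off_support[of M 1 t]
      realisation_points_support[OF t] realisation_points_iff_support[of "P - M" P "push_off M 1 t"] by auto
qed

text \<open>
  Coordinates are only rescaled, so that no new vertex enters the support of a point. The homotopy
  therefore preserves all subcomplexes at once and is a homotopy of every pair.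
\<close>

lemma homotopic_push_off:
  "homotopic_with (\<lambda>h. \<forall>Q. h \<in> realisation_points Q \<rightarrow> realisation_points Q)
     (nerve_realisation P) (nerve_realisation P) id (push_off M 1)"
proof -
  let ?h = "\<lambda>z. push_off M (fst z) (snd z)"
  have "continuous_map (prod_topology (top_of_set {0..1}) (nerve_realisation P)) (nerve_realisation P) ?h"
  proof (rule continuous_map_interval_nerve_realisation)
    fix p x assume x: "x \<in> nerve_simplices P p"
    have "continuous_map (prod_topology (top_of_set {0..1}) (simplex_top p)) (nerve_realisation P)
      (\<lambda>z. simplex_point p x (\<lambda>i. rescale M (fst z) (\<Sum>i\<le>p. indicator M (x i) * snd z i) (x i) * snd z i))"
      by (rule continuous_map_into_simplex_point[OF x])
        (auto intro!: rescale_simplex continuous_map_real_mult continuous_map_rescale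
          continuous_map_snd_coordinate continuous_map_fst_interval continuous_map_sum)
    then show "continuous_map (prod_topology (top_of_set {0..1}) (simplex_top p)) (nerve_realisation P)
       (\<lambda>(u, s). ?h (u, simplex_point p x s))"
      by (simp add: case_prod_unfold push_off_simplex_point)
  qed
  moreover have "push_off M 0 t = t" for t
    by (auto simp: push_off_def rescale_def)
  ultimately show ?thesis
    unfolding homotopic_with_def
    by (intro exI[of _ ?h]) (auto intro: push_off_in_realisation)
qed


section \<open>Flags and their singular simplices\<close>

text \<open>
  The augmentation. Its values are chains on a point rather than integers, so that it commutes with
  \<^const>\<open>frag_extend\<close>.
\<close>

definition coefficient_sum :: "('a \<Rightarrow>\<^sub>0 int) \<Rightarrow> (unit \<Rightarrow>\<^sub>0 int)" where
  "coefficient_sum c = frag_extend (\<lambda>_. frag_of ()) c"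

text \<open>
  The contraction to \<open>m\<close> makes a cycle homologous to its image in the space consisting of the vertex
  \<open>m\<close>, where cycles of positive degree bound and where the image of a cycle of degree 0 depends only
  on its coefficient sum.
\<close>

lemma cycle_bounds_of_greatest:
  assumes m: "m \<in> Q" "\<And>v. v \<in> Q \<Longrightarrow> v \<le> m"
    and z: "singular_relcycle q (nerve_realisation Q) {} z"
    and sum: "q = 0 \<Longrightarrow> coefficient_sum z = 0"
  shows "singular_relboundary q (nerve_realisation Q) {} z"
proof -
  let ?X = "nerve_realisation Q" and ?\<delta> = "indicat_real {m}"
  let ?S = "subtopology ?X {?\<delta>}" and ?c = "chain_map q (\<lambda>_. ?\<delta>) z"
  have \<delta>: "?\<delta> \<in> topspace ?X"
    using vertex_in_realisation[OF m(1)] by (simp add: topspace_nerve_realisation)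
  then have tS: "topspace ?S = {?\<delta>}" by auto
  have "homotopic_with (\<lambda>h. h \<in> {} \<rightarrow> {}) ?X ?X id (\<lambda>_. ?\<delta>)"
    using homotopic_to_greatest[OF m] by (rule homotopic_with_mono) auto
  from homotopic_imp_homologous_rel_chain_maps[OF this z]
  have hom: "homologous_rel q ?X {} z ?c"
    using chain_map_ident[of q ?X z] z by (simp add: singular_cycle)
  have "continuous_map ?X ?S (\<lambda>_. ?\<delta>)"
    using \<delta> by (simp add: continuous_map_in_subtopology)
  from singular_relcycle_chain_map[OF z this]
  have cyc: "singular_relcycle q ?S {} ?c" by simp
  have "singular_relboundary q ?S {} ?c"
  proof (cases "q = 0")
    case True
    have "?c = frag_extend (\<lambda>_. frag_of (restrict (\<lambda>_. ?\<delta>) (standard_simplex q))) z"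
      unfolding chain_map_def by (rule frag_extend_eq) (simp add: simplex_map_def o_def)
    also have "\<dots> = frag_extend (\<lambda>_. frag_of (restrict (\<lambda>_. ?\<delta>) (standard_simplex q))) (coefficient_sum z)"
      unfolding coefficient_sum_def
      using frag_extend_compose[of "\<lambda>_. frag_of (restrict (\<lambda>_. ?\<delta>) (standard_simplex q))" "\<lambda>_. ()" z]
      by (simp add: o_def)
    finally show ?thesis using sum[OF True] by simp
  next
    case False
    then show ?thesis using singular_boundary_eq_cycle_singleton[OF tS] cyc by simp
  qed
  then have "singular_relboundary q ?X {} ?c"
    using singular_boundary_mono[of "{?\<delta>}" "topspace ?X" q ?X ?c] \<delta> by simp
  then show ?thesis
    using singular_relboundary_add[of q ?X "{}" "z - ?c" ?c] hom by (simp add: homologous_rel_def)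
qed

lemma coefficient_sum_diff: "coefficient_sum (a - b) = coefficient_sum a - coefficient_sum b"
  by (simp add: coefficient_sum_def frag_extend_diff)

lemma coefficient_sum_map: "coefficient_sum (frag_extend (frag_of \<circ> f) c) = coefficient_sum c"
  unfolding coefficient_sum_def frag_extend_compose by (simp add: o_def)

lemma coefficient_sum_boundary: "coefficient_sum (chain_boundary (Suc 0) c) = 0"
proof -
  have "coefficient_sum (chain_boundary (Suc 0) c) = 0" if "Poly_Mapping.keys c \<subseteq> UNIV"
    using that
    by (induction c rule: frag_induction)
       (auto simp: coefficient_sum_def chain_boundary_of frag_extend_add frag_extend_minus
         chain_boundary_diff frag_extend_diff)
  then show ?thesis by simp
qed

subsection \<open>Flags\<close>

text \<open>
  Full flags, with one member of each rank below \<open>n\<close>, as extensional functions on \<open>{..<n}\<close>. For \<open>n = 0\<close>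
  there is exactly one, the function \<open>\<lambda>_. undefined\<close>; for this reason the only face map of flags with
  one member is the augmentation, and reduced homology in degree 0 needs no special treatment.
\<close>

definition flags :: "('a::order \<Rightarrow> nat) \<Rightarrow> nat \<Rightarrow> 'a set \<Rightarrow> (nat \<Rightarrow> 'a) set" where
  "flags r n P = {x \<in> {..<n} \<rightarrow>\<^sub>E P. (\<forall>i<n. r (x i) = i) \<and> (\<forall>i j. i < j \<longrightarrow> j < n \<longrightarrow> x i < x j)}"

definition flag_face :: "nat \<Rightarrow> nat \<Rightarrow> (nat \<Rightarrow> 'a) \<Rightarrow> nat \<Rightarrow> 'a" where
  "flag_face n k x = restrict (\<lambda>i. x (if i < k then i else Suc i)) {..<n}"

definition face_chain :: "nat \<Rightarrow> nat \<Rightarrow> ((nat \<Rightarrow> 'a) \<Rightarrow>\<^sub>0 int) \<Rightarrow> ((nat \<Rightarrow> 'a) \<Rightarrow>\<^sub>0 int)" where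
  "face_chain n k c = frag_extend (frag_of \<circ> flag_face n k) c"

definition flag_simplex :: "nat \<Rightarrow> (nat \<Rightarrow> 'a) \<Rightarrow> (nat \<Rightarrow> real) \<Rightarrow> ('a \<Rightarrow> real)" where
  "flag_simplex n x = restrict (simplex_point n x) (standard_simplex n)"

definition flag_chain :: "nat \<Rightarrow> ((nat \<Rightarrow> 'a) \<Rightarrow>\<^sub>0 int) \<Rightarrow> ('a \<Rightarrow> real) chain" where
  "flag_chain n c = frag_extend (frag_of \<circ> flag_simplex n) c"

text \<open>
  The face of a full flag with index \<open>k\<close> lacks exactly the rank \<open>k\<close>. Faces of different indices cannot
  cancel, so that on a cycle every face map vanishes separately.
\<close>

definition top_cycles :: "('a::order \<Rightarrow> nat) \<Rightarrow> nat \<Rightarrow> 'a set \<Rightarrow> ((nat \<Rightarrow> 'a) \<Rightarrow>\<^sub>0 int) set" where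
  "top_cycles r n P = {c. Poly_Mapping.keys c \<subseteq> flags r n P \<and> (\<forall>k<n. face_chain (n - 1) k c = 0)}"

text \<open>
  Cycles relative to the part of rank less than \<open>n\<close>: the face without the top member lies in that part
  and is not constrained.
\<close>

definition rel_top_cycles :: "('a::order \<Rightarrow> nat) \<Rightarrow> nat \<Rightarrow> 'a set \<Rightarrow> ((nat \<Rightarrow> 'a) \<Rightarrow>\<^sub>0 int) set" where
  "rel_top_cycles r n P = {c. Poly_Mapping.keys c \<subseteq> flags r (Suc n) P \<and> (\<forall>k<n. face_chain n k c = 0)}"

text \<open>
  The cone over a chain of flags, with apex \<open>m\<close>; \<open>slice\<close> goes back, from a chain to the link of \<open>m\<close> in
  it.
\<close>

definition snoc_chain :: "nat \<Rightarrow> 'a \<Rightarrow> ((nat \<Rightarrow> 'a) \<Rightarrow>\<^sub>0 int) \<Rightarrow> ((nat \<Rightarrow> 'a) \<Rightarrow>\<^sub>0 int)" where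
  "snoc_chain n m c = frag_extend (frag_of \<circ> (\<lambda>x. x(n := m))) c"

definition slice :: "nat \<Rightarrow> 'a \<Rightarrow> ((nat \<Rightarrow> 'a) \<Rightarrow>\<^sub>0 int) \<Rightarrow> ((nat \<Rightarrow> 'a) \<Rightarrow>\<^sub>0 int)" where
  "slice n m c = frag_extend (\<lambda>x. if x n = m then frag_of (restrict x {..<n}) else 0) c"

lemma flag_in_nerve: "x \<in> flags r (Suc n) P \<Longrightarrow> x \<in> nerve_simplices P n"
  unfolding flags_def nerve_simplices_def mono_on_def
  by (auto simp: lessThan_Suc_atMost le_less less_Suc_eq_le)

lemma singular_simplex_flag_simplex:
  "x \<in> nerve_simplices P n \<Longrightarrow> singular_simplex n (nerve_realisation P) (flag_simplex n x)"
  unfolding singular_simplex_def flag_simplex_def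
  using continuous_map_eq[OF continuous_map_simplex_point] by fastforce

lemma singular_chain_flag_chain:
  "Poly_Mapping.keys c \<subseteq> flags r (Suc n) P \<Longrightarrow> singular_chain n (nerve_realisation P) (flag_chain n c)"
  unfolding flag_chain_def
  by (intro singular_chain_extend)
     (auto simp: singular_chain_of intro!: singular_simplex_flag_simplex flag_in_nerve)

lemma flag_chain_0 [simp]: "flag_chain n 0 = 0"
  and flag_chain_add: "flag_chain n (a + b) = flag_chain n a + flag_chain n b"
  and flag_chain_diff: "flag_chain n (a - b) = flag_chain n a - flag_chain n b"
  and flag_chain_cmul: "flag_chain n (frag_cmul k a) = frag_cmul k (flag_chain n a)"
  and flag_chain_sum: "finite I \<Longrightarrow> flag_chain n (sum f I) = (\<Sum>i\<in>I. flag_chain n (f i))"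
  by (simp_all add: flag_chain_def frag_extend_add frag_extend_diff frag_extend_cmul frag_extend_minus
      frag_extend_sum)

lemma face_chain_0 [simp]: "face_chain n k 0 = 0"
  and face_chain_add: "face_chain n k (a + b) = face_chain n k a + face_chain n k b"
  and face_chain_diff: "face_chain n k (a - b) = face_chain n k a - face_chain n k b"
  and face_chain_cmul: "face_chain n k (frag_cmul j a) = frag_cmul j (face_chain n k a)"
  and face_chain_of: "face_chain n k (frag_of x) = frag_of (flag_face n k x)"
  and face_chain_sum: "finite I \<Longrightarrow> face_chain n k (sum f I) = (\<Sum>i\<in>I. face_chain n k (f i))"
  by (simp_all add: face_chain_def frag_extend_add frag_extend_diff frag_extend_cmul frag_extend_minus
      frag_extend_sum)

lemma snoc_chain_0 [simp]: "snoc_chain n m 0 = 0"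
  and snoc_chain_diff: "snoc_chain n m (a - b) = snoc_chain n m a - snoc_chain n m b"
  and snoc_chain_of: "snoc_chain n m (frag_of x) = frag_of (x(n := m))"
  by (simp_all add: snoc_chain_def frag_extend_diff frag_extend_cmul)

lemma slice_0 [simp]: "slice n m 0 = 0"
  and slice_diff: "slice n m (a - b) = slice n m a - slice n m b"
  and slice_of: "slice n m (frag_of x) = (if x n = m then frag_of (restrict x {..<n}) else 0)"
  by (simp_all add: slice_def frag_extend_diff)

lemma singular_face_flag_simplex:
  assumes "1 \<le> n" "k \<le> n"
  shows "singular_face n k (flag_simplex n x) = flag_simplex (n - 1) (flag_face n k x)"
proof
  fix s
  have "simplex_point n x (simplical_face k s) v = simplex_point (n - 1) (flag_face n k x) s v" for v
  proof -
    let ?skip = "\<lambda>i. if i < k then i else Suc i"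
    let ?f = "\<lambda>i. if x i = v then simplical_face k s i else 0"
    have inj: "inj_on ?skip {..n - 1}" by (auto simp: inj_on_def split: if_splits)
    have im: "?skip ` {..n - 1} = {..n} - {k}"
    proof
      show "?skip ` {..n - 1} \<subseteq> {..n} - {k}" using assms by auto
      show "{..n} - {k} \<subseteq> ?skip ` {..n - 1}"
      proof
        fix i assume i: "i \<in> {..n} - {k}"
        show "i \<in> ?skip ` {..n - 1}"
        proof (cases "i < k")
          case True then show ?thesis using i assms by (intro image_eqI[of _ _ i]) auto
        next
          case False then show ?thesis using i assms by (intro image_eqI[of _ _ "i - 1"]) auto
        qed
      qed
    qed
    have "simplex_point n x (simplical_face k s) v = (\<Sum>i\<le>n. ?f i)"
      by (rule simplex_point_alt)
    also have "\<dots> = (\<Sum>i \<in> {..n} - {k}. ?f i)"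
      by (rule sum.mono_neutral_right) (auto simp: simplical_face_def)
    also have "\<dots> = (\<Sum>j\<le>n - 1. ?f (?skip j))"
      unfolding im[symmetric] using sum.reindex[OF inj, of ?f] by (simp only: o_def)
    also have "\<dots> = (\<Sum>j\<le>n - 1. if flag_face n k x j = v then s j else 0)"
      using assms by (intro sum.cong) (auto simp: simplical_face_def flag_face_def)
    also have "\<dots> = simplex_point (n - 1) (flag_face n k x) s v"
      by (rule simplex_point_alt[symmetric])
    finally show ?thesis .
  qed
  then show "singular_face n k (flag_simplex n x) s = flag_simplex (n - 1) (flag_face n k x) s"
    using simplical_face_in_standard_simplex[OF assms]
    by (auto simp: singular_face_def flag_simplex_def restrict_def)
qed

lemma frag_cmul_diff: "frag_cmul k (a - b) = frag_cmul k a - frag_cmul k b"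
  by (rule poly_mapping_eqI) (simp add: lookup_minus right_diff_distrib)

lemma chain_boundary_flag_chain:
  assumes "1 \<le> n"
  shows "chain_boundary n (flag_chain n c) =
    (\<Sum>k\<le>n. frag_cmul ((-1) ^ k) (flag_chain (n - 1) (face_chain n k c)))"
  using subset_UNIV[of "Poly_Mapping.keys c"]
proof (induction c rule: frag_induction)
  case (one x)
  then show ?case
    using assms by (simp add: flag_chain_def face_chain_def chain_boundary_of singular_face_flag_simplex)
next
  case (diff a b)
  then show ?case
    by (simp add: flag_chain_diff face_chain_diff chain_boundary_diff sum_subtractf frag_cmul_diff)
qed simp

lemma flag_face_last: "x \<in> flags r (Suc n) P \<Longrightarrow> flag_face n n x \<in> flags r n {v \<in> P. r v < n}"
  unfolding flags_def flag_face_def by (auto simp: PiE_iff)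

lemma face_chain_last_keys:
  assumes "Poly_Mapping.keys c \<subseteq> flags r (Suc n) P"
  shows "Poly_Mapping.keys (face_chain n n c) \<subseteq> flags r n {v \<in> P. r v < n}"
  using assms keys_frag_extend[of "frag_of \<circ> flag_face n n" c] flag_face_last
  unfolding face_chain_def by fastforce

text \<open>
  Members with index \<open>n\<close> and \<open>k < n\<close> may be removed in either order.
\<close>

lemma face_chain_last_in_top_cycles:
  assumes c: "c \<in> rel_top_cycles r n P"
  shows "face_chain n n c \<in> top_cycles r n {v \<in> P. r v < n}"
  unfolding top_cycles_def
proof (intro CollectI conjI allI impI)
  show "Poly_Mapping.keys (face_chain n n c) \<subseteq> flags r n {v \<in> P. r v < n}"
    using c face_chain_last_keys[of c r n P] by (simp add: rel_top_cycles_def)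
  fix k assume k: "k < n"
  have "flag_face (n - 1) k (flag_face n n x) = flag_face (n - 1) (n - 1) (flag_face n k x)" for x :: "nat \<Rightarrow> 'a"
    using k by (auto simp: flag_face_def fun_eq_iff)
  then have "face_chain (n - 1) k (face_chain n n c) = face_chain (n - 1) (n - 1) (face_chain n k c)"
    unfolding face_chain_def frag_extend_compose by (simp add: o_def)
  then show "face_chain (n - 1) k (face_chain n n c) = 0"
    using c k by (simp add: rel_top_cycles_def)
qed

lemma chain_boundary_rel_top_cycle:
  assumes "c \<in> rel_top_cycles r n P" "1 \<le> n"
  shows "chain_boundary n (flag_chain n c) = frag_cmul ((-1) ^ n) (flag_chain (n - 1) (face_chain n n c))"
proof -
  have "chain_boundary n (flag_chain n c) =
    (\<Sum>k\<in>{n}. frag_cmul ((-1) ^ k) (flag_chain (n - 1) (face_chain n k c)))"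
    unfolding chain_boundary_flag_chain[OF assms(2)]
    by (rule sum.mono_neutral_right) (use assms in \<open>auto simp: rel_top_cycles_def\<close>)
  then show ?thesis by simp
qed

lemma face_chain_snoc_chain_last:
  assumes "Poly_Mapping.keys c \<subseteq> flags r n P"
  shows "face_chain n n (snoc_chain n m c) = c"
  using assms
proof (induction c rule: frag_induction)
  case (one x)
  then have "flag_face n n (x(n := m)) = x"
    by (auto simp: flag_face_def flags_def PiE_iff extensional_def fun_eq_iff)
  then show ?case by (simp add: face_chain_of snoc_chain_of)
qed (auto simp: face_chain_diff snoc_chain_diff)

lemma snoc_chain_in_rel_top_cycles:
  assumes c: "c \<in> top_cycles r n {v \<in> P. v < m}" and m: "m \<in> P" "r m = n"
  shows "snoc_chain n m c \<in> rel_top_cycles r n {v \<in> P. v \<le> m}"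
  unfolding rel_top_cycles_def
proof (intro CollectI conjI allI impI)
  have "x(n := m) \<in> flags r (Suc n) {v \<in> P. v \<le> m}" if "x \<in> flags r n {v \<in> P. v < m}" for x
    using that m unfolding flags_def
    by (auto simp: PiE_iff extensional_def less_Suc_eq le_less)
  then show "Poly_Mapping.keys (snoc_chain n m c) \<subseteq> flags r (Suc n) {v \<in> P. v \<le> m}"
    using c keys_frag_extend[of "frag_of \<circ> (\<lambda>x. x(n := m))" c]
    unfolding snoc_chain_def top_cycles_def by fastforce
  fix k assume k: "k < n"
  have "flag_face n k (x(n := m)) = (flag_face (n - 1) k x)(n - 1 := m)" for x
    using k by (auto simp: flag_face_def fun_eq_iff)
  then have "face_chain n k (snoc_chain n m c) = snoc_chain (n - 1) m (face_chain (n - 1) k c)"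
    unfolding face_chain_def snoc_chain_def frag_extend_compose by (simp add: o_def)
  then show "face_chain n k (snoc_chain n m c) = 0"
    using c k by (simp add: top_cycles_def)
qed

lemma slice_in_top_cycles:
  assumes c: "c \<in> rel_top_cycles r n P"
  shows "slice n m c \<in> top_cycles r n {v \<in> P. v < m}"
  unfolding top_cycles_def
proof (intro CollectI conjI allI impI)
  have "restrict x {..<n} \<in> flags r n {v \<in> P. v < x n}" if "x \<in> flags r (Suc n) P" for x
    using that unfolding flags_def by (auto simp: PiE_iff)
  then show "Poly_Mapping.keys (slice n m c) \<subseteq> flags r n {v \<in> P. v < m}"
    using c keys_frag_extend[of "\<lambda>x. if x n = m then frag_of (restrict x {..<n}) else 0" c]
    unfolding slice_def rel_top_cycles_def by (fastforce split: if_splits)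
  fix k assume k: "k < n"
  have "face_chain (n - 1) k (slice n m c) = slice (n - 1) m (face_chain n k c)"
    using subset_UNIV[of "Poly_Mapping.keys c"]
  proof (induction c rule: frag_induction)
    case (one x)
    have "flag_face (n - 1) k (restrict x {..<n}) = restrict (flag_face n k x) {..<n - 1}"
      "flag_face n k x (n - 1) = x n"
      using k by (auto simp: flag_face_def fun_eq_iff)
    then show ?case by (simp add: face_chain_of slice_of)
  qed (auto simp: face_chain_diff slice_diff)
  then show "face_chain (n - 1) k (slice n m c) = 0"
    using c k by (simp add: rel_top_cycles_def)
qed

lemma sum_snoc_slice:
  assumes "Poly_Mapping.keys c \<subseteq> {x \<in> extensional {..<Suc n}. x n \<in> F}" "finite F"
  shows "(\<Sum>m\<in>F. snoc_chain n m (slice n m c)) = c"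
  using assms(1)
proof (induction c rule: frag_induction)
  case (one x)
  have "(restrict x {..<n})(n := x n) = x"
    using one by (auto simp: fun_eq_iff extensional_def)
  moreover have "(\<Sum>m\<in>F. snoc_chain n m (slice n m (frag_of x))) =
      (\<Sum>m\<in>F. if m = x n then frag_of ((restrict x {..<n})(n := x n)) else 0)"
    by (rule sum.cong) (auto simp: slice_of snoc_chain_of)
  ultimately show ?case
    using one assms(2) by (simp add: sum.delta)
qed (auto simp: slice_diff snoc_chain_diff sum_subtractf)


section \<open>Homology of the realisation of a graded poset\<close>

definition ranked :: "('a::order \<Rightarrow> nat) \<Rightarrow> nat \<Rightarrow> 'a set \<Rightarrow> bool" where
  "ranked r n P \<longleftrightarrow> (\<forall>u\<in>P. r u < n) \<and> (\<forall>u\<in>P. \<forall>v\<in>P. u < v \<longrightarrow> r u < r v)"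

text \<open>
  Reduced homology vanishes from degree \<open>n\<close> on, and in degree \<open>n - 1\<close> every class is represented by
  exactly one cycle of flags. This is phrased with singular chains, because the homology of pairs is
  chased on the level of chains below; the condition on \<^const>\<open>coefficient_sum\<close> singles out the reduced
  classes in degree 0.
\<close>

definition homology_by_flags :: "('a::order \<Rightarrow> nat) \<Rightarrow> nat \<Rightarrow> 'a set \<Rightarrow> bool" where
  "homology_by_flags r n P \<longleftrightarrow>
     (\<forall>q z. n \<le> q \<longrightarrow> singular_relcycle q (nerve_realisation P) {} z \<longrightarrow>
        singular_relboundary q (nerve_realisation P) {} z) \<and>
     (\<forall>z. singular_relcycle (n - 1) (nerve_realisation P) {} z \<longrightarrow>
        (n = 1 \<longrightarrow> coefficient_sum z = 0) \<longrightarrow>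
        (\<exists>c \<in> top_cycles r n P. homologous_rel (n - 1) (nerve_realisation P) {} z (flag_chain (n - 1) c))) \<and>
     (\<forall>c \<in> top_cycles r n P. singular_relboundary (n - 1) (nerve_realisation P) {} (flag_chain (n - 1) c)
        \<longrightarrow> c = 0)"

lemma homology_by_flags_vanishing:
  assumes h: "homology_by_flags r n P" and "n \<le> q" and "singular_relcycle q (nerve_realisation P) {} z"
  shows "singular_relboundary q (nerve_realisation P) {} z"
  using h[unfolded homology_by_flags_def, THEN conjunct1, rule_format, OF assms(2,3)] .

lemma homology_by_flags_surj:
  assumes h: "homology_by_flags r n P" and z: "singular_relcycle (n - 1) (nerve_realisation P) {} z"
    and "n = 1 \<Longrightarrow> coefficient_sum z = 0"
  shows "\<exists>c \<in> top_cycles r n P. homologous_rel (n - 1) (nerve_realisation P) {} z (flag_chain (n - 1) c)"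
  using h[unfolded homology_by_flags_def, THEN conjunct2, THEN conjunct1, rule_format, OF z] assms(3) by simp

lemma homology_by_flags_inj:
  assumes h: "homology_by_flags r n P" and "c \<in> top_cycles r n P"
    and "singular_relboundary (n - 1) (nerve_realisation P) {} (flag_chain (n - 1) c)"
  shows "c = 0"
  using h[unfolded homology_by_flags_def, THEN conjunct2, THEN conjunct2, rule_format, OF assms(2,3)] .

lemma ranked_below: "ranked r (Suc n) P \<Longrightarrow> m \<in> P \<Longrightarrow> r m = n \<Longrightarrow> ranked r n {v \<in> P. v < m}"
  unfolding ranked_def by fastforce

lemma ranked_lower: "ranked r (Suc n) P \<Longrightarrow> ranked r n {v \<in> P. r v < n}"
  unfolding ranked_def by auto

lemma singular_chain_nerve_mono:
  assumes "Q \<subseteq> P" "singular_chain q (nerve_realisation Q) c"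
  shows "singular_chain q (nerve_realisation P) c"
  using assms(2) unfolding subtopology_nerve_realisation[OF assms(1), symmetric] singular_chain_subtopology
  by blast

lemma singular_chain_nerve_Int:
  assumes "Q \<subseteq> P" "S \<subseteq> realisation_points P"
    and "singular_chain q (nerve_realisation Q) c" "singular_chain q (subtopology (nerve_realisation P) S) c"
  shows "singular_chain q (subtopology (nerve_realisation Q) (S \<inter> realisation_points Q)) c"
  using assms(3,4)
  unfolding subtopology_nerve_realisation[OF assms(1), symmetric] singular_chain_subtopology subtopology_subtopology
  by auto

lemma singular_relboundary_nerve_mono:
  assumes "Q \<subseteq> P" "S \<subseteq> Q" "T \<subseteq> P" "S \<subseteq> T"
    and "singular_relboundary q (nerve_realisation Q) (realisation_points S) c"
  shows "singular_relboundary q (nerve_realisation P) (realisation_points T) c"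
  using assms(5) singular_chain_nerve_mono[OF assms(1)] singular_chain_nerve_mono[OF assms(4)]
  unfolding singular_relboundary subtopology_nerve_realisation[OF assms(2)]
    subtopology_nerve_realisation[OF assms(3)]
  by blast

lemma singular_relcycle_mono:
  "\<lbrakk>singular_relcycle p X S c; S \<subseteq> T\<rbrakk> \<Longrightarrow> singular_relcycle p X T c"
  unfolding singular_relcycle using singular_chain_mono by blast

lemma singular_relboundary_mono:
  "\<lbrakk>singular_relboundary p X S c; S \<subseteq> T\<rbrakk> \<Longrightarrow> singular_relboundary p X T c"
  unfolding singular_relboundary using singular_chain_mono by blast

lemma top_cycles_add: "\<lbrakk>a \<in> top_cycles r n P; b \<in> top_cycles r n P\<rbrakk> \<Longrightarrow> a + b \<in> top_cycles r n P"
  unfolding top_cycles_def using keys_add[of a b] by (auto simp: face_chain_add)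

lemma top_cycles_cmul: "a \<in> top_cycles r n P \<Longrightarrow> frag_cmul k a \<in> top_cycles r n P"
  unfolding top_cycles_def using keys_cmul[of k a] by (auto simp: face_chain_cmul)

lemma rel_top_cycles_sum:
  "(\<And>i. i \<in> I \<Longrightarrow> f i \<in> rel_top_cycles r n P) \<Longrightarrow> finite I \<Longrightarrow> sum f I \<in> rel_top_cycles r n P"
  unfolding rel_top_cycles_def using keys_sum[of f I] by (simp add: face_chain_sum) blast

lemma rel_top_cycles_mono:
  assumes "c \<in> rel_top_cycles r n Q" "Q \<subseteq> P" shows "c \<in> rel_top_cycles r n P"
proof -
  have "flags r (Suc n) Q \<subseteq> flags r (Suc n) P"
    using assms(2) unfolding flags_def by (auto simp: PiE_iff)
  then show ?thesis using assms(1) unfolding rel_top_cycles_def by blast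
qed

lemma frag_eq_coefficient_sum:
  assumes "Poly_Mapping.keys c \<subseteq> {x}"
  shows "c = frag_cmul (Poly_Mapping.lookup (coefficient_sum c) ()) (frag_of x)"
  using assms
proof (induction c rule: frag_induction)
  case (diff a b)
  then show ?case by (metis coefficient_sum_diff frag_cmul_diff_distrib lookup_minus)
qed (auto simp: coefficient_sum_def)

lemma frag_cmul_sign [simp]: "frag_cmul ((-1) ^ n) (frag_cmul ((-1) ^ n) c) = c"
  by (simp flip: power_add)

subsection \<open>Cones\<close>

text \<open>
  The cone of the elements up to \<open>m\<close> is contractible. Therefore the boundary map identifies its homology
  relative to its base, the realisation of the elements below \<open>m\<close>, with the reduced homology of the
  base in one degree less, which is described by flags. Appending \<open>m\<close> to flags inverts the boundary map
  up to sign. For \<open>n = 0\<close> the base is empty, and the single class comes from the flag without members.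
\<close>

lemma cone_relative_cycles:
  fixes P :: "'a::order set"
  assumes P: "ranked r (Suc n) P" and m: "m \<in> P" "r m = n"
    and hyp: "1 \<le> n \<Longrightarrow> homology_by_flags r n {v \<in> P. v < m}"
  defines "C \<equiv> nerve_realisation {v \<in> P. v \<le> m}" and "L \<equiv> realisation_points {v \<in> P. v < m}"
  shows cone_relative_vanishing:
      "\<And>q z. n < q \<Longrightarrow> singular_relcycle q C L z \<Longrightarrow> singular_relboundary q C L z"
    and cone_relative_surj:
      "\<And>z. singular_relcycle n C L z \<Longrightarrow>
        \<exists>c \<in> top_cycles r n {v \<in> P. v < m}. homologous_rel n C L z (flag_chain n (snoc_chain n m c))"
    and cone_relative_inj:
      "\<And>c. c \<in> top_cycles r n {v \<in> P. v < m} \<Longrightarrow>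
        singular_relboundary n C L (flag_chain n (snoc_chain n m c)) \<Longrightarrow> c = 0"
proof -
  let ?B = "{v \<in> P. v < m}"
  have BC: "?B \<subseteq> {v \<in> P. v \<le> m}" by auto
  have CL: "subtopology C L = nerve_realisation ?B"
    unfolding C_def L_def by (rule subtopology_nerve_realisation[OF BC])
  have chainBC: "singular_chain q C w" if "singular_chain q (nerve_realisation ?B) w" for q w
    using singular_chain_nerve_mono[OF BC that] by (simp add: C_def)
  \<comment> \<open>contractibility of the cone\<close>
  have bounds: "singular_relboundary q C {} z"
    if "singular_relcycle q C {} z" "q = 0 \<Longrightarrow> coefficient_sum z = 0" for q z
    unfolding C_def
  proof (rule cycle_bounds_of_greatest[of m])
    show "m \<in> {v \<in> P. v \<le> m}" using m by simp
    show "singular_relcycle q (nerve_realisation {v \<in> P. v \<le> m}) {} z"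
      using that(1) by (simp only: C_def)
  qed (use that in auto)
  have B0: "?B = {}" if "n = 0"
  proof -
    have "\<not> v < m" if "v \<in> P" for v
      using P m that \<open>n = 0\<close> unfolding ranked_def by (metis not_less_zero)
    then show ?thesis by blast
  qed
  have relI: "singular_relboundary q C L z"
    if w: "singular_chain q (nerve_realisation ?B) w" and b: "singular_relboundary q C {} (z - w)" for q z w
  proof -
    obtain d where "singular_chain (Suc q) C d" "chain_boundary (Suc q) d = z - w"
      using b by (auto simp: singular_boundary)
    then show ?thesis
      unfolding singular_relboundary CL using w by (intro exI[of _ d] exI[of _ w]) simp
  qed

  have bcyc: "singular_relcycle (q - 1) (nerve_realisation ?B) {} (chain_boundary q z)"
    if "singular_relcycle q C L z" for q z
  proof (cases "q = 0")
    case True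
    then show ?thesis by (simp add: chain_boundary_def)
  next
    case False
    have "chain_boundary (q - 1) (chain_boundary q z) = 0"
      using chain_boundary_boundary[of q C z] that by (simp add: singular_relcycle)
    then show ?thesis
      using that unfolding singular_cycle singular_relcycle CL by simp
  qed
  have snoc: "snoc_chain n m c \<in> rel_top_cycles r n {v \<in> P. v \<le> m}"
    if "c \<in> top_cycles r n ?B" for c
    using snoc_chain_in_rel_top_cycles[OF that m] .
  have fc: "singular_chain n C (flag_chain n (snoc_chain n m c))" if "c \<in> top_cycles r n ?B" for c
    using snoc[OF that] unfolding C_def rel_top_cycles_def by (intro singular_chain_flag_chain[of _ r]) simp
  have bfc: "chain_boundary n (flag_chain n (snoc_chain n m c)) = frag_cmul ((-1) ^ n) (flag_chain (n - 1) c)"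
    if "c \<in> top_cycles r n ?B" "1 \<le> n" for c
    using chain_boundary_rel_top_cycle[OF snoc[OF that(1)] that(2)]
      face_chain_snoc_chain_last[of c r n ?B m] that(1) by (simp add: top_cycles_def)
  have csum: "coefficient_sum (flag_chain n (snoc_chain n m c)) = coefficient_sum c" for c
    unfolding flag_chain_def snoc_chain_def by (simp only: coefficient_sum_map)
  show "singular_relboundary q C L z" if q: "n < q" and z: "singular_relcycle q C L z" for q z
  proof -
    obtain w where w: "singular_chain q (nerve_realisation ?B) w" "chain_boundary q w = chain_boundary q z"
    proof (cases "1 \<le> n")
      case True
      then have "singular_relboundary (q - 1) (nerve_realisation ?B) {} (chain_boundary q z)"
        using homology_by_flags_vanishing[OF hyp _ bcyc[OF z]] q by simp
      then show thesis using that q by (auto simp: singular_boundary)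
    next
      case False
      then have "chain_boundary q z = 0"
        using bcyc[OF z] B0 by (auto simp: singular_cycle singular_chain_empty topspace_nerve_realisation)
      then show thesis using that[of 0] by simp
    qed
    have "singular_relcycle q C {} (z - w)"
      using z w chainBC by (auto simp: singular_cycle singular_relcycle chain_boundary_diff intro!: singular_chain_diff)
    then show ?thesis using relI[OF w(1)] bounds q by simp
  qed
  show "\<exists>c \<in> top_cycles r n ?B. homologous_rel n C L z (flag_chain n (snoc_chain n m c))"
    if z: "singular_relcycle n C L z" for z
  proof (cases "n = 0")
    case True
    define c :: "(nat \<Rightarrow> 'a) \<Rightarrow>\<^sub>0 int"
      where "c = frag_cmul (Poly_Mapping.lookup (coefficient_sum z) ()) (frag_of (\<lambda>_. undefined))"
    have c: "c \<in> top_cycles r n ?B"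
      using keys_cmul[of _ "frag_of (\<lambda>_. undefined)"] True by (auto simp: top_cycles_def c_def flags_def)
    have "coefficient_sum c = coefficient_sum z"
    proof -
      have "coefficient_sum c = frag_cmul (Poly_Mapping.lookup (coefficient_sum z) ()) (frag_of ())"
        by (simp add: c_def coefficient_sum_def frag_extend_cmul)
      then show ?thesis by (auto intro!: poly_mapping_eqI)
    qed
    then have "coefficient_sum (z - flag_chain n (snoc_chain n m c)) = 0"
      using csum[of c] by (simp add: coefficient_sum_diff)
    moreover have "singular_relcycle n C {} (z - flag_chain n (snoc_chain n m c))"
      using z fc[OF c] True by (auto simp: singular_cycle singular_relcycle chain_boundary_def intro!: singular_chain_diff)
    ultimately have "singular_relboundary n C {} (z - flag_chain n (snoc_chain n m c))"
      by (rule bounds[rotated])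
    then have "singular_relboundary n C L (z - flag_chain n (snoc_chain n m c))"
      using relI[of n 0 "z - flag_chain n (snoc_chain n m c)"] by simp
    then show ?thesis using c by (auto simp: homologous_rel_def)
  next
    case False
    have "coefficient_sum (chain_boundary n z) = 0" if "n = 1"
      using coefficient_sum_boundary that by simp
    then obtain c0 where c0: "c0 \<in> top_cycles r n ?B"
      and "homologous_rel (n - 1) (nerve_realisation ?B) {} (chain_boundary n z) (flag_chain (n - 1) c0)"
      using homology_by_flags_surj[OF hyp bcyc[OF z]] False by auto
    then obtain w where w: "singular_chain n (nerve_realisation ?B) w"
      "chain_boundary n w = chain_boundary n z - flag_chain (n - 1) c0"
      using False by (auto simp: homologous_rel_def singular_boundary)
    \<comment> \<open>compensates the sign of the last face in the boundary\<close>
    define c where "c = frag_cmul ((-1) ^ n) c0"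
    have c: "c \<in> top_cycles r n ?B" using c0 by (simp add: c_def top_cycles_cmul)
    let ?z = "z - flag_chain n (snoc_chain n m c)"
    have "chain_boundary n (flag_chain n (snoc_chain n m c)) = flag_chain (n - 1) c0"
      using bfc[OF c] False by (simp add: c_def flag_chain_cmul)
    then have "singular_relcycle n C {} (?z - w)"
      using z w chainBC fc[OF c]
      by (auto simp: singular_cycle singular_relcycle chain_boundary_diff intro!: singular_chain_diff)
    then have "singular_relboundary n C L ?z" using relI[OF w(1)] bounds False by simp
    then show ?thesis using c by (auto simp: homologous_rel_def)
  qed
  show "c = 0" if c: "c \<in> top_cycles r n ?B"
    and rb: "singular_relboundary n C L (flag_chain n (snoc_chain n m c))" for c
  proof -
    obtain d e where d: "singular_chain (Suc n) C d" and e: "singular_chain n (nerve_realisation ?B) e"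
      and eq: "chain_boundary (Suc n) d + e = flag_chain n (snoc_chain n m c)"
      using rb by (auto simp: singular_relboundary CL)
    show ?thesis
    proof (cases "n = 0")
      case True
      have "e = 0" using e B0[OF True] by (simp add: singular_chain_empty topspace_nerve_realisation)
      then have "coefficient_sum c = 0"
        using csum[of c] eq coefficient_sum_boundary[of d] True by (metis add.right_neutral)
      moreover have "Poly_Mapping.keys c \<subseteq> {\<lambda>_. undefined}"
        using c True by (auto simp: top_cycles_def flags_def)
      ultimately show ?thesis
        using frag_eq_coefficient_sum[of c] by simp
    next
      case False
      have "chain_boundary n (chain_boundary (Suc n) d) = 0"
        using d by (rule chain_boundary_boundary_alt)
      then have "chain_boundary n e = chain_boundary n (flag_chain n (snoc_chain n m c))"
        unfolding eq[symmetric] by (simp add: chain_boundary_add)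
      also have "\<dots> = flag_chain (n - 1) (frag_cmul ((-1) ^ n) c)"
        using bfc[OF c] False by (simp add: flag_chain_cmul)
      finally have "singular_relboundary (n - 1) (nerve_realisation ?B) {} (flag_chain (n - 1) (frag_cmul ((-1) ^ n) c))"
        using e False by (auto simp: singular_boundary)
      then have "frag_cmul ((-1) ^ n) c = 0"
        using homology_by_flags_inj[OF hyp top_cycles_cmul[OF c, of "(-1) ^ n"]] False by simp
      then show ?thesis by simp
    qed
  qed
qed


subsection \<open>The pair consisting of a graded poset and its lower part\<close>

definition chain_part :: "nat \<Rightarrow> 'a set \<Rightarrow> 'a chain \<Rightarrow> 'a chain" where
  "chain_part q U c = frag_extend (\<lambda>f. if f ` standard_simplex q \<subseteq> U then frag_of f else 0) c"

lemma chain_part_0 [simp]: "chain_part q U 0 = 0"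
  and chain_part_diff: "chain_part q U (a - b) = chain_part q U a - chain_part q U b"
  and chain_part_sum: "finite I \<Longrightarrow> chain_part q U (sum g I) = (\<Sum>i\<in>I. chain_part q U (g i))"
  and chain_part_cmul: "chain_part q U (frag_cmul k a) = frag_cmul k (chain_part q U a)"
  and chain_part_of: "chain_part q U (frag_of f) = (if f ` standard_simplex q \<subseteq> U then frag_of f else 0)"
  by (simp_all add: chain_part_def frag_extend_diff frag_extend_sum frag_extend_cmul)

lemma keys_chain_part:
  "Poly_Mapping.keys (chain_part q U c) \<subseteq> {f \<in> Poly_Mapping.keys c. f ` standard_simplex q \<subseteq> U}"
proof
  fix f assume "f \<in> Poly_Mapping.keys (chain_part q U c)"
  then obtain g where "g \<in> Poly_Mapping.keys c"
    "f \<in> Poly_Mapping.keys (if g ` standard_simplex q \<subseteq> U then frag_of g else 0)"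
    using keys_frag_extend[of "\<lambda>f. if f ` standard_simplex q \<subseteq> U then frag_of f else 0" c]
    unfolding chain_part_def by blast
  then show "f \<in> {f \<in> Poly_Mapping.keys c. f ` standard_simplex q \<subseteq> U}"
    by (auto split: if_split_asm)
qed

lemma simplex_in_disjoint_family:
  assumes "disjoint_family_on U M" "m \<in> M" "m' \<in> M" "g ` standard_simplex p \<subseteq> U m'"
  shows "g ` standard_simplex p \<subseteq> U m \<longleftrightarrow> m = m'"
proof
  assume sub: "g ` standard_simplex p \<subseteq> U m"
  obtain s where "s \<in> standard_simplex p" using nonempty_standard_simplex by blast
  then have "g s \<in> U m \<inter> U m'" using sub assms(4) by blast
  then show "m = m'" using assms(1-3) by (auto simp: disjoint_family_on_def)
qed (use assms in simp)

text \<open>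
  The faces of a simplex lie in the same member of the disjoint family as the simplex.
\<close>

lemma chain_boundary_chain_part:
  assumes disj: "disjoint_family_on U M" and m: "m \<in> M"
    and c: "Poly_Mapping.keys c \<subseteq> {f. \<exists>m\<in>M. f ` standard_simplex q \<subseteq> U m}"
  shows "chain_boundary q (chain_part q (U m) c) = chain_part (q - 1) (U m) (chain_boundary q c)"
proof (cases "q = 0")
  case False
  show ?thesis
    using c
  proof (induction c rule: frag_induction)
    case (one f)
    then obtain m' where m': "m' \<in> M" "f ` standard_simplex q \<subseteq> U m'" by auto
    have face: "singular_face q k f ` standard_simplex (q - 1) \<subseteq> f ` standard_simplex q" if "k \<le> q" for k
      using False that by (auto simp: singular_face_def simplical_face_in_standard_simplex)
    note iff = simplex_in_disjoint_family[OF disj m m'(1)]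
    have "singular_face q k f ` standard_simplex (q - 1) \<subseteq> U m \<longleftrightarrow> m = m'" if "k \<le> q" for k
      by (rule iff, rule order_trans[OF face[OF that] m'(2)])
    moreover have "f ` standard_simplex q \<subseteq> U m \<longleftrightarrow> m = m'"
      by (rule iff, rule m'(2))
    ultimately show ?case
      using False by (auto simp: chain_part_of chain_boundary_of chain_part_sum chain_part_cmul)
  qed (auto simp: chain_part_diff chain_boundary_diff)
qed (simp add: chain_boundary_def)

lemma sum_chain_part:
  assumes disj: "disjoint_family_on U M" and F: "finite F" "F \<subseteq> M"
    and c: "Poly_Mapping.keys c \<subseteq> {f. \<exists>m\<in>F. f ` standard_simplex q \<subseteq> U m}"
  shows "(\<Sum>m\<in>F. chain_part q (U m) c) = c"
  using c
proof (induction c rule: frag_induction)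
  case (one f)
  then obtain m' where m': "m' \<in> F" "f ` standard_simplex q \<subseteq> U m'" by auto
  have "(\<Sum>m\<in>F. chain_part q (U m) (frag_of f)) = (\<Sum>m\<in>F. if m = m' then frag_of f else 0)"
  proof (rule sum.cong)
    fix m assume "m \<in> F"
    then have "f ` standard_simplex q \<subseteq> U m \<longleftrightarrow> m = m'"
      using simplex_in_disjoint_family[OF disj _ _ m'(2)] m'(1) F(2) by blast
    then show "chain_part q (U m) (frag_of f) = (if m = m' then frag_of f else 0)"
      by (simp add: chain_part_of)
  qed simp
  then show ?case using m' F by (simp add: sum.delta)
qed (auto simp: chain_part_diff sum_subtractf)

lemma weight_off:
  assumes "t \<in> realisation_points (P - M)"
  shows "weight (indicator M) t = 0"
  unfolding weight_def
  using realisation_points_support[OF assms] by (intro sum.neutral) (auto simp: indicator_def)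

lemma openin_weight_less:
  "openin (nerve_realisation P) {t \<in> realisation_points P. weight f t < a}"
proof -
  have "openin (nerve_realisation P) {t \<in> topspace (nerve_realisation P). weight f t \<in> {..<a}}"
    by (rule openin_continuous_map_preimage[OF continuous_map_weight]) simp
  then show ?thesis by (simp add: topspace_nerve_realisation)
qed

lemma push_off_chain:
  assumes "singular_relcycle q (nerve_realisation P) (realisation_points Q) z"
  shows "homologous_rel q (nerve_realisation P) (realisation_points Q) z (chain_map q (push_off M 1) z)"
proof -
  have "homotopic_with (\<lambda>h. h \<in> realisation_points Q \<rightarrow> realisation_points Q)
     (nerve_realisation P) (nerve_realisation P) id (push_off M 1)"
    using homotopic_push_off by (rule homotopic_with_mono) blast
  from homotopic_imp_homologous_rel_chain_maps[OF this assms] show ?thesis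
    using chain_map_ident[of q "nerve_realisation P" z] assms by (simp add: singular_relcycle)
qed

lemma continuous_push_off: "continuous_map (nerve_realisation P) (nerve_realisation P) (push_off M 1)"
  using homotopic_with_imp_continuous_maps[OF homotopic_push_off] by blast

text \<open>
  The rank of \<open>m\<close> is maximal, so that no member of a chain through \<open>m\<close> lies above \<open>m\<close>.
\<close>

lemma star_in_cone:
  assumes P: "ranked r (Suc n) P" and m: "m \<in> P" "r m = n" and t: "t \<in> realisation_points P" "t m \<noteq> 0"
  shows "t \<in> realisation_points {v \<in> P. v \<le> m}"
proof -
  have "v \<in> P \<and> v \<le> m" if "t v \<noteq> 0" for v
  proof -
    have v: "v \<in> P" using realisation_points_support[OF t(1) that] .
    have "\<not> m < v" using P m v unfolding ranked_def by (metis less_antisym not_less_eq)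
    then show ?thesis using realisation_points_chain[OF t(1) that t(2)] v by (auto simp: le_less)
  qed
  then show ?thesis
    using t(1) by (subst realisation_points_iff_support[of _ P]) auto
qed

text \<open>
  The image of a simplex is connected, and the stars of the elements of the top level are disjoint, open
  and cover the complement of the lower part.
\<close>

lemma simplex_in_one_star:
  assumes P: "ranked r (Suc n) P"
    and f: "singular_simplex q (nerve_realisation P) f"
      "f ` standard_simplex q \<inter> realisation_points {v \<in> P. r v < n} = {}"
  shows "\<exists>m\<in>{v \<in> P. r v = n}. f ` standard_simplex q \<subseteq> {t \<in> realisation_points P. t m \<noteq> 0}"
proof -
  let ?X = "nerve_realisation P" and ?M = "{v \<in> P. r v = n}"
  let ?U = "\<lambda>m. {t \<in> realisation_points P. t m \<noteq> 0}"
  have fX: "f ` standard_simplex q \<subseteq> realisation_points P"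
    using f(1) unfolding singular_simplex_def continuous_map_def topspace_nerve_realisation by auto
  have conn: "connectedin ?X (f ` standard_simplex q)"
    using f(1) connectedin_continuous_map_image[of "simplex_top q" ?X f "standard_simplex q"]
    unfolding singular_simplex_def
    by (simp add: connectedin_subtopology connectedin_standard_simplex del: euclidean_product_topology)
  have opU: "openin ?X (?U m)" for m
  proof -
    have "openin ?X {t \<in> topspace ?X. t m \<in> - {0}}"
      by (rule openin_continuous_map_preimage[OF continuous_map_coordinate]) auto
    then show ?thesis by (simp add: topspace_nerve_realisation)
  qed
  have ex: "\<exists>m\<in>?M. t \<in> ?U m" if t: "t \<in> f ` standard_simplex q" for t
  proof (rule ccontr)
    assume *: "\<not> ?thesis"
    have tP: "t \<in> realisation_points P" using t fX by blast
    have "v \<in> P \<and> r v < n" if "t v \<noteq> 0" for v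
      using realisation_points_support[OF tP that] * that tP P unfolding ranked_def by (auto simp: less_Suc_eq)
    then have "t \<in> realisation_points {v \<in> P. r v < n}"
      using tP by (subst realisation_points_iff_support[of _ P]) auto
    then show False using t f(2) by blast
  qed
  have uniq: "m = m'" if "m \<in> ?M" "m' \<in> ?M" "t \<in> ?U m" "t \<in> ?U m'" for m m' t
    using that realisation_points_chain[of t P m m'] P unfolding ranked_def
    by (metis (mono_tags, lifting) le_less less_irrefl mem_Collect_eq)
  obtain s0 where s0: "s0 \<in> standard_simplex q" using nonempty_standard_simplex by blast
  then obtain m where m: "m \<in> ?M" "f s0 \<in> ?U m" using ex by blast
  let ?V = "\<Union>m' \<in> ?M - {m}. ?U m'"
  have "openin ?X ?V" using opU by (intro openin_Union) auto
  moreover have "f ` standard_simplex q \<subseteq> ?U m \<union> ?V" using ex by blast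
  moreover have "?U m \<inter> ?V \<inter> f ` standard_simplex q = {}"
    using uniq[OF m(1)] by blast
  moreover have "?U m \<inter> f ` standard_simplex q \<noteq> {}" using m(2) s0 by blast
  ultimately have "?V \<inter> f ` standard_simplex q = {}"
    using conn[unfolded connectedin, THEN conjunct2] opU[of m] by blast
  then show ?thesis using ex m(1) by blast
qed

text \<open>
  Excision moves a relative cycle into the complement of the lower part. There it splits according to
  the star in which its simplices lie. The boundary of each part has weight less than 1/2 on the top
  level, so that \<^const>\<open>push_off\<close> brings it into the lower part again, and each part becomes a relative
  cycle of one cone.
\<close>

lemma relative_cycle_splits:
  fixes P :: "'a::order set"
  assumes P: "ranked r (Suc n) P"
    and z: "singular_relcycle q (nerve_realisation P) (realisation_points {v \<in> P. r v < n}) z"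
  shows "\<exists>F y. finite F \<and> F \<subseteq> {v \<in> P. r v = n} \<and>
     (\<forall>m\<in>F. singular_relcycle q (nerve_realisation {v \<in> P. v \<le> m}) (realisation_points {v \<in> P. v < m}) (y m)) \<and>
     homologous_rel q (nerve_realisation P) (realisation_points {v \<in> P. r v < n}) z (\<Sum>m\<in>F. y m)"
proof -
  let ?X = "nerve_realisation P" and ?A = "realisation_points {v \<in> P. r v < n}"
  define M where "M = {v \<in> P. r v = n}"
  have AM: "{v \<in> P. r v < n} = P - M" using P unfolding M_def ranked_def by auto
  define W where "W = {t \<in> realisation_points P. weight (indicator M) t < 1/2}"
  define U where "U m = {t \<in> realisation_points P. t m \<noteq> 0}" for m
  let ?r = "push_off M 1"
  have AW: "?A \<subseteq> W"
    using weight_off[of _ P M] realisation_points_mono[of "P - M" P] unfolding AM W_def by auto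
  have openW: "openin ?X W" unfolding W_def by (rule openin_weight_less)
  have closedA: "closedin ?X ?A" by (rule closedin_realisation_points) auto
  have rW: "?r \<in> W \<rightarrow> ?A"
    using push_off_clears[of _ P M] unfolding AM W_def by auto
  have "singular_relcycle q (subtopology ?X (topspace ?X)) W z"
    using singular_relcycle_mono[OF z AW] by simp
  moreover have "?X closure_of ?A \<subseteq> ?X interior_of W"
    using AW by (simp add: closure_of_closedin closedA interior_of_openin openW)
  moreover have "W \<subseteq> topspace ?X" using openW by (rule openin_subset)
  ultimately obtain c where c: "singular_relcycle q (subtopology ?X (topspace ?X - ?A)) (W - ?A) c"
    and zc: "homologous_rel q ?X W z c"
    using excised_relcycle_exists[of ?X ?A W "topspace ?X" q z] by auto
  have zrz: "homologous_rel q ?X ?A z (chain_map q ?r z)"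
    by (rule push_off_chain[OF z])
  have rzc: "homologous_rel q ?X ?A (chain_map q ?r z) (chain_map q ?r c)"
    using singular_relboundary_chain_map[OF _ continuous_push_off rW, of q P "z - c"] zc
    by (simp add: homologous_rel_def chain_map_diff)
  have cX: "singular_chain q ?X c" and cA: "\<And>f. f \<in> Poly_Mapping.keys c \<Longrightarrow> f ` standard_simplex q \<inter> ?A = {}"
    using c by (auto simp: singular_relcycle singular_chain_subtopology)
  have bc: "singular_chain (q - 1) (subtopology ?X W) (chain_boundary q c)"
  proof -
    have "singular_chain (q - 1) (subtopology ?X ((topspace ?X - ?A) \<inter> (W - ?A))) (chain_boundary q c)"
      using c by (simp add: singular_relcycle subtopology_subtopology)
    then show ?thesis by (rule singular_chain_mono) blast
  qed
  have "\<exists>m\<in>M. f ` standard_simplex q \<subseteq> U m" if "f \<in> Poly_Mapping.keys c" for f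
    unfolding M_def U_def
    using simplex_in_one_star[OF P, of q f] that cX cA by (auto simp: singular_chain_def)
  then obtain \<tau> where \<tau>: "\<And>f. f \<in> Poly_Mapping.keys c \<Longrightarrow> \<tau> f \<in> M \<and> f ` standard_simplex q \<subseteq> U (\<tau> f)"
    by metis
  let ?F = "\<tau> ` Poly_Mapping.keys c"
  have disj: "disjoint_family_on U M"
  proof -
    have "m = m'" if "m \<in> M" "m' \<in> M" "t \<in> U m" "t \<in> U m'" for m m' t
      using that realisation_points_chain[of t P m m'] P unfolding ranked_def M_def U_def
      by (metis (mono_tags, lifting) le_less less_irrefl mem_Collect_eq)
    then show ?thesis unfolding disjoint_family_on_def by blast
  qed
  have F: "finite ?F" "?F \<subseteq> M" using \<tau> by auto
  define y where "y m = chain_map q ?r (chain_part q (U m) c)" for m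
  have "chain_map q ?r c = (\<Sum>m\<in>?F. y m)"
  proof -
    have "(\<Sum>m\<in>?F. chain_part q (U m) c) = c"
      by (rule sum_chain_part[OF disj F]) (use \<tau> in auto)
    then have "chain_map q ?r c = chain_map q ?r (\<Sum>m\<in>?F. chain_part q (U m) c)" by simp
    then show ?thesis by (simp add: chain_map_sum y_def)
  qed
  then have hom: "homologous_rel q ?X ?A z (\<Sum>m\<in>?F. y m)"
    using homologous_rel_trans[OF rzc zrz] by simp
  have "singular_relcycle q (nerve_realisation {v \<in> P. v \<le> m}) (realisation_points {v \<in> P. v < m}) (y m)"
    if m: "m \<in> M" for m
  proof -
    let ?C = "{v \<in> P. v \<le> m}"
    let ?S = "W \<inter> realisation_points ?C"
    have sub: "?C \<subseteq> P" by auto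
    have UC: "U m \<subseteq> realisation_points ?C"
      using star_in_cone[OF P, of m] m by (auto simp: U_def M_def)
    have 1: "singular_chain q (nerve_realisation ?C) (chain_part q (U m) c)"
      unfolding subtopology_nerve_realisation[OF sub, symmetric] singular_chain_subtopology
      using keys_chain_part[of q "U m" c] cX UC unfolding singular_chain_def by blast
    have "chain_boundary q (chain_part q (U m) c) = chain_part (q - 1) (U m) (chain_boundary q c)"
      by (rule chain_boundary_chain_part[OF disj m]) (use \<tau> in auto)
    note part_boundary = this
    have 2: "singular_chain (q - 1) (subtopology (nerve_realisation ?C) ?S)
        (chain_boundary q (chain_part q (U m) c))"
    proof -
      have "f ` standard_simplex (q - 1) \<subseteq> W \<and> f ` standard_simplex (q - 1) \<subseteq> realisation_points ?C
          \<and> singular_simplex (q - 1) ?X f"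
        if "f \<in> Poly_Mapping.keys (chain_part (q - 1) (U m) (chain_boundary q c))" for f
      proof -
        have "f \<in> Poly_Mapping.keys (chain_boundary q c)" and fU: "f ` standard_simplex (q - 1) \<subseteq> U m"
          using subsetD[OF keys_chain_part that] by auto
        then have "singular_simplex (q - 1) (subtopology ?X W) f"
          using bc[unfolded singular_chain_def] by blast
        then show ?thesis using order_trans[OF fU UC] by (simp add: singular_simplex_subtopology)
      qed
      note * = this
      have "singular_chain (q - 1) ?X (chain_part (q - 1) (U m) (chain_boundary q c))"
        unfolding singular_chain_def by (rule subsetI, rule CollectI) (simp only: *)
      then show ?thesis
        unfolding subtopology_nerve_realisation[OF sub, symmetric] singular_chain_subtopology
          part_boundary using * by simp
    qed
    have "singular_relcycle q (nerve_realisation ?C) ?S (chain_part q (U m) c)"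
      using 1 2 by (simp add: singular_relcycle)
    moreover have "?r \<in> ?S \<rightarrow> realisation_points {v \<in> P. v < m}"
    proof
      fix t assume t: "t \<in> ?S"
      have "?C - M = {v \<in> P. v < m}"
        using P m unfolding ranked_def M_def by (auto simp: le_less) (metis less_irrefl)
      then show "?r t \<in> realisation_points {v \<in> P. v < m}"
        using push_off_clears[of t ?C M] t by (auto simp: W_def)
    qed
    ultimately show ?thesis
      unfolding y_def by (intro singular_relcycle_chain_map[OF _ continuous_push_off])
  qed
  then show ?thesis
    using F hom unfolding M_def by (intro exI[of _ ?F] exI[of _ y]) auto
qed

lemma singular_chain_power_subdivision:
  "singular_chain p X c \<Longrightarrow> singular_chain p X ((singular_subdivision p ^^ k) c)"
  by (induction k) (auto simp: singular_chain_singular_subdivision)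

lemma chain_boundary_power_subdivision:
  assumes "singular_chain p X c"
  shows "chain_boundary p ((singular_subdivision p ^^ k) c) = (singular_subdivision (p - 1) ^^ k) (chain_boundary p c)"
  by (induction k)
     (auto simp: chain_boundary_singular_subdivision[OF singular_chain_power_subdivision[OF assms]])

lemma homologous_rel_power_subdivision:
  assumes "singular_relcycle p X T c"
  shows "homologous_rel p X T c ((singular_subdivision p ^^ k) c)"
proof (induction k)
  case (Suc k)
  then have "singular_relcycle p X T ((singular_subdivision p ^^ k) c)"
    using homologous_rel_singular_relcycle_1 assms by blast
  then show ?case
    using homologous_rel_trans[OF _ Suc] homologous_rel_singular_subdivision homologous_rel_sym by fastforce
qed simp

lemma singular_subdivision_power_add:
  "(singular_subdivision p ^^ n) (a + b) = (singular_subdivision p ^^ n) a + (singular_subdivision p ^^ n) b"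
  by (induction n) (auto simp: singular_subdivision_add)

text \<open>
  Different top elements do not interfere. After subdivision, a chain that bounds \<open>y\<close> relative to the
  subcomplex without \<open>m\<close> is the sum of a chain in the star of \<open>m\<close>, hence in the cone, and one of weight
  less than 1/2 at \<open>m\<close>. Applying \<^const>\<open>push_off\<close> moves what the latter contributes to the boundary into
  the base of the cone.
\<close>

lemma cone_boundary_reflected:
  fixes P :: "'a::order set"
  assumes P: "ranked r (Suc n) P" and m: "m \<in> P" "r m = n"
    and y: "singular_relcycle q (nerve_realisation {v \<in> P. v \<le> m}) (realisation_points {v \<in> P. v < m}) y"
    and b: "singular_relboundary q (nerve_realisation P) (realisation_points (P - {m})) y"
  shows "singular_relboundary q (nerve_realisation {v \<in> P. v \<le> m}) (realisation_points {v \<in> P. v < m}) y"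
proof -
  let ?X = "nerve_realisation P" and ?B = "realisation_points (P - {m})"
  let ?C = "nerve_realisation {v \<in> P. v \<le> m}" and ?L = "realisation_points {v \<in> P. v < m}"
  let ?c = "realisation_points {v \<in> P. v \<le> m}"
  define W where "W = {t \<in> realisation_points P. weight (indicator {m}) t < 1/2}"
  let ?S = "W \<inter> ?c" and ?r = "push_off {m} 1"
  have sub: "{v \<in> P. v \<le> m} \<subseteq> P" "P - {m} \<subseteq> P" "{v \<in> P. v < m} \<subseteq> {v \<in> P. v \<le> m}" by auto
  have BW: "?B \<subseteq> W"
    using weight_off[of _ P "{m}"] realisation_points_mono[OF sub(2)] unfolding W_def by auto
  have openW: "openin ?X W" unfolding W_def by (rule openin_weight_less)
  have closedB: "closedin ?X ?B" by (rule closedin_realisation_points) auto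
  have Bc: "topspace ?X - ?B \<subseteq> ?c"
  proof
    fix t assume t: "t \<in> topspace ?X - ?B"
    then have "t m \<noteq> 0"
      using realisation_points_iff_support[OF sub(2), of t] realisation_points_support[of t P]
      by (auto simp: topspace_nerve_realisation)
    then show "t \<in> ?c" using star_in_cone[OF P m] t by (simp add: topspace_nerve_realisation)
  qed
  obtain d e where d: "singular_chain (Suc q) ?X d" and e: "singular_chain q (subtopology ?X ?B) e"
    and de: "chain_boundary (Suc q) d + e = y"
    using b by (auto simp: singular_relboundary)
  have "?X closure_of ?B \<subseteq> ?X interior_of W"
    using BW by (simp add: closure_of_closedin closedB interior_of_openin openW)
  moreover have "W \<subseteq> topspace ?X" using openW by (rule openin_subset)
  moreover have "singular_chain (Suc q) (subtopology ?X (topspace ?X)) d" using d by simp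
  ultimately obtain k d1 d2 where d1: "singular_chain (Suc q) (subtopology ?X (topspace ?X - ?B)) d1"
    and d2: "singular_chain (Suc q) (subtopology ?X W) d2"
    and split: "(singular_subdivision (Suc q) ^^ k) d = d1 + d2"
    by (rule excised_chain_exists)
  let ?y = "(singular_subdivision q ^^ k) y"
  \<comment> \<open>the part near the complement; it lies in the cone because the subdivided \<open>y\<close> and the boundary of \<open>d1\<close> do\<close>
  define e' where "e' = chain_boundary (Suc q) d2 + (singular_subdivision q ^^ k) e"
  have yC: "singular_chain q ?C y" using y by (simp add: singular_relcycle)
  have y': "?y = chain_boundary (Suc q) d1 + e'"
  proof -
    have "?y = (singular_subdivision q ^^ k) (chain_boundary (Suc q) d) + (singular_subdivision q ^^ k) e"
      unfolding de[symmetric] by (rule singular_subdivision_power_add)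
    also have "(singular_subdivision q ^^ k) (chain_boundary (Suc q) d) = chain_boundary (Suc q) (d1 + d2)"
      using chain_boundary_power_subdivision[OF d, of k] split by simp
    finally show ?thesis by (simp add: e'_def chain_boundary_add add.assoc)
  qed
  have d1C: "singular_chain (Suc q) ?C d1"
    using singular_chain_mono[OF d1 Bc] by (simp add: subtopology_nerve_realisation[OF sub(1)])
  have "singular_chain q (subtopology ?X W) e'"
    unfolding e'_def
    using singular_chain_boundary[OF d2] singular_chain_power_subdivision[OF singular_chain_mono[OF e BW]]
    by (simp add: singular_chain_add)
  moreover have "singular_chain q ?C e'"
  proof -
    have "e' = ?y - chain_boundary (Suc q) d1" using y' by simp
    then show ?thesis
      using singular_chain_power_subdivision[OF yC] singular_chain_boundary[OF d1C]
      by (simp add: singular_chain_diff)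
  qed
  ultimately have "singular_chain q (subtopology ?C ?S) e'"
    using singular_chain_nerve_Int[OF sub(1), of W q e'] unfolding W_def by auto
  then have 1: "singular_relboundary q ?C ?S ?y"
    unfolding singular_relboundary y' using d1C by blast
  have LS: "?L \<subseteq> ?S"
  proof -
    have "{v \<in> P. v < m} \<subseteq> P - {m}" by auto
    then show ?thesis using BW realisation_points_mono[OF sub(3)] realisation_points_mono by blast
  qed
  have "homologous_rel q ?C ?S y ?y"
    by (rule homologous_rel_power_subdivision[OF singular_relcycle_mono[OF y LS]])
  then have "singular_relboundary q ?C ?S y"
    using 1 singular_relboundary_add[of q ?C ?S "y - ?y" ?y] by (simp add: homologous_rel_def)
  moreover have "?r \<in> ?S \<rightarrow> ?L"
  proof
    fix t assume t: "t \<in> ?S"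
    have "{v \<in> P. v \<le> m} - {m} = {v \<in> P. v < m}" by auto
    then show "?r t \<in> ?L"
      using push_off_clears[of t "{v \<in> P. v \<le> m}" "{m}"] t by (auto simp: W_def)
  qed
  ultimately have "singular_relboundary q ?C ?L (chain_map q ?r y)"
    by (intro singular_relboundary_chain_map[OF _ continuous_push_off])
  then show ?thesis
    using push_off_chain[OF y, of "{m}"] singular_relboundary_add[of q ?C ?L "y - chain_map q ?r y" "chain_map q ?r y"]
    by (simp add: homologous_rel_def)
qed

lemma keys_diff_snoc_slice:
  assumes "Poly_Mapping.keys c \<subseteq> flags r (Suc n) P" "r m = n"
  shows "Poly_Mapping.keys (c - snoc_chain n m (slice n m c)) \<subseteq> flags r (Suc n) (P - {m})"
  using assms(1)
proof (induction c rule: frag_induction)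
  case (one x)
  show ?case
  proof (cases "x n = m")
    case True
    then have "(restrict x {..<n})(n := m) = x"
      using one by (auto simp: flags_def PiE_iff extensional_def fun_eq_iff)
    then show ?thesis using True by (simp add: slice_of snoc_chain_of)
  next
    case False
    have "x i \<noteq> m" if "i < Suc n" for i
      using one assms(2) that False unfolding flags_def by (metis (mono_tags, lifting) mem_Collect_eq)
    then have "x \<in> flags r (Suc n) (P - {m})"
      using one unfolding flags_def by (auto simp: PiE_iff)
    then show ?thesis using False by (simp add: slice_of)
  qed
next
  case (diff a b)
  have "a - b - snoc_chain n m (slice n m (a - b)) =
      (a - snoc_chain n m (slice n m a)) - (b - snoc_chain n m (slice n m b))"
    by (simp add: slice_diff snoc_chain_diff)
  show ?case
    unfolding \<open>a - b - _ = _\<close>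
    using keys_diff[of "a - snoc_chain n m (slice n m a)" "b - snoc_chain n m (slice n m b)"] diff by blast
qed simp

text \<open>
  By \<open>relative_cycle_splits\<close> every relative class is a sum of classes of the cones, which are described
  by \<open>cone_relative_cycles\<close>. If a chain of flags bounds, then so does the part of it in each cone
  separately, by \<open>cone_boundary_reflected\<close>, and is zero.
\<close>

lemma relative_homology_by_flags:
  fixes P :: "'a::order set"
  assumes P: "ranked r (Suc n) P"
    and hyp: "\<And>m. \<lbrakk>1 \<le> n; m \<in> P; r m = n\<rbrakk> \<Longrightarrow> homology_by_flags r n {v \<in> P. v < m}"
  defines "X \<equiv> nerve_realisation P" and "A \<equiv> realisation_points {v \<in> P. r v < n}"
  shows relative_vanishing:
      "\<And>q z. n < q \<Longrightarrow> singular_relcycle q X A z \<Longrightarrow> singular_relboundary q X A z"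
    and relative_surj:
      "\<And>z. singular_relcycle n X A z \<Longrightarrow> \<exists>c \<in> rel_top_cycles r n P. homologous_rel n X A z (flag_chain n c)"
    and relative_inj:
      "\<And>c. c \<in> rel_top_cycles r n P \<Longrightarrow> singular_relboundary n X A (flag_chain n c) \<Longrightarrow> c = 0"
proof -
  let ?C = "\<lambda>m. nerve_realisation {v \<in> P. v \<le> m}" and ?L = "\<lambda>m. realisation_points {v \<in> P. v < m}"
  have up: "singular_relboundary q X A c" if "singular_relboundary q (?C m) (?L m) c" "m \<in> P" "r m = n" for q c m
    unfolding X_def A_def
  proof (rule singular_relboundary_nerve_mono[OF _ _ _ _ that(1)])
    show "{v \<in> P. v < m} \<subseteq> {v \<in> P. r v < n}"
      using P that unfolding ranked_def by auto
  qed auto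
  show "singular_relboundary q X A z" if q: "n < q" and z: "singular_relcycle q X A z" for q z
  proof -
    obtain F y where F: "finite F" "F \<subseteq> {v \<in> P. r v = n}"
      and y: "\<forall>m\<in>F. singular_relcycle q (?C m) (?L m) (y m)"
      and hom: "homologous_rel q X A z (\<Sum>m\<in>F. y m)"
      using relative_cycle_splits[OF P z[unfolded X_def A_def]] unfolding X_def A_def by blast
    have "singular_relboundary q X A (y m)" if "m \<in> F" for m
    proof (rule up)
      show m: "m \<in> P" "r m = n" using F that by auto
      show "singular_relboundary q (?C m) (?L m) (y m)"
        by (rule cone_relative_vanishing[OF P m _ q]) (use hyp m y that in auto)
    qed
    then have "homologous_rel q X A (\<Sum>m\<in>F. y m) (\<Sum>m\<in>F. 0)"
      using F by (intro homologous_rel_sum) (auto simp: homologous_rel_def)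
    from homologous_rel_trans[OF this hom] show ?thesis by (simp add: homologous_rel_def)
  qed
  show "\<exists>c \<in> rel_top_cycles r n P. homologous_rel n X A z (flag_chain n c)"
    if z: "singular_relcycle n X A z" for z
  proof -
    obtain F y where F: "finite F" "F \<subseteq> {v \<in> P. r v = n}"
      and y: "\<forall>m\<in>F. singular_relcycle n (?C m) (?L m) (y m)"
      and hom: "homologous_rel n X A z (\<Sum>m\<in>F. y m)"
      using relative_cycle_splits[OF P z[unfolded X_def A_def]] unfolding X_def A_def by blast
    have "\<exists>c \<in> top_cycles r n {v \<in> P. v < m}. homologous_rel n (?C m) (?L m) (y m) (flag_chain n (snoc_chain n m c))"
      if "m \<in> F" for m
    proof -
      have m: "m \<in> P" "r m = n" using F that by auto
      show ?thesis
        by (rule cone_relative_surj[OF P m]) (use hyp m y that in auto)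
    qed
    then have "\<forall>m\<in>F. \<exists>c. c \<in> top_cycles r n {v \<in> P. v < m} \<and>
        homologous_rel n (?C m) (?L m) (y m) (flag_chain n (snoc_chain n m c))"
      by blast
    from bchoice[OF this] obtain c where c: "\<And>m. m \<in> F \<Longrightarrow> c m \<in> top_cycles r n {v \<in> P. v < m}"
      "\<And>m. m \<in> F \<Longrightarrow> homologous_rel n (?C m) (?L m) (y m) (flag_chain n (snoc_chain n m (c m)))"
      by blast
    let ?c = "\<Sum>m\<in>F. snoc_chain n m (c m)"
    have "homologous_rel n X A (y m) (flag_chain n (snoc_chain n m (c m)))" if "m \<in> F" for m
      using up[of n m] c(2)[OF that] F that unfolding homologous_rel_def by auto
    then have "homologous_rel n X A (\<Sum>m\<in>F. y m) (flag_chain n ?c)"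
      unfolding flag_chain_sum[OF F(1)] using F by (intro homologous_rel_sum) auto
    moreover have "?c \<in> rel_top_cycles r n P"
    proof (rule rel_top_cycles_sum[OF _ F(1)])
      fix m assume m: "m \<in> F"
      show "snoc_chain n m (c m) \<in> rel_top_cycles r n P"
        by (rule rel_top_cycles_mono[OF snoc_chain_in_rel_top_cycles[OF c(1)[OF m]]]) (use m F in auto)
    qed
    ultimately show ?thesis using homologous_rel_trans[OF _ hom] by blast
  qed
  show "c = 0" if c: "c \<in> rel_top_cycles r n P" and b: "singular_relboundary n X A (flag_chain n c)" for c
  proof -
    have keys: "Poly_Mapping.keys c \<subseteq> flags r (Suc n) P" using c by (simp add: rel_top_cycles_def)
    let ?F = "(\<lambda>x. x n) ` Poly_Mapping.keys c"
    have "slice n m c = 0" if "m \<in> ?F" for m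
    proof -
      have m: "m \<in> P" "r m = n" using that keys by (auto simp: flags_def PiE_iff)
      let ?y = "flag_chain n (snoc_chain n m (slice n m c))"
      have sl: "slice n m c \<in> top_cycles r n {v \<in> P. v < m}" by (rule slice_in_top_cycles[OF c])
      have sn: "snoc_chain n m (slice n m c) \<in> rel_top_cycles r n {v \<in> P. v \<le> m}"
        by (rule snoc_chain_in_rel_top_cycles[OF sl m])
      have below: "{v \<in> {v \<in> P. v \<le> m}. r v < n} \<subseteq> {v \<in> P. v < m}"
        using m by (auto simp: le_less)
      have ycyc: "singular_relcycle n (?C m) (?L m) ?y"
        unfolding singular_relcycle
      proof
        show "singular_chain n (?C m) ?y"
          using sn by (intro singular_chain_flag_chain[of _ r]) (simp add: rel_top_cycles_def)
        show "singular_chain (n - 1) (subtopology (?C m) (?L m)) (chain_boundary n ?y)"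
        proof (cases "n = 0")
          case False
          have keys_in: "Poly_Mapping.keys (face_chain n n (snoc_chain n m (slice n m c))) \<subseteq> flags r (Suc (n - 1)) {v \<in> P. v < m}"
            using face_chain_snoc_chain_last[of "slice n m c" r n "{v \<in> P. v < m}" m] sl False
            by (simp add: top_cycles_def)
          have "singular_chain (n - 1) (nerve_realisation {v \<in> P. v < m}) (chain_boundary n ?y)"
            using chain_boundary_rel_top_cycle[OF sn] False singular_chain_flag_chain[OF keys_in]
            by (simp add: singular_chain_cmul)
          moreover have "subtopology (?C m) (?L m) = nerve_realisation {v \<in> P. v < m}"
            by (rule subtopology_nerve_realisation) auto
          ultimately show ?thesis by simp
        qed (simp add: chain_boundary_def)
      qed
      have "singular_relboundary n X (realisation_points (P - {m})) ?y"
      proof -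
        have "{v \<in> P. r v < n} \<subseteq> P - {m}" using m by auto
        \<comment> \<open>relative to the subcomplex without \<open>m\<close>, only the flags that end in \<open>m\<close> count\<close>
        then have 1: "singular_relboundary n X (realisation_points (P - {m})) (flag_chain n c)"
          using singular_relboundary_mono[OF b] realisation_points_mono unfolding A_def by blast
        have "singular_chain n (nerve_realisation (P - {m})) (flag_chain n (c - snoc_chain n m (slice n m c)))"
          by (rule singular_chain_flag_chain[OF keys_diff_snoc_slice[OF keys m(2)]])
        moreover have "subtopology X (realisation_points (P - {m})) = nerve_realisation (P - {m})"
          unfolding X_def by (rule subtopology_nerve_realisation) auto
        ultimately have "singular_relboundary n X (realisation_points (P - {m})) (flag_chain n (c - snoc_chain n m (slice n m c)))"
          by (intro singular_chain_imp_relboundary) simp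
        from singular_relboundary_diff[OF 1 this] show ?thesis
          by (simp add: flag_chain_diff)
      qed
      then have "singular_relboundary n (?C m) (?L m) ?y"
        using cone_boundary_reflected[OF P m ycyc] by (simp add: X_def)
      then show ?thesis
        using cone_relative_inj[OF P m _ sl] hyp m by simp
    qed
    moreover have "(\<Sum>m\<in>?F. snoc_chain n m (slice n m c)) = c"
      by (rule sum_snoc_slice) (use keys in \<open>auto simp: flags_def PiE_iff\<close>)
    ultimately show ?thesis by simp
  qed
qed

text \<open>
  Induction with the exact sequence of the pair of \<open>P\<close> and its part of rank less than \<open>n\<close>. The homology
  of the latter vanishes in degree \<open>n\<close>, so that a class of \<open>P\<close> in this degree is determined by its
  relative class, which is a chain of flags; the last face of this chain bounds in the lower part and is
  therefore zero by the injectivity in degree \<open>n - 1\<close>. The flags below a single top element satisfy the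
  induction hypothesis as well, which is what the relative homology requires.
\<close>

theorem homology_by_flags:
  assumes "ranked r n P" "1 \<le> n"
  shows "homology_by_flags r n P"
  using assms
proof (induction n arbitrary: P)
  case (Suc n)
  note P = Suc.prems(1)
  have hyp: "homology_by_flags r n {v \<in> P. v < m}" if "1 \<le> n" "m \<in> P" "r m = n" for m
    using Suc.IH[OF ranked_below[OF P that(2,3)] that(1)] .
  let ?X = "nerve_realisation P" and ?A = "realisation_points {v \<in> P. r v < n}"
  let ?P' = "{v \<in> P. r v < n}"
  have XA: "subtopology ?X ?A = nerve_realisation ?P'"
    by (rule subtopology_nerve_realisation) auto
  have lower: "\<lbrakk>1 \<le> n\<rbrakk> \<Longrightarrow> homology_by_flags r n ?P'"
    using Suc.IH[OF ranked_lower[OF P]] .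

  have chainA: "singular_chain q ?X w" if "singular_chain q (nerve_realisation ?P') w" for q w
    using singular_chain_nerve_mono[of ?P' P q w] that by auto
  have A0: "w = 0" if "n = 0" "singular_chain q (nerve_realisation ?P') w" for q w
    using that by (simp add: singular_chain_empty topspace_nerve_realisation)

  have relcyc: "singular_relcycle q ?X ?A z" if "singular_relcycle q ?X {} z" for q z
    using singular_relcycle_mono[OF that] by simp
  have lowbounds: "\<exists>f. singular_chain (Suc q) ?X f \<and> chain_boundary (Suc q) f = e"
    if e: "singular_chain q (nerve_realisation ?P') e" "chain_boundary q e = 0" and q: "n \<le> q" for q e
  proof (cases "n = 0")
    case True
    then show ?thesis using A0[OF True e(1)] by (intro exI[of _ 0]) simp
  next
    case False
    then have "singular_relboundary q (nerve_realisation ?P') {} e"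
      using homology_by_flags_vanishing[OF lower q] e by (simp add: singular_cycle)
    then show ?thesis using chainA by (auto simp: singular_boundary)
  qed
  show ?case
    unfolding homology_by_flags_def diff_Suc_1
  proof (intro conjI allI impI ballI)
    fix q z assume q: "Suc n \<le> q" and z: "singular_relcycle q ?X {} z"
    have "singular_relboundary q ?X ?A z"
      by (rule relative_vanishing[OF P hyp]) (use q relcyc[OF z] in auto)
    then obtain d e where d: "singular_chain (Suc q) ?X d" and e: "singular_chain q (nerve_realisation ?P') e"
      and eq: "chain_boundary (Suc q) d + e = z"
      by (auto simp: singular_relboundary XA)
    have "chain_boundary q e = 0"
      using z eq chain_boundary_boundary_alt[OF d] by (auto simp: singular_cycle chain_boundary_add)
    then obtain f where "singular_chain (Suc q) ?X f" "chain_boundary (Suc q) f = e"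
      using lowbounds[OF e] q by auto
    then show "singular_relboundary q ?X {} z"
      unfolding singular_boundary using d eq
      by (intro exI[of _ "d + f"]) (simp add: singular_chain_add chain_boundary_add)
  next
    fix z assume z: "singular_relcycle n ?X {} z" and sum: "Suc n = 1 \<longrightarrow> coefficient_sum z = 0"
    have "\<exists>c \<in> rel_top_cycles r n P. homologous_rel n ?X ?A z (flag_chain n c)"
      by (rule relative_surj[OF P hyp]) (use relcyc[OF z] in auto)
    then obtain c where c: "c \<in> rel_top_cycles r n P" and "homologous_rel n ?X ?A z (flag_chain n c)"
      by blast
    then obtain d e where d: "singular_chain (Suc n) ?X d" and e: "singular_chain n (nerve_realisation ?P') e"
      and eq: "chain_boundary (Suc n) d + e = z - flag_chain n c"
      by (auto simp: homologous_rel_def singular_relboundary XA)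
    have be: "chain_boundary n e = - chain_boundary n (flag_chain n c)"
    proof -
      have "chain_boundary n (chain_boundary (Suc n) d) + chain_boundary n e
          = chain_boundary n z - chain_boundary n (flag_chain n c)"
        using eq by (metis chain_boundary_add chain_boundary_diff)
      then show ?thesis using z chain_boundary_boundary_alt[OF d] by (simp add: singular_cycle)
    qed
    have "face_chain n n c = 0"
    proof (cases "n = 0")
      case True
      have "coefficient_sum z = coefficient_sum (flag_chain n c)"
        using eq A0[OF True e] coefficient_sum_boundary[of d] True
        by (metis add.right_neutral coefficient_sum_diff eq_iff_diff_eq_0)
      then have "coefficient_sum (face_chain n n c) = 0"
        using sum True unfolding flag_chain_def face_chain_def coefficient_sum_map by simp
      moreover have "Poly_Mapping.keys (face_chain n n c) \<subseteq> {\<lambda>_. undefined}"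
        using face_chain_last_keys[of c r n P] c True by (auto simp: rel_top_cycles_def flags_def)
      ultimately show ?thesis using frag_eq_coefficient_sum[of "face_chain n n c"] by simp
    next
      case False
      have top: "face_chain n n c \<in> top_cycles r n ?P'" by (rule face_chain_last_in_top_cycles[OF c])
      have "chain_boundary n e = flag_chain (n - 1) (frag_cmul (- ((-1) ^ n)) (face_chain n n c))"
        using be chain_boundary_rel_top_cycle[OF c] False by (simp add: flag_chain_cmul)
      then have "singular_relboundary (n - 1) (nerve_realisation ?P') {}
          (flag_chain (n - 1) (frag_cmul (- ((-1) ^ n)) (face_chain n n c)))"
        using e False by (auto simp: singular_boundary)
      then have "frag_cmul (- ((-1) ^ n)) (face_chain n n c) = 0"
        using homology_by_flags_inj[OF lower top_cycles_cmul[OF top, of "- ((-1) ^ n)"]] False by simp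
      then show ?thesis by simp
    qed
    then have cyc: "c \<in> top_cycles r (Suc n) P"
      using c by (auto simp: top_cycles_def rel_top_cycles_def less_Suc_eq)
    have "chain_boundary n e = 0"
    proof (cases "n = 0")
      case False
      then show ?thesis
        using be chain_boundary_rel_top_cycle[OF c] \<open>face_chain n n c = 0\<close> by simp
    qed (simp add: chain_boundary_def)
    then obtain f where "singular_chain (Suc n) ?X f" "chain_boundary (Suc n) f = e"
      using lowbounds[OF e] by auto
    then have "homologous_rel n ?X {} z (flag_chain n c)"
      unfolding homologous_rel_def singular_boundary using d eq
      by (intro exI[of _ "d + f"]) (simp add: singular_chain_add chain_boundary_add)
    then show "\<exists>c\<in>top_cycles r (Suc n) P. homologous_rel n ?X {} z (flag_chain n c)"
      using cyc by blast
  next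
    fix c assume c: "c \<in> top_cycles r (Suc n) P" and b: "singular_relboundary n ?X {} (flag_chain n c)"
    show "c = 0"
    proof (rule relative_inj[OF P hyp])
      show "c \<in> rel_top_cycles r n P" using c by (simp add: top_cycles_def rel_top_cycles_def)
      show "singular_relboundary n ?X ?A (flag_chain n c)"
        using singular_relboundary_mono[OF b] by simp
    qed
  qed
qed simp


section \<open>The Steinberg module as a group of cycles of flags\<close>

definition flag_class :: "nat \<Rightarrow> 'a::order set \<Rightarrow> ((nat \<Rightarrow> 'a) \<Rightarrow>\<^sub>0 int) \<Rightarrow> ('a \<Rightarrow> real) chain set" where
  "flag_class n P c = homologous_rel_set n (nerve_realisation P) {} (flag_chain n c)"

lemma top_cycle_is_cycle:
  assumes c: "c \<in> top_cycles r (Suc n) P"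
  shows "singular_relcycle n (nerve_realisation P) {} (flag_chain n c)"
proof -
  have "chain_boundary n (flag_chain n c) = 0"
  proof (cases "n = 0")
    case False
    then show ?thesis
      using c by (simp add: chain_boundary_flag_chain top_cycles_def less_Suc_eq_le)
  qed (simp add: chain_boundary_def)
  then show ?thesis
    using c singular_chain_flag_chain[of c r n P] by (simp add: singular_cycle top_cycles_def)
qed

lemma chain_map_to_point:
  "chain_map 0 (\<lambda>_. ()) z = 0 \<longleftrightarrow> coefficient_sum z = 0"
proof
  let ?g = "\<lambda>_::unit. restrict (\<lambda>_::nat \<Rightarrow> real. ()) (standard_simplex 0)"
  have "chain_map 0 (\<lambda>_. ()) z = frag_extend (frag_of \<circ> ?g) (coefficient_sum z)"
    unfolding coefficient_sum_def chain_map_def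
    using frag_extend_compose[of "frag_of \<circ> ?g" "\<lambda>_. ()" z]
    by (simp add: o_def simplex_map_def)
  then show "coefficient_sum z = 0 \<Longrightarrow> chain_map 0 (\<lambda>_. ()) z = 0" by simp
  have "coefficient_sum (chain_map 0 (\<lambda>_. ()) z) = coefficient_sum z"
    unfolding chain_map_def by (rule coefficient_sum_map)
  then show "chain_map 0 (\<lambda>_. ()) z = 0 \<Longrightarrow> coefficient_sum z = 0"
    by (metis coefficient_sum_def frag_extend_0)
qed

text \<open>
  Reduced homology is the kernel of the map induced by the projection to a point. In degree 0 the
  homology of the point is detected by the coefficient sum, in positive degrees it is zero.
\<close>

lemma class_in_reduced_homology:
  assumes z: "singular_relcycle n X {} z"
  shows "homologous_rel_set n X {} z \<in> carrier (reduced_homology_group (int n) X)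
     \<longleftrightarrow> (n = 0 \<longrightarrow> coefficient_sum z = 0)"
proof -
  let ?pt = "discrete_topology {()}" and ?h = "\<lambda>_. ()"
  have tp: "topspace ?pt = {()}" by simp
  have "homologous_rel_set n X {} z \<in> carrier (homology_group (int n) X)"
    using z by (auto simp: carrier_relative_homology_group)
  moreover have "hom_induced (int n) X {} ?pt {} ?h (homologous_rel_set n X {} z)
      = homologous_rel_set n ?pt {} (chain_map n ?h z)"
    by (rule hom_induced_chain_map) (use z in auto)
  ultimately have "homologous_rel_set n X {} z \<in> carrier (reduced_homology_group (int n) X)
     \<longleftrightarrow> singular_relboundary n ?pt {} (chain_map n ?h z)"
    unfolding carrier_reduced_homology_group kernel_def
    by (simp add: homologous_rel_set_eq_relboundary)
  also have "\<dots> \<longleftrightarrow> (n = 0 \<longrightarrow> coefficient_sum z = 0)"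
  proof -
    have "singular_relcycle n ?pt {} (chain_map n ?h z)"
      by (rule singular_relcycle_chain_map[OF z]) auto
    then show ?thesis
      using singular_boundary_eq_cycle_singleton[OF tp, of n "chain_map n ?h z"]
        singular_boundary_singleton[OF tp, of n "chain_map n ?h z"] chain_map_to_point[of z]
      by (cases "n = 0") (auto simp: singular_cycle)
  qed
  finally show ?thesis .
qed

lemma homologous_rel_set_add:
  "homologous_rel_set n X S a \<otimes>\<^bsub>relative_homology_group (int n) X S\<^esub> homologous_rel_set n X S b
   = homologous_rel_set n X S (a + b)"
proof -
  have "x \<in> (\<Union>r\<in>homologous_rel_set n X S a. \<Union>s\<in>homologous_rel_set n X S b. {r + s})"
    if "homologous_rel n X S (a + b) x" for x
  proof -
    have "homologous_rel n X S b (x - a)"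
      using that by (simp add: homologous_rel_def algebra_simps)
    then show ?thesis
      by (intro UN_I[of a] UN_I[of "x - a"]) auto
  qed
  then show ?thesis
    unfolding mult_relative_homology_group by (auto intro: homologous_rel_add)
qed

lemma bij_betw_flag_class:
  assumes P: "ranked r (Suc n) P"
  shows "bij_betw (flag_class n P) (top_cycles r (Suc n) P)
     (carrier (reduced_homology_group (int n) (nerve_realisation P)))"
proof -
  let ?X = "nerve_realisation P"
  have H: "homology_by_flags r (Suc n) P" using homology_by_flags[OF P] by simp
  have "inj_on (flag_class n P) (top_cycles r (Suc n) P)"
  proof (rule inj_onI)
    fix a b assume a: "a \<in> top_cycles r (Suc n) P" and b: "b \<in> top_cycles r (Suc n) P"
      and eq: "flag_class n P a = flag_class n P b"
    have "a + frag_cmul (- 1) b \<in> top_cycles r (Suc n) P"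
      using a b by (intro top_cycles_add top_cycles_cmul)
    then have ab: "a - b \<in> top_cycles r (Suc n) P" by simp
    have "homologous_rel n ?X {} (flag_chain n a) (flag_chain n b)"
      using eq unfolding flag_class_def homologous_rel_set_eq .
    then have "singular_relboundary n ?X {} (flag_chain n (a - b))"
      by (simp add: homologous_rel_def flag_chain_diff)
    then have "a - b = 0" using homology_by_flags_inj[OF H ab] by simp
    then show "a = b" by simp
  qed
  moreover have "flag_class n P c \<in> carrier (reduced_homology_group (int n) ?X)"
    if c: "c \<in> top_cycles r (Suc n) P" for c
    unfolding flag_class_def class_in_reduced_homology[OF top_cycle_is_cycle[OF c]]
  proof
    assume "n = 0"
    then have "coefficient_sum (face_chain 0 0 c) = 0"
      using c by (simp add: top_cycles_def coefficient_sum_def)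
    then show "coefficient_sum (flag_chain n c) = 0"
      unfolding face_chain_def flag_chain_def coefficient_sum_map .
  qed
  moreover have "x \<in> flag_class n P ` top_cycles r (Suc n) P"
    if x: "x \<in> carrier (reduced_homology_group (int n) ?X)" for x
  proof -
    have "x \<in> carrier (homology_group (int n) ?X)"
      using x carrier_reduced_homology_group_subset by blast
    then obtain z where z: "singular_relcycle n ?X {} z" and xz: "x = homologous_rel_set n ?X {} z"
      by (auto simp: carrier_relative_homology_group)
    have "n = 0 \<longrightarrow> coefficient_sum z = 0"
      using x class_in_reduced_homology[OF z] unfolding xz by simp
    then obtain c where c: "c \<in> top_cycles r (Suc n) P" "homologous_rel n ?X {} z (flag_chain n c)"
      using homology_by_flags_surj[OF H, of z] z by auto
    have "x = flag_class n P c"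
      unfolding xz flag_class_def homologous_rel_set_eq by (rule c(2))
    then show ?thesis using c(1) by blast
  qed
  ultimately show ?thesis unfolding bij_betw_def by blast
qed

lemma flag_class_add:
  "flag_class n P (a + b) = flag_class n P a \<otimes>\<^bsub>reduced_homology_group (int n) (nerve_realisation P)\<^esub> flag_class n P b"
  unfolding flag_class_def reduced_homology_group_def mult_subgroup_generated
    homologous_rel_set_add flag_chain_add ..

lemma comm_group_reduced_homology: "comm_group (reduced_homology_group p X)"
  unfolding reduced_homology_group_def
  by (intro group.abelian_subgroup_generated group_relative_homology_group abelian_homology_group)

subsection \<open>The action\<close>

definition move_flags :: "nat \<Rightarrow> ('v \<Rightarrow> 'v) \<Rightarrow> ((nat \<Rightarrow> 'v set) \<Rightarrow>\<^sub>0 int) \<Rightarrow> ((nat \<Rightarrow> 'v set) \<Rightarrow>\<^sub>0 int)" where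
  "move_flags n g c = frag_extend (frag_of \<circ> (\<lambda>x. restrict (\<lambda>i. g ` x i) {..<n})) c"

lemma simplex_point_restrict: "simplex_point p (restrict x {..p}) = simplex_point p x"
  by (intro ext) (auto simp: simplex_point_alt intro!: sum.cong)

lemma building_map_simplex_point:
  assumes "bij g"
  shows "building_map g (simplex_point p x s) = simplex_point p (\<lambda>i. g ` x i) s"
proof
  fix W
  have "A = g -` W \<longleftrightarrow> g ` A = W" for A
    using assms by (metis bij_def inj_vimage_image_eq surj_image_vimage_eq)
  then show "building_map g (simplex_point p x s) W = simplex_point p (\<lambda>i. g ` x i) s W"
    unfolding building_map_def simplex_point_def by simp
qed

lemma image_nerve_simplex:
  assumes "\<And>W. W \<in> P \<Longrightarrow> g ` W \<in> P" "x \<in> nerve_simplices P p"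
  shows "restrict (\<lambda>i. g ` x i) {..p} \<in> nerve_simplices P p"
proof -
  have "x i \<in> P" "i \<le> j \<Longrightarrow> x i \<le> x j" if "i \<le> p" "j \<le> p" for i j
    using assms(2) that by (auto simp: nerve_simplices_def mono_on_def)
  then show ?thesis
    using assms(1) unfolding nerve_simplices_def mono_on_def by (simp add: image_mono)
qed

lemma continuous_map_building_map:
  assumes g: "bij g" "\<And>W. W \<in> P \<Longrightarrow> g ` W \<in> P"
  shows "continuous_map (nerve_realisation P) (nerve_realisation P) (building_map g)"
proof (rule continuous_map_nerve_realisation)
  fix p x assume x: "x \<in> nerve_simplices P p"
  have "continuous_map (simplex_top p) (nerve_realisation P) (simplex_point p (restrict (\<lambda>i. g ` x i) {..p}))"
    by (rule continuous_map_simplex_point[OF image_nerve_simplex[OF g(2) x]])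
  then show "continuous_map (simplex_top p) (nerve_realisation P) (building_map g \<circ> simplex_point p x)"
    by (simp add: o_def building_map_simplex_point[OF g(1)] simplex_point_restrict)
qed

lemma chain_map_building_map:
  assumes "bij g"
  shows "chain_map n (building_map g) (flag_chain n c) = flag_chain n (move_flags (Suc n) g c)"
proof -
  have "simplex_map n (building_map g) (flag_simplex n x) = flag_simplex n (restrict (\<lambda>i. g ` x i) {..<Suc n})" for x
    unfolding simplex_map_def flag_simplex_def lessThan_Suc_atMost simplex_point_restrict
    by (rule ext) (simp add: building_map_simplex_point[OF assms])
  then show ?thesis
    unfolding chain_map_def flag_chain_def move_flags_def frag_extend_compose
    by (simp add: o_def)
qed

lemma hom_induced_flag_class:
  assumes g: "bij g" "\<And>W. W \<in> P \<Longrightarrow> g ` W \<in> P" and c: "c \<in> top_cycles r (Suc n) P"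
  shows "hom_induced (int n) (nerve_realisation P) {} (nerve_realisation P) {} (building_map g) (flag_class n P c)
     = flag_class n P (move_flags (Suc n) g c)"
  unfolding flag_class_def chain_map_building_map[OF g(1), symmetric]
  by (rule hom_induced_chain_map[OF continuous_map_building_map[OF g] _ top_cycle_is_cycle[OF c]]) auto

lemma frag_extend_const: "Poly_Mapping.keys c \<subseteq> {x} \<Longrightarrow> frag_extend (\<lambda>_. frag_of x) c = c"
  by (induction c rule: frag_induction) (auto simp: frag_extend_diff)

lemma keys_frag_extend_const: "Poly_Mapping.keys (frag_extend (frag_of \<circ> (\<lambda>_. y)) c) \<subseteq> {y}"
  using keys_frag_extend[of "frag_of \<circ> (\<lambda>_. y)" c] by (auto split: if_split_asm)

subsection \<open>Proper subspaces\<close>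

text \<open>
  Shifted so that lines have rank 0.
\<close>

definition subspace_rank :: "('f::field \<Rightarrow> 'v::ab_group_add \<Rightarrow> 'v) \<Rightarrow> 'v set \<Rightarrow> nat" where
  "subspace_rank smul W = vector_space.dim smul W - 1"

definition flag_cycles :: "('f::field \<Rightarrow> 'v::ab_group_add \<Rightarrow> 'v) \<Rightarrow> ((nat \<Rightarrow> 'v set) \<Rightarrow>\<^sub>0 int) set" where
  "flag_cycles smul =
     top_cycles (subspace_rank smul) (vector_space.dim smul (UNIV :: 'v set) - 1) (proper_subspaces smul)"

context finite_dimensional_vector_space
begin

lemma dim_proper_subspace:
  assumes "W \<in> proper_subspaces scale" shows "0 < dim W" "dim W < dim (UNIV :: 'b set)"
proof -
  have W: "subspace W" "W \<noteq> {0}" "W \<noteq> UNIV" using assms by (auto simp: proper_subspaces_def)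
  show "0 < dim W" using W dim_eq_0[of W] subspace_0[of W] by (metis empty_iff not_gr_zero subset_singletonD)
  have "span W \<subset> span UNIV" using W by (simp add: span_eq_iff[THEN iffD2] psubset_eq)
  then show "dim W < dim (UNIV :: 'b set)" by (rule dim_psubset)
qed

lemma ranked_proper_subspaces: "ranked (subspace_rank scale) (dim (UNIV :: 'b set) - 1) (proper_subspaces scale)"
  unfolding ranked_def
proof (intro conjI ballI impI)
  fix W :: "'b set" assume "W \<in> proper_subspaces scale"
  from dim_proper_subspace[OF this] show "subspace_rank scale W < dim (UNIV :: 'b set) - 1" by (simp add: subspace_rank_def)
next
  fix U W :: "'b set" assume *: "U \<in> proper_subspaces scale" "W \<in> proper_subspaces scale" "U < W"
  then have "span U = U" "span W = W" by (auto simp: proper_subspaces_def span_eq_iff)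
  then have "span U \<subset> span W" using *(3) by (simp only:)
  then have "dim U < dim W" by (rule local.dim_psubset)
  with dim_proper_subspace[OF *(1)] show "subspace_rank scale U < subspace_rank scale W" by (simp add: subspace_rank_def)
qed

lemma GL_proper_subspace:
  assumes g: "g \<in> GL scale" and W: "W \<in> proper_subspaces scale"
  shows "g ` W \<in> proper_subspaces scale"
proof -
  have lin: "Vector_Spaces.linear scale scale g" and "bij g" using g by (auto simp: GL_def)
  interpret g: Vector_Spaces.linear scale scale g by (rule lin)
  have "g ` W \<noteq> {0}"
  proof
    assume "g ` W = {0}"
    then have "g ` W = g ` {0}" by (simp add: g.zero)
    then have "W = {0}" by (simp only: inj_image_eq_iff[OF bij_is_inj[OF \<open>bij g\<close>]])
    then show False using W by (simp add: proper_subspaces_def)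
  qed
  moreover have "g ` W \<noteq> UNIV"
  proof
    assume "g ` W = UNIV"
    then have "g ` W = g ` UNIV" using \<open>bij g\<close> by (simp add: bij_is_surj)
    then show False using W \<open>bij g\<close> by (simp add: proper_subspaces_def inj_image_eq_iff bij_is_inj)
  qed
  moreover have "subspace (g ` W)"
    using W by (intro g.subspace_image) (simp add: proper_subspaces_def)
  ultimately show ?thesis by (simp add: proper_subspaces_def)
qed

text \<open>
  In dimension one the building is empty, and its homology in degree -1 is the free group on the empty
  simplex, with trivial action; it corresponds to the flag without members. This isomorphism is not an
  instance of \<^const>\<open>flag_class\<close>, hence the existential quantifier: what matters is that the map is
  bijective, additive and equivariant.
\<close>

lemma steinberg_flags:
  assumes "(UNIV :: 'b set) \<noteq> {0}"
  shows "comm_group (steinberg scale) \<and> (\<forall>g. steinberg_act scale g \<in> hom (steinberg scale) (steinberg scale)) \<and>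
    (\<exists>\<Psi>. bij_betw \<Psi> (flag_cycles scale) (carrier (steinberg scale)) \<and>
       (\<forall>a b. \<Psi> (a + b) = \<Psi> a \<otimes>\<^bsub>steinberg scale\<^esub> \<Psi> b) \<and>
       (\<forall>g \<in> GL scale. \<forall>c \<in> flag_cycles scale.
          steinberg_act scale g (\<Psi> c) = \<Psi> (move_flags (dim (UNIV :: 'b set) - 1) g c)))"
proof -
  let ?d = "dim (UNIV :: 'b set)" and ?P = "proper_subspaces scale"
  have d: "1 \<le> ?d"
  proof -
    have "\<not> (UNIV :: 'b set) \<subseteq> {0}" using assms by blast
    then have "dim (UNIV :: 'b set) \<noteq> 0" using local.dim_eq_0[of UNIV] by simp
    then show ?thesis by linarith
  qed
  show ?thesis
  proof (cases "?d = 1")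
    case False
    then obtain n where n: "?d = Suc (Suc n)"
    proof -
      have "?d = Suc (Suc (?d - 2))" using d False by linarith
      then show thesis by (rule that)
    qed
    let ?X = "nerve_realisation ?P"
    have deg: "int ?d - 2 = int n" using n by simp
    have St: "steinberg scale = reduced_homology_group (int n) ?X"
      unfolding steinberg_def reduced_homology_def tits_building_def deg by simp
    have act: "steinberg_act scale g = hom_induced (int n) ?X {} ?X {} (building_map g)" for g
      unfolding steinberg_act_def reduced_hom_induced_def tits_building_def deg by simp
    have R: "ranked (subspace_rank scale) (Suc n) ?P" using ranked_proper_subspaces n by simp
    have "bij_betw (flag_class n ?P) (flag_cycles scale) (carrier (steinberg scale))"
      using bij_betw_flag_class[OF R] unfolding St flag_cycles_def n diff_Suc_1 .
    moreover have "\<forall>g \<in> GL scale. \<forall>c \<in> flag_cycles scale.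
        steinberg_act scale g (flag_class n ?P c) = flag_class n ?P (move_flags (?d - 1) g c)"
    proof (intro ballI)
      fix g c assume g: "g \<in> GL scale" and c: "c \<in> flag_cycles scale"
      have "bij g" using g by (simp add: GL_def)
      moreover have "c \<in> top_cycles (subspace_rank scale) (Suc n) ?P"
        using c unfolding flag_cycles_def n diff_Suc_1 .
      ultimately show "steinberg_act scale g (flag_class n ?P c) = flag_class n ?P (move_flags (?d - 1) g c)"
        unfolding act n diff_Suc_1 using GL_proper_subspace[OF g]
        by (intro hom_induced_flag_class[where r = "subspace_rank scale"])
    qed
    ultimately show ?thesis
      unfolding St act using comm_group_reduced_homology hom_induced_reduced_hom flag_class_add by blast
  next
    case True
    have P: "?P = {}"
      using dim_proper_subspace True by (metis One_nat_def equals0I less_Suc0 less_numeral_extra(3))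
    let ?u = "\<lambda>_::nat \<Rightarrow> real. undefined :: 'b set \<Rightarrow> real" and ?e = "\<lambda>_::nat. undefined :: 'b set"
    let ?G = "free_Abelian_group {?u}"
    have X: "topspace (tits_building scale) = {}"
      by (simp add: tits_building_def P topspace_nerve_realisation)
    have deg: "int ?d - 2 = -1" using True by simp
    have St: "steinberg scale = ?G Mod {0}"
      unfolding steinberg_def reduced_homology_def deg using X by simp
    have act: "steinberg_act scale g = (\<lambda>c. c)" for g
      unfolding steinberg_act_def reduced_hom_induced_def deg using X by simp
    interpret G: comm_group ?G by (rule abelian_free_Abelian_group)
    have triv: "subgroup {0} ?G" using G.triv_subgroup by simp
    have coset: "{0} #>\<^bsub>?G\<^esub> c = {c}" for c by (simp add: r_coset_def)
    have Z: "flag_cycles scale = {c. Poly_Mapping.keys c \<subseteq> {?e}}"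
      using True by (auto simp: flag_cycles_def top_cycles_def flags_def)
    define \<Psi> where "\<Psi> c = {frag_extend (frag_of \<circ> (\<lambda>_. ?u)) c}" for c :: "(nat \<Rightarrow> 'b set) \<Rightarrow>\<^sub>0 int"
    have carr: "carrier (steinberg scale) = (\<lambda>c. {c}) ` {c. Poly_Mapping.keys c \<subseteq> {?u}}"
      unfolding St carrier_FactGroup coset by (simp add: free_Abelian_group_def)
    have "bij_betw \<Psi> (flag_cycles scale) (carrier (steinberg scale))"
    proof (rule bij_betw_byWitness[where f' = "\<lambda>C. frag_extend (frag_of \<circ> (\<lambda>_. ?e)) (the_elem C)"])

      show "\<forall>c\<in>flag_cycles scale. frag_extend (frag_of \<circ> (\<lambda>_. ?e)) (the_elem (\<Psi> c)) = c"
        unfolding Z \<Psi>_def the_elem_eq frag_extend_compose using frag_extend_const by (auto simp: o_def)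
      show "\<forall>C\<in>carrier (steinberg scale). \<Psi> (frag_extend (frag_of \<circ> (\<lambda>_. ?e)) (the_elem C)) = C"
        unfolding carr \<Psi>_def frag_extend_compose using frag_extend_const by (auto simp: o_def)
      show "\<Psi> ` flag_cycles scale \<subseteq> carrier (steinberg scale)"
        unfolding carr \<Psi>_def by (intro image_subsetI imageI CollectI keys_frag_extend_const)
      show "(\<lambda>C. frag_extend (frag_of \<circ> (\<lambda>_. ?e)) (the_elem C)) ` carrier (steinberg scale) \<subseteq> flag_cycles scale"
        unfolding Z by (intro image_subsetI CollectI keys_frag_extend_const)
    qed
    moreover have "\<Psi> (a + b) = \<Psi> a \<otimes>\<^bsub>steinberg scale\<^esub> \<Psi> b" for a b
      unfolding St \<Psi>_def by (simp add: set_mult_def frag_extend_add)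
    moreover have "move_flags (?d - 1) g c = c" if "c \<in> flag_cycles scale" for g c
      using that unfolding Z True move_flags_def mem_Collect_eq
      by (induction c rule: frag_induction) (auto simp: frag_extend_diff restrict_def)
    moreover have "comm_group (steinberg scale)"
      unfolding St using G.abelian_FactGroup[OF triv] .
    ultimately show ?thesis
      unfolding act by (auto simp: hom_def)
  qed
qed

end


section \<open>Extension of scalars and indecomposability\<close>

locale scalar_extension = R: cring R + A: comm_group A
  for R :: "('k, 'm) ring_scheme" and A :: "('a, 'n) monoid_scheme"
begin

abbreviation F where "F \<equiv> free_Abelian_group (carrier R \<times> carrier A)"
abbreviation K where "K \<equiv> tensor_relations R A"
abbreviation T where "T \<equiv> tensor_module R A"

definition cls :: "('k \<times> 'a \<Rightarrow>\<^sub>0 int) \<Rightarrow> ('k \<times> 'a \<Rightarrow>\<^sub>0 int) set" where "cls c = K #>\<^bsub>F\<^esub> c"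

definition tens :: "'k \<Rightarrow> 'a \<Rightarrow> ('k \<times> 'a \<Rightarrow>\<^sub>0 int) set" where "tens r x = cls (frag_of (r, x))"

definition relators :: "('k \<times> 'a \<Rightarrow>\<^sub>0 int) set" where
  "relators = {frag_of (r \<oplus>\<^bsub>R\<^esub> s, x) - frag_of (r, x) - frag_of (s, x) | r s x.
           r \<in> carrier R \<and> s \<in> carrier R \<and> x \<in> carrier A} \<union>
        {frag_of (r, x \<otimes>\<^bsub>A\<^esub> y) - frag_of (r, x) - frag_of (r, y) | r x y.
           r \<in> carrier R \<and> x \<in> carrier A \<and> y \<in> carrier A}"

lemma relations_eq: "K = generate F relators"
  unfolding tensor_relations_def relators_def ..

sublocale F: comm_group F
  by (rule abelian_free_Abelian_group)

lemma relators_in_carrier: "relators \<subseteq> carrier F"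
  unfolding relators_def
  by (auto simp del: carrier_free_Abelian_group_iff simp: free_Abelian_group_def dest!: subsetD[OF keys_diff])

lemma subgroup_relations: "subgroup K F"
  unfolding relations_eq by (rule F.generate_is_subgroup[OF relators_in_carrier])

sublocale K: normal K F
  using F.subgroup_imp_normal[OF subgroup_relations] .

lemma relators_subset: "relators \<subseteq> K"
  unfolding relations_eq by (auto intro: generate.incl)

lemma relators_left:
  assumes "r \<in> carrier R" "s \<in> carrier R" "x \<in> carrier A"
  shows "frag_of (r \<oplus>\<^bsub>R\<^esub> s, x) - frag_of (r, x) - frag_of (s, x) \<in> K"
  by (rule subsetD[OF relators_subset], unfold relators_def, rule UnI1, rule CollectI)
     (intro exI, rule conjI, rule refl, intro conjI assms)

lemma relators_right:
  assumes "r \<in> carrier R" "x \<in> carrier A" "y \<in> carrier A"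
  shows "frag_of (r, x \<otimes>\<^bsub>A\<^esub> y) - frag_of (r, x) - frag_of (r, y) \<in> K"
  by (rule subsetD[OF relators_subset], unfold relators_def, rule UnI2, rule CollectI)
     (intro exI, rule conjI, rule refl, intro conjI assms)

lemma carrier_T: "carrier T = cls ` carrier F"
  unfolding tensor_module_def Let_def cls_def by (simp add: carrier_FactGroup)

lemma cls_add: "\<lbrakk>c \<in> carrier F; d \<in> carrier F\<rbrakk> \<Longrightarrow> cls c \<oplus>\<^bsub>T\<^esub> cls d = cls (c + d)"
  using K.rcos_sum[of c d] unfolding tensor_module_def Let_def cls_def by simp

lemma zero_T: "\<zero>\<^bsub>T\<^esub> = cls 0"
  using F.coset_mult_one[of K] subgroup.subset[OF subgroup_relations]
  unfolding tensor_module_def Let_def cls_def by simp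

lemma cls_eq_zero: "c \<in> K \<Longrightarrow> cls c = \<zero>\<^bsub>T\<^esub>"
  using F.coset_join2[OF _ subgroup_relations] subgroup.subset[OF subgroup_relations]
  unfolding tensor_module_def Let_def cls_def by auto

sublocale T: abelian_group T
proof -
  interpret Q: comm_group "F Mod K" by (rule F.abelian_FactGroup[OF subgroup_relations])
  have [simp]: "carrier T = carrier (F Mod K)" "add T = monoid.mult (F Mod K)" "zero T = one (F Mod K)"
    unfolding tensor_module_def Let_def by simp_all
  show "abelian_group T"
  proof (rule abelian_groupI, unfold \<open>carrier T = _\<close> \<open>add T = _\<close> \<open>zero T = _\<close>)
    show "\<exists>y \<in> carrier (F Mod K). y \<otimes>\<^bsub>F Mod K\<^esub> x = \<one>\<^bsub>F Mod K\<^esub>" if "x \<in> carrier (F Mod K)" for x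
      using that Q.l_inv_ex[of x] by blast
  qed (rule Q.m_closed Q.one_closed Q.m_assoc Q.m_comm Q.l_one; assumption)+
qed

lemma frag_in_F [simp]: "\<lbrakk>r \<in> carrier R; x \<in> carrier A\<rbrakk> \<Longrightarrow> frag_of (r, x) \<in> carrier F"
  by simp

lemma frag_diff_closed: "\<lbrakk>c \<in> carrier F; d \<in> carrier F\<rbrakk> \<Longrightarrow> c - d \<in> carrier F"
  using keys_diff[of c d] by auto

lemma tens_closed [simp]: "\<lbrakk>r \<in> carrier R; x \<in> carrier A\<rbrakk> \<Longrightarrow> tens r x \<in> carrier T"
  unfolding carrier_T tens_def by simp

lemma cls_eqI:
  assumes "c \<in> carrier F" "d \<in> carrier F" "c - d \<in> K" shows "cls c = cls d"
proof -
  have "cls (c - d) \<oplus>\<^bsub>T\<^esub> cls d = cls c"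
    using cls_add[of "c - d" d] assms subgroup.subset[OF subgroup_relations] by auto
  moreover have "cls d \<in> carrier T" using assms carrier_T by blast
  ultimately show ?thesis using cls_eq_zero[OF assms(3)] by simp
qed

lemma tens_add_left:
  assumes "r \<in> carrier R" "s \<in> carrier R" "x \<in> carrier A"
  shows "tens (r \<oplus>\<^bsub>R\<^esub> s) x = tens r x \<oplus>\<^bsub>T\<^esub> tens s x"
proof -
  have "frag_of (r \<oplus>\<^bsub>R\<^esub> s, x) - frag_of (r, x) - frag_of (s, x) \<in> K"
    using relators_left[OF assms] .
  then have "cls (frag_of (r \<oplus>\<^bsub>R\<^esub> s, x)) = cls (frag_of (r, x) + frag_of (s, x))"
    using assms F.m_closed[of "frag_of (r, x)" "frag_of (s, x)"]
    by (intro cls_eqI) (auto simp: diff_diff_eq simp del: carrier_free_Abelian_group_iff)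
  then show ?thesis using assms cls_add by (simp add: tens_def)
qed

lemma tens_add_right:
  assumes "r \<in> carrier R" "x \<in> carrier A" "y \<in> carrier A"
  shows "tens r (x \<otimes>\<^bsub>A\<^esub> y) = tens r x \<oplus>\<^bsub>T\<^esub> tens r y"
proof -
  have "frag_of (r, x \<otimes>\<^bsub>A\<^esub> y) - frag_of (r, x) - frag_of (r, y) \<in> K"
    using relators_right[OF assms] .
  then have "cls (frag_of (r, x \<otimes>\<^bsub>A\<^esub> y)) = cls (frag_of (r, x) + frag_of (r, y))"
    using assms F.m_closed[of "frag_of (r, x)" "frag_of (r, y)"]
    by (intro cls_eqI) (auto simp: diff_diff_eq simp del: carrier_free_Abelian_group_iff)
  then show ?thesis using assms cls_add by (simp add: tens_def)
qed

lemma tens_zero_left [simp]: "x \<in> carrier A \<Longrightarrow> tens \<zero>\<^bsub>R\<^esub> x = \<zero>\<^bsub>T\<^esub>"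
  using tens_add_left[of "\<zero>\<^bsub>R\<^esub>" "\<zero>\<^bsub>R\<^esub>" x] T.add.l_cancel_one[of "tens \<zero>\<^bsub>R\<^esub> x" "tens \<zero>\<^bsub>R\<^esub> x"] by simp

lemma tens_one_right [simp]: "r \<in> carrier R \<Longrightarrow> tens r \<one>\<^bsub>A\<^esub> = \<zero>\<^bsub>T\<^esub>"
  using tens_add_right[of r "\<one>\<^bsub>A\<^esub>" "\<one>\<^bsub>A\<^esub>"] T.add.l_cancel_one[of "tens r \<one>\<^bsub>A\<^esub>" "tens r \<one>\<^bsub>A\<^esub>"] by simp

lemma tens_minus_left: "\<lbrakk>r \<in> carrier R; x \<in> carrier A\<rbrakk> \<Longrightarrow> tens (\<ominus>\<^bsub>R\<^esub> r) x = \<ominus>\<^bsub>T\<^esub> tens r x"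
  using tens_add_left[of "\<ominus>\<^bsub>R\<^esub> r" r x] by (intro T.minus_equality[symmetric]) (auto simp: R.l_neg)

lemma tens_inv_right: "\<lbrakk>r \<in> carrier R; x \<in> carrier A\<rbrakk> \<Longrightarrow> tens r (inv\<^bsub>A\<^esub> x) = \<ominus>\<^bsub>T\<^esub> tens r x"
  using tens_add_right[of r "inv\<^bsub>A\<^esub> x" x] by (intro T.minus_equality[symmetric]) auto

lemma cls_minus: "c \<in> carrier F \<Longrightarrow> cls (- c) = \<ominus>\<^bsub>T\<^esub> cls c"
  using cls_add[of "- c" c] zero_T carrier_T
  by (intro T.minus_equality[symmetric]) auto

text \<open>
  Sums of pure tensors suffice, without negatives, since a sign can be moved into the scalar.
\<close>

lemma tensor_induct [consumes 1, case_names tens add]: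
  assumes y: "y \<in> carrier T"
    and tens: "\<And>r x. \<lbrakk>r \<in> carrier R; x \<in> carrier A\<rbrakk> \<Longrightarrow> P (tens r x)"
    and add: "\<And>a b. \<lbrakk>a \<in> carrier T; b \<in> carrier T; P a; P b\<rbrakk> \<Longrightarrow> P (a \<oplus>\<^bsub>T\<^esub> b)"
  shows "P y"
proof -
  obtain c where c: "Poly_Mapping.keys c \<subseteq> carrier R \<times> carrier A" and y: "y = cls c"
    using y unfolding carrier_T by auto
  have zero: "P \<zero>\<^bsub>T\<^esub>" using tens[of "\<zero>\<^bsub>R\<^esub>" "\<one>\<^bsub>A\<^esub>"] by simp
  have "P (cls c) \<and> P (\<ominus>\<^bsub>T\<^esub> cls c)"
    using c
  proof (induction c rule: free_Abelian_group_induct[consumes 1, case_names zero diff of])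
    case zero
    have "\<ominus>\<^bsub>T\<^esub> \<zero>\<^bsub>T\<^esub> = \<zero>\<^bsub>T\<^esub>" by (rule T.minus_equality) simp_all
    then show ?case using \<open>P \<zero>\<^bsub>T\<^esub>\<close> unfolding zero_T[symmetric] by (simp only: simp_thms)
  next
    case (diff a b)
    have ab: "cls a \<in> carrier T" "cls b \<in> carrier T" using diff carrier_T by auto
    have "cls (a - b) = cls a \<oplus>\<^bsub>T\<^esub> \<ominus>\<^bsub>T\<^esub> cls b"
      using cls_add[of a "- b"] cls_minus[of b] diff by simp
    moreover from this have "\<ominus>\<^bsub>T\<^esub> cls (a - b) = \<ominus>\<^bsub>T\<^esub> cls a \<oplus>\<^bsub>T\<^esub> cls b"
      using ab by (simp add: T.minus_add)
    ultimately show ?case using diff ab add by simp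
  next
    case (of z)
    then obtain r x where z: "z = (r, x)" "r \<in> carrier R" "x \<in> carrier A" by auto
    then show ?case
      using tens[of r x] tens[of "\<ominus>\<^bsub>R\<^esub> r" x] by (simp add: tens_minus_left) (simp add: tens_def)
  qed
  then show ?thesis using y by simp
qed

lemma tensor_generator_induct [consumes 3, case_names tens zero add]:
  assumes gen: "generate A E = carrier A" and y: "y \<in> carrier T" and E: "E \<subseteq> carrier A"
    and tens: "\<And>r x. \<lbrakk>r \<in> carrier R; x \<in> E\<rbrakk> \<Longrightarrow> P (tens r x)"
    and zero: "P \<zero>\<^bsub>T\<^esub>"
    and add: "\<And>a b. \<lbrakk>a \<in> carrier T; b \<in> carrier T; P a; P b\<rbrakk> \<Longrightarrow> P (a \<oplus>\<^bsub>T\<^esub> b)"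
  shows "P y"
  using y
proof (induction y rule: tensor_induct)
  case (tens r x)
  then have "x \<in> generate A E" by (simp add: gen)
  then have "x \<in> carrier A \<and> (\<forall>r \<in> carrier R. P (tens r x))"
  proof induction
    case (inv h)
    then have "P (tens (\<ominus>\<^bsub>R\<^esub> r) h)" if "r \<in> carrier R" for r using that assms(4) by simp
    then show ?case using inv E by (auto simp: tens_minus_left tens_inv_right subset_iff)
  qed (use assms(4) zero add E in \<open>auto simp: tens_add_right subset_iff\<close>)
  then show ?case using tens by blast
qed (rule add)

subsection \<open>Induced maps\<close>

lemma frag_map_closed:
  assumes u: "\<And>z. z \<in> carrier R \<times> carrier A \<Longrightarrow> u z \<in> carrier R \<times> carrier A" and c: "c \<in> carrier F"
  shows "frag_extend (\<lambda>z. frag_of (u z)) c \<in> carrier F"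
proof -
  have "Poly_Mapping.keys (frag_extend (\<lambda>z. frag_of (u z)) c) \<subseteq> u ` Poly_Mapping.keys c"
    using keys_frag_extend[of "\<lambda>z. frag_of (u z)" c] by auto
  also have "\<dots> \<subseteq> carrier R \<times> carrier A"
    using u c by (intro image_subsetI) (blast dest: subsetD[OF carrier_free_Abelian_group_iff[THEN iffD1]])
  finally show ?thesis by simp
qed

text \<open>
  Relations are generated by relators, so that a map that respects relators respects cosets.
\<close>

lemma tensor_induced_cls:
  assumes u: "\<And>z. z \<in> carrier R \<times> carrier A \<Longrightarrow> u z \<in> carrier R \<times> carrier A"
    and rel: "\<And>k. k \<in> relators \<Longrightarrow> frag_extend (\<lambda>z. frag_of (u z)) k \<in> K"
    and c: "c \<in> carrier F"
  shows "tensor_induced R A u (cls c) = cls (frag_extend (\<lambda>z. frag_of (u z)) c)"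
proof -
  let ?u = "frag_extend (\<lambda>z. frag_of (u z))"
  have inv: "- k \<in> K" if "k \<in> K" for k
    using subgroup.m_inv_closed[OF subgroup_relations that]
      subsetD[OF subgroup.subset[OF subgroup_relations] that] by simp
  have uK: "?u k \<in> K" if "k \<in> K" for k
    using that unfolding relations_eq
  proof induction
    case one
    then show ?case using generate.one[of F relators] by simp
  next
    case (incl h)
    then show ?case using rel by (simp add: relations_eq)
  next
    case (inv h)
    then have "h \<in> carrier F" using relators_in_carrier by blast
    then show ?case using \<open>\<And>k. k \<in> K \<Longrightarrow> - k \<in> K\<close>[OF rel[OF inv]] by (simp add: frag_extend_minus relations_eq)
  next
    case (eng h1 h2)
    then show ?case using generate.eng[of "?u h1" F relators "?u h2"] by (simp add: frag_extend_add)
  qed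
  have "tensor_induced R A u (cls c) = {k + (?u k' + ?u c) | k k'. k \<in> K \<and> k' \<in> K}"
    unfolding tensor_induced_def cls_def set_mult_def r_coset_def
    by (auto simp: frag_extend_add image_iff)
  also have "\<dots> = {k + ?u c | k. k \<in> K}"
  proof (intro equalityI subsetI)
    fix y assume "y \<in> {k + (?u k' + ?u c) | k k'. k \<in> K \<and> k' \<in> K}"
    then obtain k k' where k: "y = k + (?u k' + ?u c)" "k \<in> K" "k' \<in> K" by blast
    have "k + ?u k' \<in> K"
      using subgroup.m_closed[OF subgroup_relations k(2) uK[OF k(3)]] by simp
    moreover have "y = (k + ?u k') + ?u c" using k by (simp add: add.assoc)
    ultimately show "y \<in> {k + ?u c | k. k \<in> K}" by blast
  next
    fix y assume "y \<in> {k + ?u c | k. k \<in> K}"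
    then obtain k where k: "y = k + ?u c" "k \<in> K" by blast
    have "y = k + (?u 0 + ?u c)" "0 \<in> K"
      using k subgroup.one_closed[OF subgroup_relations] by simp_all
    then show "y \<in> {k + (?u k' + ?u c) | k k'. k \<in> K \<and> k' \<in> K}" using k by blast
  qed
  also have "\<dots> = cls (?u c)" unfolding cls_def r_coset_def by auto
  finally show ?thesis .
qed

lemma tensor_induced_properties:
  assumes u: "\<And>z. z \<in> carrier R \<times> carrier A \<Longrightarrow> u z \<in> carrier R \<times> carrier A"
    and rel: "\<And>k. k \<in> relators \<Longrightarrow> frag_extend (\<lambda>z. frag_of (u z)) k \<in> K"
  shows "y \<in> carrier T \<Longrightarrow> tensor_induced R A u y \<in> carrier T"
    and "\<lbrakk>y \<in> carrier T; z \<in> carrier T\<rbrakk> \<Longrightarrow>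
      tensor_induced R A u (y \<oplus>\<^bsub>T\<^esub> z) = tensor_induced R A u y \<oplus>\<^bsub>T\<^esub> tensor_induced R A u z"
    and "\<lbrakk>r \<in> carrier R; x \<in> carrier A\<rbrakk> \<Longrightarrow> tensor_induced R A u (tens r x) = tens (fst (u (r, x))) (snd (u (r, x)))"
proof -
  let ?u = "frag_extend (\<lambda>z. frag_of (u z))"
  have uF: "?u c \<in> carrier F" if "c \<in> carrier F" for c
    by (rule frag_map_closed, erule u, rule that)
  have ind: "tensor_induced R A u (cls c) = cls (?u c)" if "c \<in> carrier F" for c
    by (rule tensor_induced_cls, erule u, erule rel, rule that)
  show "tensor_induced R A u y \<in> carrier T" if "y \<in> carrier T" for y
    using that uF unfolding carrier_T by (auto simp: ind simp del: carrier_free_Abelian_group_iff)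
  show "tensor_induced R A u (y \<oplus>\<^bsub>T\<^esub> z) = tensor_induced R A u y \<oplus>\<^bsub>T\<^esub> tensor_induced R A u z"
    if yz: "y \<in> carrier T" "z \<in> carrier T"
  proof -
    obtain c d where cd: "c \<in> carrier F" "d \<in> carrier F" "y = cls c" "z = cls d"
      using yz unfolding carrier_T by blast
    then have "c + d \<in> carrier F" using F.m_closed[of c d] by simp
    then show ?thesis
      using cd uF by (simp add: cls_add ind frag_extend_add del: carrier_free_Abelian_group_iff)
  qed
  show "tensor_induced R A u (tens r x) = tens (fst (u (r, x))) (snd (u (r, x)))"
    if "r \<in> carrier R" "x \<in> carrier A"
    using that ind[OF frag_in_F[OF that]] by (simp add: tens_def)
qed

lemma relators_cases:
  assumes "k \<in> relators"
    and "\<And>r s x. \<lbrakk>r \<in> carrier R; s \<in> carrier R; x \<in> carrier A;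
       k = frag_of (r \<oplus>\<^bsub>R\<^esub> s, x) - frag_of (r, x) - frag_of (s, x)\<rbrakk> \<Longrightarrow> Q"
    and "\<And>r x y. \<lbrakk>r \<in> carrier R; x \<in> carrier A; y \<in> carrier A;
       k = frag_of (r, x \<otimes>\<^bsub>A\<^esub> y) - frag_of (r, x) - frag_of (r, y)\<rbrakk> \<Longrightarrow> Q"
  shows Q
  using assms(1) unfolding relators_def
  by (elim UnE CollectE exE conjE) (use assms(2,3) in blast)+

lemma
  assumes "r \<in> carrier R"
  shows smult_closed: "y \<in> carrier T \<Longrightarrow> r \<odot>\<^bsub>T\<^esub> y \<in> carrier T"
    and smult_add: "\<lbrakk>y \<in> carrier T; z \<in> carrier T\<rbrakk> \<Longrightarrow> r \<odot>\<^bsub>T\<^esub> (y \<oplus>\<^bsub>T\<^esub> z) = r \<odot>\<^bsub>T\<^esub> y \<oplus>\<^bsub>T\<^esub> r \<odot>\<^bsub>T\<^esub> z"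
    and smult_tens: "\<lbrakk>s \<in> carrier R; x \<in> carrier A\<rbrakk> \<Longrightarrow> r \<odot>\<^bsub>T\<^esub> tens s x = tens (r \<otimes>\<^bsub>R\<^esub> s) x"
proof -
  let ?u = "\<lambda>(s, x). (r \<otimes>\<^bsub>R\<^esub> s, x)"
  have sm: "r \<odot>\<^bsub>T\<^esub> y = tensor_induced R A ?u y" for y
    unfolding tensor_module_def Let_def by simp
  have u: "?u z \<in> carrier R \<times> carrier A" if "z \<in> carrier R \<times> carrier A" for z
    using that assms by auto
  have rel: "frag_extend (\<lambda>z. frag_of (?u z)) k \<in> K" if "k \<in> relators" for k
    using that
    by (rule relators_cases)
       (use assms relators_left relators_right in \<open>auto simp: frag_extend_diff R.r_distr\<close>)
  note props = tensor_induced_properties[of ?u]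
  show "y \<in> carrier T \<Longrightarrow> r \<odot>\<^bsub>T\<^esub> y \<in> carrier T"
    "\<lbrakk>y \<in> carrier T; z \<in> carrier T\<rbrakk> \<Longrightarrow> r \<odot>\<^bsub>T\<^esub> (y \<oplus>\<^bsub>T\<^esub> z) = r \<odot>\<^bsub>T\<^esub> y \<oplus>\<^bsub>T\<^esub> r \<odot>\<^bsub>T\<^esub> z"
    "\<lbrakk>s \<in> carrier R; x \<in> carrier A\<rbrakk> \<Longrightarrow> r \<odot>\<^bsub>T\<^esub> tens s x = tens (r \<otimes>\<^bsub>R\<^esub> s) x"
    unfolding sm using props u rel by simp_all
qed

lemma
  assumes f: "f \<in> hom A A"
  shows tensor_map_closed: "y \<in> carrier T \<Longrightarrow> tensor_map R A f y \<in> carrier T"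
    and tensor_map_add: "\<lbrakk>y \<in> carrier T; z \<in> carrier T\<rbrakk> \<Longrightarrow>
       tensor_map R A f (y \<oplus>\<^bsub>T\<^esub> z) = tensor_map R A f y \<oplus>\<^bsub>T\<^esub> tensor_map R A f z"
    and tensor_map_tens: "\<lbrakk>s \<in> carrier R; x \<in> carrier A\<rbrakk> \<Longrightarrow> tensor_map R A f (tens s x) = tens s (f x)"
proof -
  let ?u = "\<lambda>(s, x). (s, f x)"
  have fA: "\<And>x. x \<in> carrier A \<Longrightarrow> f x \<in> carrier A" and fm: "\<And>x y. \<lbrakk>x \<in> carrier A; y \<in> carrier A\<rbrakk> \<Longrightarrow> f (x \<otimes>\<^bsub>A\<^esub> y) = f x \<otimes>\<^bsub>A\<^esub> f y"
    using f by (auto simp: hom_def)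
  have u: "?u z \<in> carrier R \<times> carrier A" if "z \<in> carrier R \<times> carrier A" for z
    using that fA by auto
  have rel: "frag_extend (\<lambda>z. frag_of (?u z)) k \<in> K" if "k \<in> relators" for k
    using that
    by (rule relators_cases)
       (use fA fm relators_left relators_right in \<open>auto simp: frag_extend_diff\<close>)
  note props = tensor_induced_properties[of ?u]
  show "y \<in> carrier T \<Longrightarrow> tensor_map R A f y \<in> carrier T"
    "\<lbrakk>y \<in> carrier T; z \<in> carrier T\<rbrakk> \<Longrightarrow>
       tensor_map R A f (y \<oplus>\<^bsub>T\<^esub> z) = tensor_map R A f y \<oplus>\<^bsub>T\<^esub> tensor_map R A f z"
    "\<lbrakk>s \<in> carrier R; x \<in> carrier A\<rbrakk> \<Longrightarrow> tensor_map R A f (tens s x) = tens s (f x)"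
    unfolding tensor_map_def using props u rel by simp_all
qed

text \<open>
  The function \<open>(r, x) \<mapsto> \<phi>(x) r\<close> is biadditive, hence kills the relators and factors through the tensor
  product.
\<close>

lemma extend_functional:
  assumes \<phi>: "\<And>x y. \<lbrakk>x \<in> carrier A; y \<in> carrier A\<rbrakk> \<Longrightarrow> \<phi> (x \<otimes>\<^bsub>A\<^esub> y) = \<phi> x + (\<phi> y :: int)"
  obtains \<Phi> where "\<And>y. y \<in> carrier T \<Longrightarrow> \<Phi> y \<in> carrier R"
    "\<And>y z. \<lbrakk>y \<in> carrier T; z \<in> carrier T\<rbrakk> \<Longrightarrow> \<Phi> (y \<oplus>\<^bsub>T\<^esub> z) = \<Phi> y \<oplus>\<^bsub>R\<^esub> \<Phi> z"
    "\<And>r x. \<lbrakk>r \<in> carrier R; x \<in> carrier A\<rbrakk> \<Longrightarrow> \<Phi> (tens r x) = [\<phi> x] \<cdot>\<^bsub>R\<^esub> r"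
proof -
  let ?R = "add_monoid R"
  obtain h where h: "h \<in> hom F ?R"
    and h_of: "\<And>z. z \<in> carrier R \<times> carrier A \<Longrightarrow> h (frag_of z) = (\<lambda>(r, x). [\<phi> x] \<cdot>\<^bsub>R\<^esub> r) z"
    by (rule comm_group.free_Abelian_group_universal[OF R.a_comm_group, of "\<lambda>(r, x). [\<phi> x] \<cdot>\<^bsub>R\<^esub> r" "carrier R \<times> carrier A"]) auto
  interpret h: group_hom F ?R h
    by (simp add: group_hom_def group_hom_axioms_def h F.group_axioms R.a_group)
  have h_diff: "h (c - d) = h c \<ominus>\<^bsub>R\<^esub> h d" if "c \<in> carrier F" "d \<in> carrier F" for c d
  proof -
    have "h (c \<otimes>\<^bsub>F\<^esub> inv\<^bsub>F\<^esub> d) = h c \<oplus>\<^bsub>R\<^esub> h (inv\<^bsub>F\<^esub> d)"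
      using h.hom_mult[of c "inv\<^bsub>F\<^esub> d"] that F.inv_closed by (simp del: carrier_free_Abelian_group_iff)
    moreover have "h (inv\<^bsub>F\<^esub> d) = \<ominus>\<^bsub>R\<^esub> h d" using h.hom_inv[OF that(2)] by (simp add: a_inv_def)
    moreover have "c \<otimes>\<^bsub>F\<^esub> inv\<^bsub>F\<^esub> d = c - d" using that by simp
    ultimately show ?thesis by (simp add: a_minus_def)
  qed
  have kill: "h k = \<zero>\<^bsub>R\<^esub>" if "k \<in> K" for k
    using that unfolding relations_eq
  proof induction
    case one
    then show ?case using h.hom_one by simp
  next
    have canc: "a \<oplus>\<^bsub>R\<^esub> b \<ominus>\<^bsub>R\<^esub> a \<ominus>\<^bsub>R\<^esub> b = \<zero>\<^bsub>R\<^esub>" if "a \<in> carrier R" "b \<in> carrier R" for a b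
    proof -
      have "a \<oplus>\<^bsub>R\<^esub> b \<ominus>\<^bsub>R\<^esub> a = b"
        using that R.a_comm[of "a \<oplus>\<^bsub>R\<^esub> b" "\<ominus>\<^bsub>R\<^esub> a"] by (simp add: a_minus_def R.r_neg1)
      then show ?thesis using that by (simp add: R.r_neg a_minus_def)
    qed
    have rel: "h k = \<zero>\<^bsub>R\<^esub>" if "k \<in> relators" for k
      using that
    proof (rule relators_cases)
      fix r s x
      assume "r \<in> carrier R" "s \<in> carrier R" "x \<in> carrier A"
        "k = frag_of (r \<oplus>\<^bsub>R\<^esub> s, x) - frag_of (r, x) - frag_of (s, x)"
      then show ?thesis
        using h_diff[of "frag_of (r \<oplus>\<^bsub>R\<^esub> s, x) - frag_of (r, x)" "frag_of (s, x)"]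
          h_diff[of "frag_of (r \<oplus>\<^bsub>R\<^esub> s, x)" "frag_of (r, x)"]
          frag_diff_closed[of "frag_of (r \<oplus>\<^bsub>R\<^esub> s, x)" "frag_of (r, x)"]
        by (simp add: h_of R.add.int_pow_distrib canc del: carrier_free_Abelian_group_iff)
    next
      fix r x y
      assume "r \<in> carrier R" "x \<in> carrier A" "y \<in> carrier A"
        "k = frag_of (r, x \<otimes>\<^bsub>A\<^esub> y) - frag_of (r, x) - frag_of (r, y)"
      then show ?thesis
        using h_diff[of "frag_of (r, x \<otimes>\<^bsub>A\<^esub> y) - frag_of (r, x)" "frag_of (r, y)"]
          h_diff[of "frag_of (r, x \<otimes>\<^bsub>A\<^esub> y)" "frag_of (r, x)"]
          frag_diff_closed[of "frag_of (r, x \<otimes>\<^bsub>A\<^esub> y)" "frag_of (r, x)"]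
        by (simp add: h_of \<phi> R.add.int_pow_mult canc del: carrier_free_Abelian_group_iff)
    qed
    { case (incl k) then show ?case by (rule rel) }
    { case (inv k)
      then have "k \<in> carrier F" using relators_in_carrier by blast
      then show ?case using h.hom_inv[of k] rel[OF inv] R.minus_zero by (simp add: a_inv_def del: carrier_free_Abelian_group_iff) }
  next
    case (eng a b)
    then have "a \<in> carrier F" "b \<in> carrier F"
      using subgroup.subset[OF subgroup_relations] unfolding relations_eq by blast+
    then show ?case using h.hom_mult[of a b] eng by simp
  qed
  have eq: "h c = h d" if "c \<in> carrier F" "d \<in> carrier F" "K #>\<^bsub>F\<^esub> c = K #>\<^bsub>F\<^esub> d" for c d
  proof -
    have "c \<in> K #>\<^bsub>F\<^esub> d" using F.rcos_self[OF that(1) subgroup_relations] that(3) by simp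
    then obtain k where k: "k \<in> K" "c = k + d" by (auto simp: r_coset_def)
    moreover have "k \<in> carrier F" using k subgroup.subset[OF subgroup_relations] by blast
    ultimately show ?thesis using h.hom_mult[of k d] that kill h.hom_closed[OF that(2)] by simp
  qed
  obtain \<Phi> where \<Phi>: "\<Phi> \<in> hom (F Mod K) ?R" "\<And>c. c \<in> carrier F \<Longrightarrow> \<Phi> (K #>\<^bsub>F\<^esub> c) = h c"
    using FactGroup_universal[OF h K.normal_axioms eq] by blast
  have TQ: "carrier T = carrier (F Mod K)" "add T = monoid.mult (F Mod K)"
    unfolding tensor_module_def Let_def by simp_all
  show thesis
  proof
    show "\<Phi> y \<in> carrier R" if "y \<in> carrier T" for y
      using hom_in_carrier[OF \<Phi>(1)] that TQ by simp
    show "\<Phi> (y \<oplus>\<^bsub>T\<^esub> z) = \<Phi> y \<oplus>\<^bsub>R\<^esub> \<Phi> z" if "y \<in> carrier T" "z \<in> carrier T" for y z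
      using hom_mult[OF \<Phi>(1), of y z] that TQ by simp
    show "\<Phi> (tens r x) = [\<phi> x] \<cdot>\<^bsub>R\<^esub> r" if "r \<in> carrier R" "x \<in> carrier A" for r x
      using \<Phi>(2)[OF frag_in_F[OF that]] h_of[of "(r, x)"] that by (simp add: tens_def cls_def)
  qed
qed


subsection \<open>Indecomposability\<close>

text \<open>
  The elements \<open>e i\<close> form a basis of \<open>A\<close> that is dual, up to the sign \<open>\<epsilon>\<close>, to translates of one functional
  \<open>\<phi>\<close>, and they are obtained from \<open>e0\<close> by elements of \<open>G\<close> under which \<open>\<phi>\<close> is invariant. Let \<open>\<Phi>\<close> be the linear
  extension of \<open>\<phi>\<close> and \<open>\<pi>\<close> the projection to a direct summand. On the multiples of \<open>e i\<close>, which generate,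
  the invariance of \<open>\<Phi>\<close> under \<open>\<beta> i\<close> gives \<open>\<Phi> \<circ> \<pi> = c \<Phi>\<close> with \<open>c = \<Phi>(\<pi>(e0))\<close>. The translates of \<open>\<Phi>\<close> separate
  the elements of the tensor product, so that \<open>\<pi>\<close> is multiplication by \<open>c\<close>. Then \<open>c\<close> is idempotent,
  and \<open>\<pi>\<close> is 0 or 1.
\<close>

lemma indecomposable_criterion:
  fixes J :: "'o set" and \<rho> :: "'g \<Rightarrow> 'a \<Rightarrow> 'a" and \<phi> :: "'a \<Rightarrow> int"
  assumes conn: "connected_ring R"
    and \<rho>: "\<And>g. g \<in> G \<Longrightarrow> \<rho> g \<in> hom A A"
    and \<phi>: "\<And>x y. \<lbrakk>x \<in> carrier A; y \<in> carrier A\<rbrakk> \<Longrightarrow> \<phi> (x \<otimes>\<^bsub>A\<^esub> y) = \<phi> x + \<phi> y"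
    and e0: "e0 \<in> carrier A" "\<phi> e0 = 1"
    and e: "\<And>i. i \<in> J \<Longrightarrow> e i \<in> carrier A" and gen: "generate A (e ` J) = carrier A"
    and \<beta>: "\<And>i. i \<in> J \<Longrightarrow> \<beta> i \<in> G \<and> \<rho> (\<beta> i) e0 = e i"
      "\<And>i x. \<lbrakk>i \<in> J; x \<in> carrier A\<rbrakk> \<Longrightarrow> \<phi> (\<rho> (\<beta> i) x) = \<phi> x"
    and \<eta>: "\<And>i. i \<in> J \<Longrightarrow> \<eta> i \<in> G" and \<epsilon>: "\<epsilon> * \<epsilon> = 1"
    and dual: "\<And>i j. \<lbrakk>i \<in> J; j \<in> J\<rbrakk> \<Longrightarrow> \<phi> (\<rho> (\<eta> i) (e j)) = (if i = j then \<epsilon> else 0)"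
  shows "group_ring_indecomposable G R T (\<lambda>g. tensor_map R A (\<rho> g))"
proof -
  define \<tau> where "\<tau> g = tensor_map R A (\<rho> g)" for g
  obtain \<Phi> where \<Phi>: "\<And>y. y \<in> carrier T \<Longrightarrow> \<Phi> y \<in> carrier R"
    and \<Phi>_add: "\<And>y z. \<lbrakk>y \<in> carrier T; z \<in> carrier T\<rbrakk> \<Longrightarrow> \<Phi> (y \<oplus>\<^bsub>T\<^esub> z) = \<Phi> y \<oplus>\<^bsub>R\<^esub> \<Phi> z"
    and \<Phi>_tens: "\<And>r x. \<lbrakk>r \<in> carrier R; x \<in> carrier A\<rbrakk> \<Longrightarrow> \<Phi> (tens r x) = [\<phi> x] \<cdot>\<^bsub>R\<^esub> r"
    using extend_functional[of \<phi>, OF \<phi>] by blast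
  have \<tau>: "\<tau> g y \<in> carrier T" if "g \<in> G" "y \<in> carrier T" for g y
    unfolding \<tau>_def using tensor_map_closed[OF \<rho>] that by blast
  have \<tau>_add: "\<tau> g (y \<oplus>\<^bsub>T\<^esub> z) = \<tau> g y \<oplus>\<^bsub>T\<^esub> \<tau> g z" if "g \<in> G" "y \<in> carrier T" "z \<in> carrier T" for g y z
    unfolding \<tau>_def using tensor_map_add[OF \<rho>] that by blast
  have \<tau>_tens: "\<tau> g (tens s x) = tens s (\<rho> g x)" if "g \<in> G" "s \<in> carrier R" "x \<in> carrier A" for g s x
    unfolding \<tau>_def using tensor_map_tens[OF \<rho>] that by blast
  have \<rho>A: "\<rho> g x \<in> carrier A" if "g \<in> G" "x \<in> carrier A" for g x
    using \<rho> that by (auto simp: hom_def)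
  have eO: "e ` J \<subseteq> carrier A" using e by blast
  have \<tau>_zero: "\<tau> g \<zero>\<^bsub>T\<^esub> = \<zero>\<^bsub>T\<^esub>" if "g \<in> G" for g
    using \<tau>_tens[OF that, of "\<zero>\<^bsub>R\<^esub>" "\<one>\<^bsub>A\<^esub>"] \<rho>A[OF that] by simp
  have \<Phi>_zero: "\<Phi> \<zero>\<^bsub>T\<^esub> = \<zero>\<^bsub>R\<^esub>"
    using \<Phi>_tens[of "\<zero>\<^bsub>R\<^esub>" "\<one>\<^bsub>A\<^esub>"] by simp
  have smult_\<tau>: "r \<odot>\<^bsub>T\<^esub> \<tau> g y = \<tau> g (r \<odot>\<^bsub>T\<^esub> y)" if "r \<in> carrier R" "g \<in> G" "y \<in> carrier T" for r g y
    using that(3)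
    by (induction y rule: tensor_induct)
       (use that in \<open>auto simp: \<tau>_add \<tau>_tens smult_add smult_tens smult_closed \<rho>A \<tau>\<close>)
  have smult_one: "\<one>\<^bsub>R\<^esub> \<odot>\<^bsub>T\<^esub> y = y" if "y \<in> carrier T" for y
    using that by (induction y rule: tensor_induct) (auto simp: smult_tens smult_add)
  have smult_zero: "\<zero>\<^bsub>R\<^esub> \<odot>\<^bsub>T\<^esub> y = \<zero>\<^bsub>T\<^esub>" if "y \<in> carrier T" for y
    using that by (induction y rule: tensor_induct) (auto simp: smult_tens smult_add)
  have \<Phi>_smult: "\<Phi> (r \<odot>\<^bsub>T\<^esub> y) = r \<otimes>\<^bsub>R\<^esub> \<Phi> y" if "r \<in> carrier R" "y \<in> carrier T" for r y
    using that(2)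
    by (induction y rule: tensor_induct)
       (use that in \<open>auto simp: smult_tens smult_add smult_closed \<Phi>_add \<Phi>_tens \<Phi> R.r_distr R.add_pow_rdistr_int\<close>)
  have \<Phi>_\<beta>: "\<Phi> (\<tau> (\<beta> i) y) = \<Phi> y" if "i \<in> J" "y \<in> carrier T" for i y
    using that(2)
    by (induction y rule: tensor_induct)
       (use that \<beta> in \<open>auto simp: \<tau>_add \<tau>_tens \<Phi>_add \<Phi>_tens \<rho>A \<tau>\<close>)

  \<comment> \<open>the coordinates with respect to the basis; as \<open>\<epsilon> * \<epsilon> = 1\<close>, the sign is its own inverse\<close>
  define \<kappa> where "\<kappa> i y = [\<epsilon>] \<cdot>\<^bsub>R\<^esub> \<Phi> (\<tau> (\<eta> i) y)" for i y
  have \<kappa>R: "\<kappa> i y \<in> carrier R" if "i \<in> J" "y \<in> carrier T" for i y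
    unfolding \<kappa>_def using that \<eta> \<Phi> \<tau> by simp
  have \<kappa>_add: "\<kappa> i (y \<oplus>\<^bsub>T\<^esub> z) = \<kappa> i y \<oplus>\<^bsub>R\<^esub> \<kappa> i z" if "i \<in> J" "y \<in> carrier T" "z \<in> carrier T" for i y z
    unfolding \<kappa>_def using that \<eta> \<Phi> \<tau> by (simp add: \<tau>_add \<Phi>_add R.add.int_pow_distrib)
  have \<kappa>_e: "\<kappa> i (tens r (e j)) = (if i = j then r else \<zero>\<^bsub>R\<^esub>)" if "i \<in> J" "j \<in> J" "r \<in> carrier R" for i j r
    unfolding \<kappa>_def using that \<eta> e \<rho>A
    by (cases "i = j") (simp_all add: \<tau>_tens \<Phi>_tens dual R.add.int_pow_pow \<epsilon>, simp_all add: add_pow_def)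
  \<comment> \<open>larger index sets are admitted so that two elements can be compared over a common one\<close>
  have expand: "\<exists>S. finite S \<and> S \<subseteq> J \<and> (\<forall>S'. finite S' \<longrightarrow> S \<subseteq> S' \<longrightarrow> S' \<subseteq> J \<longrightarrow>
      finsum T (\<lambda>i. tens (\<kappa> i y) (e i)) S' = y)" if "y \<in> carrier T" for y
    using gen that eO
  proof (induction y rule: tensor_generator_induct)
    case (tens r x)
    then obtain j where j: "j \<in> J" "x = e j" by blast
    have "finsum T (\<lambda>i. tens (\<kappa> i (tens r x)) (e i)) S' = tens r x"
      if S': "finite S'" "{j} \<subseteq> S'" "S' \<subseteq> J" for S'
    proof -
      have "finsum T (\<lambda>i. tens (\<kappa> i (tens r x)) (e i)) S' =
          finsum T (\<lambda>i. if j = i then tens r (e i) else \<zero>\<^bsub>T\<^esub>) S'"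
        using S' j tens e by (intro T.finsum_cong') (auto simp: \<kappa>_e)
      also have "\<dots> = tens r (e j)"
        using S' j tens e by (intro T.add.finprod_singleton) auto
      finally show ?thesis using j by simp
    qed
    then show ?case using j by (intro exI[of _ "{j}"]) auto
  next
    case zero
    have "\<kappa> i \<zero>\<^bsub>T\<^esub> = \<zero>\<^bsub>R\<^esub>" if "i \<in> J" for i
      unfolding \<kappa>_def using that \<eta> by (simp add: \<tau>_zero \<Phi>_zero)
    then have "finsum T (\<lambda>i. tens (\<kappa> i \<zero>\<^bsub>T\<^esub>) (e i)) S' = \<zero>\<^bsub>T\<^esub>" if "S' \<subseteq> J" for S'
      using that e by (intro T.add.finprod_one_eqI) auto
    then show ?case by (intro exI[of _ "{}"]) auto
  next
    case (add a b)
    obtain S1 where S1: "finite S1" "S1 \<subseteq> J"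
        "\<forall>S'. finite S' \<longrightarrow> S1 \<subseteq> S' \<longrightarrow> S' \<subseteq> J \<longrightarrow>
           finsum T (\<lambda>i. tens (\<kappa> i a) (e i)) S' = a"
      using add(3) by (elim exE conjE)
    obtain S2 where S2: "finite S2" "S2 \<subseteq> J"
        "\<forall>S'. finite S' \<longrightarrow> S2 \<subseteq> S' \<longrightarrow> S' \<subseteq> J \<longrightarrow>
           finsum T (\<lambda>i. tens (\<kappa> i b) (e i)) S' = b"
      using add(4) by (elim exE conjE)
    note S1 = S1(1,2) S1(3)[rule_format] and S2 = S2(1,2) S2(3)[rule_format]
    have "finsum T (\<lambda>i. tens (\<kappa> i (a \<oplus>\<^bsub>T\<^esub> b)) (e i)) S' = a \<oplus>\<^bsub>T\<^esub> b"
      if S': "finite S'" "S1 \<union> S2 \<subseteq> S'" "S' \<subseteq> J" for S'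
    proof -
      have "finsum T (\<lambda>i. tens (\<kappa> i (a \<oplus>\<^bsub>T\<^esub> b)) (e i)) S' =
          finsum T (\<lambda>i. tens (\<kappa> i a) (e i) \<oplus>\<^bsub>T\<^esub> tens (\<kappa> i b) (e i)) S'"
      proof (rule T.finsum_cong'[OF refl])
        show "tens (\<kappa> i (a \<oplus>\<^bsub>T\<^esub> b)) (e i) = tens (\<kappa> i a) (e i) \<oplus>\<^bsub>T\<^esub> tens (\<kappa> i b) (e i)" if "i \<in> S'" for i
          using S' add e \<kappa>R that by (auto simp: \<kappa>_add tens_add_left subset_iff)
        show "(\<lambda>i. tens (\<kappa> i a) (e i) \<oplus>\<^bsub>T\<^esub> tens (\<kappa> i b) (e i)) \<in> S' \<rightarrow> carrier T"
          using S' add e \<kappa>R by (auto simp: subset_iff)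
      qed
      also have "\<dots> = finsum T (\<lambda>i. tens (\<kappa> i a) (e i)) S' \<oplus>\<^bsub>T\<^esub> finsum T (\<lambda>i. tens (\<kappa> i b) (e i)) S'"
        using S' add e \<kappa>R by (intro T.finsum_addf) (auto simp: subset_iff)
      finally show ?thesis using S1(3)[of S'] S2(3)[of S'] S' by simp
    qed
    then show ?case using S1 S2 by (intro exI[of _ "S1 \<union> S2"]) auto
  qed
  have separate: "y = z"
    if y: "y \<in> carrier T" and z: "z \<in> carrier T"
      and eq: "\<And>i. i \<in> J \<Longrightarrow> \<Phi> (\<tau> (\<eta> i) y) = \<Phi> (\<tau> (\<eta> i) z)" for y z
  proof -
    obtain S1 where S1: "finite S1" "S1 \<subseteq> J"
        "\<forall>S'. finite S' \<longrightarrow> S1 \<subseteq> S' \<longrightarrow> S' \<subseteq> J \<longrightarrow>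
           finsum T (\<lambda>i. tens (\<kappa> i y) (e i)) S' = y"
      using expand[OF y] by (elim exE conjE)
    obtain S2 where S2: "finite S2" "S2 \<subseteq> J"
        "\<forall>S'. finite S' \<longrightarrow> S2 \<subseteq> S' \<longrightarrow> S' \<subseteq> J \<longrightarrow>
           finsum T (\<lambda>i. tens (\<kappa> i z) (e i)) S' = z"
      using expand[OF z] by (elim exE conjE)
    note S1 = S1(1,2) S1(3)[rule_format] and S2 = S2(1,2) S2(3)[rule_format]
    have "finsum T (\<lambda>i. tens (\<kappa> i y) (e i)) (S1 \<union> S2) = finsum T (\<lambda>i. tens (\<kappa> i z) (e i)) (S1 \<union> S2)"
      using S1 S2 e \<kappa>R z by (intro T.finsum_cong') (auto simp: \<kappa>_def eq subset_iff)
    then show ?thesis using S1 S2 by simp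
  qed

  show ?thesis
    unfolding group_ring_indecomposable_def
  proof (intro notI, elim exE conjE)
    fix N assume "group_ring_direct_summand G R T (\<lambda>g. tensor_map R A (\<rho> g)) N"
      and N: "N \<noteq> {\<zero>\<^bsub>T\<^esub>}" "N \<noteq> carrier T"
    then obtain N' where sub: "group_ring_submodule G R T \<tau> N" "group_ring_submodule G R T \<tau> N'"
      and Int: "N \<inter> N' = {\<zero>\<^bsub>T\<^esub>}" and sum: "N <+>\<^bsub>T\<^esub> N' = carrier T"
      unfolding group_ring_direct_summand_def \<tau>_def by blast
    have sg: "subgroup N (add_monoid T)" "subgroup N' (add_monoid T)"
      using sub by (auto simp: group_ring_submodule_def)
    \<comment> \<open>the element of the group ring with the single coefficient \<open>r\<close> at \<open>g\<close>\<close>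
    have stable: "r \<odot>\<^bsub>T\<^esub> \<tau> g y \<in> M"
      if M: "group_ring_submodule G R T \<tau> M" and r: "r \<in> carrier R" and g: "g \<in> G" and y: "y \<in> M" for M r g y
    proof (cases "r = \<zero>\<^bsub>R\<^esub>")
      case True
      have "subgroup M (add_monoid T)" using M by (simp add: group_ring_submodule_def)
      then have "\<zero>\<^bsub>T\<^esub> \<in> M" "y \<in> carrier T"
        using subgroup.one_closed subgroup.mem_carrier y by fastforce+
      then show ?thesis using True \<tau>[OF g] by (simp add: smult_zero)
    next
      case False
      let ?a = "\<lambda>h. if h = g then r else \<zero>\<^bsub>R\<^esub>"
      have yT: "y \<in> carrier T"
        using M y subgroup.mem_carrier[of M "add_monoid T" y] by (simp add: group_ring_submodule_def)
      have "?a \<in> group_ring_elements G R"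
        using r by (auto simp: group_ring_elements_def intro: finite_subset[of _ "{g}"])
      then have "group_ring_smult G R T \<tau> ?a y \<in> M"
        using M y by (simp add: group_ring_submodule_def)
      moreover have "{h \<in> G. ?a h \<noteq> \<zero>\<^bsub>R\<^esub>} = {g}" using g False by auto
      ultimately show ?thesis
        using smult_closed[OF r \<tau>[OF g yT]] by (simp add: group_ring_smult_def)
    qed
    have N'T: "N \<subseteq> carrier T" "N' \<subseteq> carrier T"
      using subgroup.subset[OF sg(1)] subgroup.subset[OF sg(2)] by auto
    have ex: "\<exists>n \<in> N. \<exists>n' \<in> N'. y = n \<oplus>\<^bsub>T\<^esub> n'" if "y \<in> carrier T" for y
      using that unfolding sum[symmetric] set_add_def' by blast
    have uniq: "n = m" if "n \<in> N" "m \<in> N" "n' \<in> N'" "m' \<in> N'" "n \<oplus>\<^bsub>T\<^esub> n' = m \<oplus>\<^bsub>T\<^esub> m'" for n m n' m'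
    proof -
      have c: "n \<in> carrier T" "m \<in> carrier T" "n' \<in> carrier T" "m' \<in> carrier T" using that N'T by auto
      have "n \<ominus>\<^bsub>T\<^esub> m = m' \<ominus>\<^bsub>T\<^esub> n'"
      proof -
        have "n = (m \<oplus>\<^bsub>T\<^esub> m') \<ominus>\<^bsub>T\<^esub> n'"
          using c that(5)[symmetric] by (simp add: a_minus_def T.a_assoc T.r_neg)
        then have "n \<ominus>\<^bsub>T\<^esub> m = (m \<oplus>\<^bsub>T\<^esub> (m' \<ominus>\<^bsub>T\<^esub> n')) \<ominus>\<^bsub>T\<^esub> m"
          using c by (simp add: a_minus_def T.a_assoc)
        also have "\<dots> = m' \<ominus>\<^bsub>T\<^esub> n'"
          using c T.a_comm[of m "m' \<ominus>\<^bsub>T\<^esub> n'"] by (simp add: a_minus_def T.a_assoc T.r_neg)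
        finally show ?thesis .
      qed
      moreover have "n \<ominus>\<^bsub>T\<^esub> m \<in> N" "m' \<ominus>\<^bsub>T\<^esub> n' \<in> N'"
        using that subgroup.m_closed[OF sg(1)] subgroup.m_inv_closed[OF sg(1)]
          subgroup.m_closed[OF sg(2)] subgroup.m_inv_closed[OF sg(2)] by (auto simp: a_minus_def a_inv_def)
      ultimately have "n \<ominus>\<^bsub>T\<^esub> m = \<zero>\<^bsub>T\<^esub>" using Int by auto
      then have "\<ominus>\<^bsub>T\<^esub> (\<ominus>\<^bsub>T\<^esub> m) = n"
        using c by (intro T.minus_equality) (simp_all add: a_minus_def)
      then show "n = m" using c by simp
    qed
    \<comment> \<open>the projection to \<open>N\<close> along the complement\<close>
    define \<pi> where "\<pi> y = (SOME n. n \<in> N \<and> (\<exists>n' \<in> N'. y = n \<oplus>\<^bsub>T\<^esub> n'))" for y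
    have \<pi>: "\<pi> y \<in> N \<and> (\<exists>n' \<in> N'. y = \<pi> y \<oplus>\<^bsub>T\<^esub> n')" if "y \<in> carrier T" for y
      unfolding \<pi>_def by (rule someI_ex) (use ex[OF that] in blast)
    have \<pi>I: "\<pi> (n \<oplus>\<^bsub>T\<^esub> n') = n" if "n \<in> N" "n' \<in> N'" for n n'
    proof -
      have "n \<oplus>\<^bsub>T\<^esub> n' \<in> carrier T" using that N'T by auto
      from \<pi>[OF this] show ?thesis using uniq that by metis
    qed
    have \<pi>T: "\<pi> y \<in> carrier T" if "y \<in> carrier T" for y using \<pi>[OF that] N'T by blast
    have \<pi>_add: "\<pi> (y \<oplus>\<^bsub>T\<^esub> z) = \<pi> y \<oplus>\<^bsub>T\<^esub> \<pi> z" if yz: "y \<in> carrier T" "z \<in> carrier T" for y z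
    proof -
      obtain n' m' where n': "n' \<in> N'" "y = \<pi> y \<oplus>\<^bsub>T\<^esub> n'" and m': "m' \<in> N'" "z = \<pi> z \<oplus>\<^bsub>T\<^esub> m'"
        using \<pi>[OF yz(1)] \<pi>[OF yz(2)] by blast
      have "y \<oplus>\<^bsub>T\<^esub> z = (\<pi> y \<oplus>\<^bsub>T\<^esub> n') \<oplus>\<^bsub>T\<^esub> (\<pi> z \<oplus>\<^bsub>T\<^esub> m')" using n'(2) m'(2) by simp
      also have "\<dots> = (\<pi> y \<oplus>\<^bsub>T\<^esub> \<pi> z) \<oplus>\<^bsub>T\<^esub> (n' \<oplus>\<^bsub>T\<^esub> m')"
      proof -
        have "\<pi> y \<in> carrier T" "\<pi> z \<in> carrier T" "n' \<in> carrier T" "m' \<in> carrier T"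
          using \<pi>T yz n'(1) m'(1) N'T by auto
        then show ?thesis by (simp add: T.a_ac)
      qed
      finally show ?thesis
        using \<pi>I[of "\<pi> y \<oplus>\<^bsub>T\<^esub> \<pi> z" "n' \<oplus>\<^bsub>T\<^esub> m'"] \<pi> yz n'(1) m'(1)
          subgroup.m_closed[OF sg(1)] subgroup.m_closed[OF sg(2)] by simp
    qed
    have \<pi>_\<tau>: "\<pi> (r \<odot>\<^bsub>T\<^esub> \<tau> g y) = r \<odot>\<^bsub>T\<^esub> \<tau> g (\<pi> y)" if "r \<in> carrier R" "g \<in> G" "y \<in> carrier T" for r g y
    proof -
      obtain n' where n': "n' \<in> N'" "y = \<pi> y \<oplus>\<^bsub>T\<^esub> n'" using \<pi>[OF \<open>y \<in> carrier T\<close>] by blast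
      have "r \<odot>\<^bsub>T\<^esub> \<tau> g y = r \<odot>\<^bsub>T\<^esub> \<tau> g (\<pi> y \<oplus>\<^bsub>T\<^esub> n')" using n'(2) by simp
      also have "\<dots> = r \<odot>\<^bsub>T\<^esub> \<tau> g (\<pi> y) \<oplus>\<^bsub>T\<^esub> r \<odot>\<^bsub>T\<^esub> \<tau> g n'"
      proof -
        have "\<pi> y \<in> carrier T" "n' \<in> carrier T" using \<pi>T that n'(1) N'T by auto
        then show ?thesis using that(1,2) by (simp add: \<tau> \<tau>_add smult_add)
      qed
      finally show ?thesis
        using \<pi>I stable[OF sub(1) that(1,2)] stable[OF sub(2) that(1,2) n'(1)] \<pi>[OF that(3)] by simp
    qed
    define c where "c = \<Phi> (\<pi> (tens \<one>\<^bsub>R\<^esub> e0))"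
    have t0: "tens \<one>\<^bsub>R\<^esub> e0 \<in> carrier T" using e0 by simp
    have c: "c \<in> carrier R" unfolding c_def using \<Phi> \<pi>T t0 by simp
    have \<mu>: "\<Phi> (\<pi> y) = c \<otimes>\<^bsub>R\<^esub> \<Phi> y" if "y \<in> carrier T" for y
      using gen that eO
    proof (induction y rule: tensor_generator_induct)
      case (tens r x)
      then obtain i where i: "i \<in> J" "x = e i" by blast
      have bi: "\<beta> i \<in> G" "\<rho> (\<beta> i) e0 = e i" using \<beta>(1)[OF i(1)] by auto
      have eq: "tens r x = r \<odot>\<^bsub>T\<^esub> \<tau> (\<beta> i) (tens \<one>\<^bsub>R\<^esub> e0)"
        using tens i bi e0 e by (simp add: \<tau>_tens smult_tens)
      have "\<Phi> (\<pi> (tens r x)) = r \<otimes>\<^bsub>R\<^esub> c"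
        unfolding eq \<pi>_\<tau>[OF tens(1) bi(1) t0]
        using \<Phi>_smult[OF tens(1) \<tau>[OF bi(1) \<pi>T[OF t0]]] \<Phi>_\<beta>[OF i(1) \<pi>T[OF t0]] by (simp add: c_def)
      moreover have "\<Phi> (tens r x) = r"
        unfolding eq
        using \<Phi>_smult[OF tens(1) \<tau>[OF bi(1) t0]] \<Phi>_\<beta>[OF i(1) t0] e0 tens(1)
        by (simp add: \<Phi>_tens)
      ultimately show ?case using c tens(1) by (simp add: R.m_comm)
    next
      case zero
      have "\<pi> (\<zero>\<^bsub>T\<^esub> \<oplus>\<^bsub>T\<^esub> \<zero>\<^bsub>T\<^esub>) = \<zero>\<^bsub>T\<^esub>" using Int by (intro \<pi>I) auto
      then show ?case using c by (simp add: \<Phi>_zero)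
    next
      case (add a b)
      then show ?case using c by (simp add: \<pi>_add \<Phi>_add \<pi>T \<Phi> R.r_distr)
    qed
    have scalar: "\<pi> y = c \<odot>\<^bsub>T\<^esub> y" if y: "y \<in> carrier T" for y
    proof (rule separate)
      fix i assume i: "i \<in> J"
      have "\<pi> (\<tau> (\<eta> i) y) = \<tau> (\<eta> i) (\<pi> y)"
        using \<pi>_\<tau>[OF R.one_closed \<eta>[OF i] y] \<tau>[OF \<eta>[OF i]] y \<pi>T by (simp add: smult_one)
      then have "\<Phi> (\<tau> (\<eta> i) (\<pi> y)) = c \<otimes>\<^bsub>R\<^esub> \<Phi> (\<tau> (\<eta> i) y)"
        using \<mu>[OF \<tau>[OF \<eta>[OF i] y]] by simp
      also have "\<dots> = \<Phi> (\<tau> (\<eta> i) (c \<odot>\<^bsub>T\<^esub> y))"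
        using \<Phi>_smult[OF c \<tau>[OF \<eta>[OF i] y]] smult_\<tau>[OF c \<eta>[OF i] y] by simp
      finally show "\<Phi> (\<tau> (\<eta> i) (\<pi> y)) = \<Phi> (\<tau> (\<eta> i) (c \<odot>\<^bsub>T\<^esub> y))" .
    qed (use y \<pi>T smult_closed[OF c] in auto)
    have \<pi>N: "\<pi> n = n" if "n \<in> N" for n
    proof -
      have "\<zero>\<^bsub>T\<^esub> \<in> N'" "n \<in> carrier T" using Int that N'T by blast+
      then show ?thesis using \<pi>I[OF that, of "\<zero>\<^bsub>T\<^esub>"] by simp
    qed
    have "c \<otimes>\<^bsub>R\<^esub> c = c"
      using \<mu>[OF \<pi>T[OF t0]] \<pi>N \<pi>[OF t0] by (simp add: c_def)
    then consider "c = \<zero>\<^bsub>R\<^esub>" | "c = \<one>\<^bsub>R\<^esub>"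
      using conn c unfolding connected_ring_def by blast
    then show False
    proof cases
      case 1
      have "n = \<zero>\<^bsub>T\<^esub>" if "n \<in> N" for n
        using \<pi>N[OF that] scalar[of n] that N'T 1 by (auto simp: smult_zero subset_iff)
      then show False using N(1) Int by blast
    next
      case 2
      have "y \<in> N" if "y \<in> carrier T" for y
        using \<pi>[OF that] scalar[OF that] 2 that by (simp add: smult_one)
      then show False using N(2) N'T by blast
    qed
  qed
qed

end


section \<open>Flags opposite to a base flag\<close>

lemma lookup_frag_map:
  "Poly_Mapping.lookup (frag_extend (frag_of \<circ> f) c) y =
   (\<Sum>x \<in> Poly_Mapping.keys c. if f x = y then Poly_Mapping.lookup c x else 0)"
  unfolding frag_extend_def lookup_sum by (rule sum.cong) auto

text \<open>
  If no other flag in the support of \<open>c\<close> shares the face with \<open>x\<close>, the coefficient of this face is that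
  of \<open>x\<close>.
\<close>

lemma lookup_zero_of_face:
  assumes face: "face_chain n k c = 0"
    and alone: "\<And>x'. \<lbrakk>x' \<in> Poly_Mapping.keys c; flag_face n k x' = flag_face n k x\<rbrakk> \<Longrightarrow> x' = x"
  shows "Poly_Mapping.lookup c x = 0"
proof (rule ccontr)
  assume x: "Poly_Mapping.lookup c x \<noteq> 0"
  have "0 = (\<Sum>x' \<in> Poly_Mapping.keys c. if flag_face n k x' = flag_face n k x then Poly_Mapping.lookup c x' else 0)"
    using face lookup_frag_map[of "flag_face n k" c "flag_face n k x"] by (simp add: face_chain_def)
  also have "\<dots> = (\<Sum>x' \<in> Poly_Mapping.keys c. if x' = x then Poly_Mapping.lookup c x else 0)"
    using alone by (intro sum.cong) auto
  also have "\<dots> = Poly_Mapping.lookup c x"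
    using x by (simp add: in_keys_iff)
  finally show False using x by simp
qed

text \<open>
  A space of dimension \<open>N + 1\<close> with an ordered basis \<open>v\<close>. Full flags of proper subspaces have \<open>N\<close> members.
\<close>

locale framed_space = finite_dimensional_vector_space scale Basis
  for scale :: "'a::field \<Rightarrow> 'b::ab_group_add \<Rightarrow> 'b" (infixr \<open>*s\<close> 75) and Basis :: "'b set" +
  fixes v :: "nat \<Rightarrow> 'b" and N :: nat
  assumes dim_eq: "dim (UNIV :: 'b set) = Suc N"
    and frame_inj: "inj_on v {..N}" and frame_independent: "independent (v ` {..N})"
begin

declare dim_UNIV [simp del]

definition full_flags :: "(nat \<Rightarrow> 'b set) set" where
  "full_flags = flags (subspace_rank scale) N (proper_subspaces scale)"

definition base :: "nat \<Rightarrow> 'b set" where "base j = span (v ` {..<j})"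

text \<open>
  The member \<open>x i\<close> has dimension \<open>i + 1\<close>, so that \<open>base (N - i)\<close> is the member of the base flag of
  complementary dimension.
\<close>

definition opposite :: "(nat \<Rightarrow> 'b set) \<Rightarrow> bool" where
  "opposite x \<longleftrightarrow> (\<forall>i<N. x i \<inter> base (N - i) = {0})"

lemma flag_cycles_eq: "flag_cycles scale = top_cycles (subspace_rank scale) N (proper_subspaces scale)"
  unfolding flag_cycles_def dim_eq by simp

lemma flag_cyclesD:
  assumes "c \<in> flag_cycles scale"
  shows "Poly_Mapping.keys c \<subseteq> full_flags" "k < N \<Longrightarrow> face_chain (N - 1) k c = 0"
  using assms unfolding flag_cycles_eq top_cycles_def full_flags_def by auto

lemma flag_cycles_diff: "\<lbrakk>a \<in> flag_cycles scale; b \<in> flag_cycles scale\<rbrakk> \<Longrightarrow> a - b \<in> flag_cycles scale"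
  unfolding flag_cycles_eq using top_cycles_add[of a _ _ _ "frag_cmul (-1) b"] top_cycles_cmul[of b _ _ _ "-1"] by simp

lemma flag_cycles_add: "\<lbrakk>a \<in> flag_cycles scale; b \<in> flag_cycles scale\<rbrakk> \<Longrightarrow> a + b \<in> flag_cycles scale"
  unfolding flag_cycles_eq by (rule top_cycles_add)

lemma flag_cycles_0: "0 \<in> flag_cycles scale"
  unfolding flag_cycles_eq top_cycles_def by simp

lemma flagD:
  assumes "x \<in> full_flags" "i < N"
  shows "subspace (x i)" "dim (x i) = Suc i" "\<And>j. i < j \<Longrightarrow> j < N \<Longrightarrow> x i \<subseteq> x j"
proof -
  have P: "x i \<in> proper_subspaces scale" and r: "subspace_rank scale (x i) = i"
    using assms unfolding full_flags_def flags_def by (auto simp: PiE_iff)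
  show "subspace (x i)" using P by (simp add: proper_subspaces_def)
  show "dim (x i) = Suc i" using r dim_proper_subspace(1)[OF P] by (simp add: subspace_rank_def)
  show "x i \<subseteq> x j" if "i < j" "j < N" for j
    using assms that unfolding full_flags_def flags_def by (simp add: psubset_imp_subset)
qed

lemma flag_extensional: "x \<in> full_flags \<Longrightarrow> x \<in> extensional {..<N}"
  unfolding full_flags_def flags_def by (auto simp: PiE_iff)

lemma subspace_eqI: "\<lbrakk>subspace S; subspace T; S \<subseteq> T; dim T \<le> dim S\<rbrakk> \<Longrightarrow> S = T"
  by (rule local.subspace_dim_equal)

lemma flagI:
  assumes ext: "x \<in> extensional {..<N}" and sub: "\<And>i. i < N \<Longrightarrow> subspace (x i)"
    and d: "\<And>i. i < N \<Longrightarrow> dim (x i) = Suc i" and mono: "\<And>i j. i < j \<Longrightarrow> j < N \<Longrightarrow> x i \<subseteq> x j"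
  shows "x \<in> full_flags"
proof -
  have P: "x i \<in> proper_subspaces scale" if "i < N" for i
  proof -
    have "dim {0} = 0" by (simp add: local.dim_eq_0)
    then have "x i \<noteq> {0}" using d[OF that] by (metis nat.distinct(1))
    moreover have "x i \<noteq> UNIV" using d[OF that] dim_eq that by auto
    ultimately show ?thesis using sub[OF that] by (simp add: proper_subspaces_def)
  qed
  have "x i < x j" if "i < j" "j < N" for i j
  proof -
    have "x i \<noteq> x j" using d[of i] d[of j] that by auto
    then show ?thesis using mono[OF that] by auto
  qed
  then show ?thesis
    unfolding full_flags_def flags_def using ext P d by (auto simp: PiE_iff subspace_rank_def)
qed

lemma subspace_base: "subspace (base j)" by (simp add: base_def)

lemma base_mono: "i \<le> j \<Longrightarrow> base i \<subseteq> base j"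
  unfolding base_def by (intro span_mono image_mono) auto

lemma span_frame_dim:
  assumes "S \<subseteq> {..N}" shows "dim (span (v ` S)) = card S"
proof -
  have "independent (v ` S)" using frame_independent by (rule independent_mono) (use assms in auto)
  moreover have "card (v ` S) = card S" by (rule card_image) (rule inj_on_subset[OF frame_inj assms])
  ultimately show ?thesis using local.dim_span_eq_card_independent by simp
qed

lemma dim_base: "j \<le> Suc N \<Longrightarrow> dim (base j) = j"
  unfolding base_def using span_frame_dim[of "{..<j}"] by force

lemma base_0: "base 0 = {0}" unfolding base_def by simp

lemma frame_mem_iff:
  assumes "a \<le> N" "S \<subseteq> {..N}" shows "v a \<in> span (v ` S) \<longleftrightarrow> a \<in> S"
proof
  assume *: "v a \<in> span (v ` S)"
  show "a \<in> S"
  proof (rule ccontr)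
    assume "a \<notin> S"
    then have "v ` S \<subseteq> v ` {..N} - {v a}"
      using assms frame_inj by (auto simp: inj_on_def subset_iff)
    then have "v a \<in> span (v ` {..N} - {v a})" using * span_mono by blast
    then show False using frame_independent assms(1) unfolding dependent_def by blast
  qed
qed (auto intro: span_base)

lemma line_of_dim_le_1:
  assumes W: "subspace W" "dim W \<le> 1" and u: "u \<in> W" "u \<noteq> 0"
  shows "W \<subseteq> span {u}"
proof -
  have "span {u} = W"
  proof (rule subspace_eqI)
    show "span {u} \<subseteq> W" using u W by (simp add: span_minimal)
    show "dim W \<le> dim (span {u})" using W u by (simp add: local.dim_singleton)
  qed (use W in auto)
  then show ?thesis by simp
qed

text \<open>
  Concerning the second part: \<open>x k\<close> is spanned by its predecessor in the flag together with \<open>u\<close>. As \<open>x'\<close>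
  has the same predecessor, \<open>u \<in> x' k\<close> would imply \<open>x' k = x k\<close>.
\<close>

lemma flags_agree_off:
  assumes x': "x' \<in> full_flags" and x: "x \<in> full_flags" and k: "k < N"
    and face: "flag_face (N - 1) k x' = flag_face (N - 1) k x" and ne: "x' \<noteq> x"
  shows "\<And>i. i < N \<Longrightarrow> i \<noteq> k \<Longrightarrow> x' i = x i"
    and "\<And>u. u \<in> x k \<Longrightarrow> (\<And>i. i < k \<Longrightarrow> u \<notin> x i) \<Longrightarrow> u \<noteq> 0 \<Longrightarrow> u \<notin> x' k"
proof -
  show agree: "x' i = x i" if i: "i < N" "i \<noteq> k" for i
  proof (cases "i < k")
    case True
    then have "i < N - 1" using k by simp
    then show ?thesis using fun_cong[OF face, of i] True by (simp add: flag_face_def)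
  next
    case False
    then show ?thesis using fun_cong[OF face, of "i - 1"] i by (simp add: flag_face_def split: if_splits)
  qed
  show "u \<notin> x' k" if u: "u \<in> x k" "\<And>i. i < k \<Longrightarrow> u \<notin> x i" "u \<noteq> 0" for u
  proof
    assume u': "u \<in> x' k"
    define D where "D = (if k = 0 then {0} else x (k - 1))"
    have D: "subspace D" "dim D = k" "u \<notin> D"
      using flagD[OF x, of "k - 1"] k u local.dim_eq_0[of "{0}"] by (auto simp: D_def)
    have DS: "D \<subseteq> x k" "D \<subseteq> x' k"
      using flagD(3)[OF x, of "k - 1" k] flagD(3)[OF x', of "k - 1" k] agree[of "k - 1"] k
        subspace_0[OF flagD(1)[OF x k]] subspace_0[OF flagD(1)[OF x' k]]
      by (auto simp: D_def)
    have "span D = D" using D(1) by (simp only: local.span_eq_iff)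
    then have "u \<notin> span D" using D(3) by metis
    then have d: "dim (span (insert u D)) = Suc k" using D by (simp add: local.dim_insert)
    have "span (insert u D) = x k"
      by (rule subspace_eqI) (use DS u d flagD[OF x k] span_minimal[of "insert u D" "x k"] in auto)
    moreover have "span (insert u D) = x' k"
      by (rule subspace_eqI) (use DS u' d flagD[OF x' k] span_minimal[of "insert u D" "x' k"] in auto)
    ultimately have "x' i = x i" for i
      using agree[of i] flag_extensional[OF x] flag_extensional[OF x']
      by (cases "i < N"; cases "i = k") (auto simp: extensional_def)
    then show False using ne by auto
  qed
qed

text \<open>
  Downward induction on the first index \<open>k\<close> with \<open>u \<in> x k\<close>. Any other flag \<open>x'\<close> with the same face of
  index \<open>k\<close> avoids \<open>u\<close> at \<open>k\<close>. If \<open>k = j\<close>, then \<open>x' j\<close> meets \<open>base (N - j)\<close> trivially, since that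
  intersection lies in the line spanned by \<open>u\<close>; otherwise \<open>u\<close> enters \<open>x'\<close> at \<open>k + 1\<close>. In both cases the
  coefficient of \<open>x'\<close> is known to vanish, and the vanishing of the face leaves only that of \<open>x\<close>.
\<close>

lemma vanish_on_line:
  assumes c: "c \<in> flag_cycles scale" and j: "j < N"
    and u0: "u \<noteq> 0"
    and IH: "\<And>x. \<lbrakk>x \<in> full_flags; \<And>i. \<lbrakk>j \<le> i; i < N\<rbrakk> \<Longrightarrow> x i \<inter> base (N - i) = {0}\<rbrakk> \<Longrightarrow> Poly_Mapping.lookup c x = 0"
    and k: "k \<le> j" and x: "x \<in> full_flags"
    and above: "\<And>i. \<lbrakk>j < i; i < N\<rbrakk> \<Longrightarrow> x i \<inter> base (N - i) = {0}"
    and line: "(if Suc j < N then x (Suc j) else UNIV) \<inter> base (N - j) \<subseteq> span {u}"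
    and uk: "u \<in> x k" "\<And>i. i < k \<Longrightarrow> u \<notin> x i"
  shows "Poly_Mapping.lookup c x = 0"
  using k x above line uk
proof (induction "j - k" arbitrary: k x)
  case (0 k x)
  have "k = j" using 0 by simp
  show ?case
  proof (rule lookup_zero_of_face[OF flag_cyclesD(2)[OF c j]])
    fix x' assume x': "x' \<in> Poly_Mapping.keys c" and face: "flag_face (N - 1) j x' = flag_face (N - 1) j x"
    show "x' = x"
    proof (rule ccontr)
      assume "x' \<noteq> x"
      have fx': "x' \<in> full_flags" using x' flag_cyclesD(1)[OF c] by blast
      have agree: "\<And>i. i < N \<Longrightarrow> i \<noteq> j \<Longrightarrow> x' i = x i" and u: "u \<notin> x' j"
        using flags_agree_off[OF fx' 0(3) j face \<open>x' \<noteq> x\<close>] 0(6,7) u0 \<open>k = j\<close> by blast+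
      have "x' i \<inter> base (N - i) = {0}" if i: "j \<le> i" "i < N" for i
      proof (cases "i = j")
        case True
        have "x' j \<subseteq> (if Suc j < N then x (Suc j) else UNIV)"
          using flagD(3)[OF fx' j, of "Suc j"] agree[of "Suc j"] by auto
        then have sub: "x' j \<inter> base (N - j) \<subseteq> span {u}" using 0(5) by blast
        have "w = 0" if w: "w \<in> x' j \<inter> base (N - j)" for w
        proof -
          obtain a where a: "w = a *s u" using sub w by (auto simp: span_singleton)
          show "w = 0"
          proof (cases "a = 0")
            case False
            have "u = inverse a *s w" using a False by simp
            then have "u \<in> x' j" using w subspace_scale[OF flagD(1)[OF fx' j]] by auto
            then show ?thesis using u by simp
          qed (simp add: a)
        qed
        moreover have "0 \<in> x' j \<inter> base (N - j)"
          using subspace_0[OF flagD(1)[OF fx' j]] subspace_0[OF subspace_base] by simp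
        ultimately show ?thesis using True by blast
      next
        case False
        then show ?thesis using 0(4)[of i] agree[of i] i by simp
      qed
      then have "Poly_Mapping.lookup c x' = 0" using IH[OF fx'] by simp
      then show False using x' by (simp add: in_keys_iff)
    qed
  qed
next
  case (Suc d k x)
  then have k: "k < j" by simp
  then have kN: "k < N" using j by simp
  show ?case
  proof (rule lookup_zero_of_face[OF flag_cyclesD(2)[OF c kN]])
    fix x' assume x': "x' \<in> Poly_Mapping.keys c" and face: "flag_face (N - 1) k x' = flag_face (N - 1) k x"
    show "x' = x"
    proof (rule ccontr)
      assume "x' \<noteq> x"
      have fx': "x' \<in> full_flags" using x' flag_cyclesD(1)[OF c] by blast
      have agree: "\<And>i. i < N \<Longrightarrow> i \<noteq> k \<Longrightarrow> x' i = x i" and u: "u \<notin> x' k"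
        using flags_agree_off[OF fx' Suc(4) kN face \<open>x' \<noteq> x\<close>] Suc(7,8) u0 by blast+
      have "Poly_Mapping.lookup c x' = 0"
      proof (rule Suc(1)[of "Suc k"])
        show "d = j - Suc k" "Suc k \<le> j" using Suc(2) k by simp_all
        show "x' \<in> full_flags" by (rule fx')
        show "x' i \<inter> base (N - i) = {0}" if "j < i" "i < N" for i
          using Suc(5)[OF that] agree[of i] that k by simp
        show "(if Suc j < N then x' (Suc j) else UNIV) \<inter> base (N - j) \<subseteq> span {u}"
          using Suc(6) agree[of "Suc j"] k by auto
        show "u \<in> x' (Suc k)"
          using flagD(3)[OF Suc(4) kN, of "Suc k"] Suc(7) agree[of "Suc k"] k j by auto
        show "u \<notin> x' i" if "i < Suc k" for i
          using that u agree[of i] Suc(8)[of i] kN by (cases "i = k") auto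
      qed
      then show False using x' by (simp add: in_keys_iff)
    qed
  qed
qed

text \<open>
  Let \<open>x\<close> be a flag whose members above \<open>j\<close> are transversal to the base flag while \<open>x j\<close> is not. Then
  \<open>x (j + 1)\<close> meets \<open>base (N - j - 1)\<close> trivially, hence \<open>base (N - j)\<close> in at most a line, and this line
  lies in \<open>x j\<close>. Induction on \<open>j\<close> with \<open>vanish_on_line\<close> reduces \<open>x\<close> to flags that are transversal from
  \<open>j\<close> on.
\<close>

lemma cycle_vanishes:
  assumes c: "c \<in> flag_cycles scale"
    and van: "\<And>x. x \<in> full_flags \<Longrightarrow> opposite x \<Longrightarrow> Poly_Mapping.lookup c x = 0"
  shows "c = 0"
proof -
  have *: "Poly_Mapping.lookup c x = 0"
    if "j \<le> N" "x \<in> full_flags" "\<And>i. \<lbrakk>j \<le> i; i < N\<rbrakk> \<Longrightarrow> x i \<inter> base (N - i) = {0}" for j x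
    using that
  proof (induction j arbitrary: x)
    case 0
    then show ?case using van by (simp add: opposite_def)
  next
    case (Suc j)
    then have j: "j < N" by simp
    show ?case
    proof (cases "x j \<inter> base (N - j) = {0}")
      case True
      show ?thesis
      proof (rule Suc.IH)
        show "x i \<inter> base (N - i) = {0}" if "j \<le> i" "i < N" for i
          using True Suc.prems(3)[of i] that by (cases "i = j") auto
      qed (use j Suc.prems in auto)
    next
      case False
      moreover have "0 \<in> x j \<inter> base (N - j)"
        using subspace_0[OF flagD(1)[OF Suc.prems(2) j]] subspace_0[OF subspace_base] by simp
      ultimately obtain u where u: "u \<in> x j" "u \<in> base (N - j)" "u \<noteq> 0" by blast
      let ?X = "if Suc j < N then x (Suc j) else UNIV"
      let ?W = "?X \<inter> base (N - j)"
      have X: "subspace ?X" using flagD(1)[OF Suc.prems(2), of "Suc j"] by auto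
      have W: "subspace ?W" by (rule subspace_inter[OF X subspace_base])
      have "dim ?W \<le> 1"
      proof (cases "Suc j < N")
        case True
        have "?W \<inter> base (N - Suc j) = {0}"
        proof -
          have "x (Suc j) \<inter> base (N - Suc j) = {0}" using Suc.prems(3)[of "Suc j"] True by simp
          moreover have "base (N - Suc j) \<subseteq> base (N - j)" by (rule base_mono) simp
          ultimately show ?thesis using True by auto
        qed
        then have "dim (?W \<inter> base (N - Suc j)) = 0" by (simp add: local.dim_eq_0)
        then have "dim {a + b | a b. a \<in> ?W \<and> b \<in> base (N - Suc j)} = dim ?W + dim (base (N - Suc j))"
          using local.dim_sums_Int[OF W subspace_base, of "N - Suc j"] by linarith
        moreover have "dim {a + b | a b. a \<in> ?W \<and> b \<in> base (N - Suc j)} \<le> dim (base (N - j))"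
        proof (rule local.dim_subset)
          show "{a + b | a b. a \<in> ?W \<and> b \<in> base (N - Suc j)} \<subseteq> base (N - j)"
            using base_mono[of "N - Suc j" "N - j", OF diff_le_mono2[OF le_SucI[OF order_refl]]]
            by (auto intro: subspace_add[OF subspace_base])
        qed
        ultimately show ?thesis using dim_base[of "N - j"] dim_base[of "N - Suc j"] j by simp
      next
        case False
        then have "N - j = 1" using j by simp
        then have "dim ?W \<le> dim (base 1)" by (intro local.dim_subset) auto
        then show ?thesis using dim_base[of 1] by simp
      qed
      moreover have uW: "u \<in> ?W" using u flagD(3)[OF Suc.prems(2) j, of "Suc j"] by auto
      ultimately have line: "?W \<subseteq> span {u}" using line_of_dim_le_1[OF W _ uW u(3)] by simp
      define k where "k = (LEAST k. u \<in> x k)"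
      have k: "u \<in> x k" "k \<le> j" "\<And>i. i < k \<Longrightarrow> u \<notin> x i"
        unfolding k_def using LeastI[of "\<lambda>k. u \<in> x k", OF u(1)] Least_le[of "\<lambda>k. u \<in> x k", OF u(1)]
          not_less_Least[of _ "\<lambda>k. u \<in> x k"] by blast+
      show ?thesis
      proof (rule vanish_on_line[OF c j u(3) _ k(2) Suc.prems(2) _ line k(1,3)])
        show "Poly_Mapping.lookup c y = 0"
          if "y \<in> full_flags" "\<And>i. \<lbrakk>j \<le> i; i < N\<rbrakk> \<Longrightarrow> y i \<inter> base (N - i) = {0}" for y
          using Suc.IH[of y] that j by simp
        show "x i \<inter> base (N - i) = {0}" if "j < i" "i < N" for i
          using Suc.prems(3)[of i] that by simp
      qed
    qed
  qed
  show ?thesis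
  proof (rule poly_mapping_eqI)
    fix x
    show "Poly_Mapping.lookup c x = Poly_Mapping.lookup 0 x"
    proof (cases "x \<in> Poly_Mapping.keys c")
      case True
      then show ?thesis using *[of N x] flag_cyclesD(1)[OF c] by auto
    qed (simp add: in_keys_iff)
  qed
qed


section \<open>The standard apartment\<close>

definition apartment_flag :: "(nat \<Rightarrow> nat) \<Rightarrow> nat \<Rightarrow> 'b set" where
  "apartment_flag \<sigma> = restrict (\<lambda>i. span (v ` \<sigma> ` {..i})) {..<N}"

definition apartment :: "(nat \<Rightarrow> 'b set) \<Rightarrow>\<^sub>0 int" where
  "apartment = (\<Sum>\<sigma> | \<sigma> permutes {..N}. frag_cmul (sign \<sigma>) (frag_of (apartment_flag \<sigma>)))"

definition reversal :: "nat \<Rightarrow> nat" where "reversal i = (if i \<le> N then N - i else i)"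

lemma reversal_permutes: "reversal permutes {..N}"
proof (rule bij_imp_permutes)
  show "bij_betw reversal {..N} {..N}"
    by (rule bij_betw_byWitness[where f' = reversal]) (auto simp: reversal_def)
qed (auto simp: reversal_def)

lemma permutes_initial_subset:
  assumes "\<sigma> permutes {..N}" "i \<le> N" shows "\<sigma> ` {..i} \<subseteq> {..N}" "card (\<sigma> ` {..i}) = Suc i"
proof -
  have "\<sigma> ` {..i} \<subseteq> \<sigma> ` {..N}" using assms(2) by (intro image_mono) auto
  then show "\<sigma> ` {..i} \<subseteq> {..N}" by (simp only: permutes_image[OF assms(1)])
  show "card (\<sigma> ` {..i}) = Suc i"
    using card_image[OF inj_on_subset[OF permutes_inj[OF assms(1)] subset_UNIV], of "{..i}"] by simp
qed

lemma permutes_eqI_initial: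
  assumes \<sigma>: "\<sigma> permutes {..N}" and \<rho>: "\<rho> permutes {..N}"
    and eq: "\<And>i. i < N \<Longrightarrow> \<sigma> ` {..i} = \<rho> ` {..i}"
  shows "\<sigma> = \<rho>"
proof
  fix i
  have eq': "\<sigma> ` {..i} = \<rho> ` {..i}" if "i \<le> N" for i
    using eq[of i] permutes_image[OF \<sigma>] permutes_image[OF \<rho>] that by (cases "i = N") auto
  show "\<sigma> i = \<rho> i"
  proof (cases "i \<le> N")
    case True
    then show ?thesis
    proof (induction i rule: less_induct)
      case (less i)
      have "\<sigma> i \<in> \<rho> ` {..i}" using eq'[OF less.prems] by blast
      then obtain j where j: "j \<le> i" "\<sigma> i = \<rho> j" by auto
      show ?case
      proof (cases "j = i")
        case False
        then have "\<sigma> j = \<sigma> i" using less.IH[of j] j less.prems by simp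
        then have "j = i" using permutes_inj[OF \<sigma>] by (simp add: inj_eq)
        then show ?thesis using False by simp
      qed (use j in simp)
    qed
  next
    case False
    then show ?thesis using permutes_not_in[OF \<sigma>] permutes_not_in[OF \<rho>] by simp
  qed
qed

lemma apartment_flag_in:
  assumes \<sigma>: "\<sigma> permutes {..N}" shows "apartment_flag \<sigma> \<in> full_flags"
proof (rule flagI)
  show "dim (apartment_flag \<sigma> i) = Suc i" if "i < N" for i
    using span_frame_dim[OF permutes_initial_subset(1)[OF \<sigma>], of i] permutes_initial_subset(2)[OF \<sigma>, of i] that
    by (simp add: apartment_flag_def)
  show "apartment_flag \<sigma> i \<subseteq> apartment_flag \<sigma> j" if "i < j" "j < N" for i j
  proof -
    have "span (v ` \<sigma> ` {..i}) \<subseteq> span (v ` \<sigma> ` {..j})"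
      using that by (intro span_mono image_mono) auto
    then show ?thesis using that by (simp add: apartment_flag_def)
  qed
qed (auto simp: apartment_flag_def)

lemma frame_in_apartment_flag:
  assumes "\<sigma> permutes {..N}" "i < N" "a \<le> N"
  shows "v a \<in> apartment_flag \<sigma> i \<longleftrightarrow> a \<in> \<sigma> ` {..i}"
  using frame_mem_iff[OF assms(3) permutes_initial_subset(1)[OF assms(1), of i]] assms(2)
  by (simp add: apartment_flag_def)

lemma apartment_flag_inj:
  assumes \<sigma>: "\<sigma> permutes {..N}" and \<rho>: "\<rho> permutes {..N}" and eq: "apartment_flag \<sigma> = apartment_flag \<rho>"
  shows "\<sigma> = \<rho>"
proof (rule permutes_eqI_initial[OF \<sigma> \<rho>])
  fix i assume i: "i < N"
  have "a \<in> \<sigma> ` {..i} \<longleftrightarrow> a \<in> \<rho> ` {..i}" if "a \<le> N" for a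
    using frame_in_apartment_flag[OF \<sigma> i that] frame_in_apartment_flag[OF \<rho> i that] eq by simp
  moreover have "\<sigma> ` {..i} \<subseteq> {..N}" "\<rho> ` {..i} \<subseteq> {..N}"
    using permutes_initial_subset(1)[OF \<sigma>, of i] permutes_initial_subset(1)[OF \<rho>, of i] i by auto
  ultimately show "\<sigma> ` {..i} = \<rho> ` {..i}" by blast
qed

lemma reversal_image: "i \<le> N \<Longrightarrow> reversal ` {..i} = {N - i..N}"
proof (intro equalityI subsetI)
  fix a assume "i \<le> N" "a \<in> {N - i..N}"
  then show "a \<in> reversal ` {..i}" by (intro image_eqI[of _ _ "N - a"]) (auto simp: reversal_def)
qed (auto simp: reversal_def)

text \<open>
  A span of \<open>i + 1\<close> basis vectors that meets \<open>base (N - i)\<close> trivially contains none of the first \<open>N - i\<close>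
  basis vectors and is therefore the span of the last \<open>i + 1\<close>.
\<close>

lemma opposite_apartment_flag:
  assumes \<sigma>: "\<sigma> permutes {..N}" and opp: "opposite (apartment_flag \<sigma>)"
  shows "\<sigma> = reversal"
proof (rule permutes_eqI_initial[OF \<sigma> reversal_permutes])
  fix i assume i: "i < N"
  have "a \<in> {N - i..N}" if a: "a \<in> \<sigma> ` {..i}" for a
  proof -
    have aN: "a \<le> N" using permutes_initial_subset(1)[OF \<sigma>, of i] i a by auto
    have "v a \<noteq> 0" using frame_independent aN dependent_zero[of "v ` {..N}"] by (metis atMost_iff imageI)
    moreover have "v a \<in> apartment_flag \<sigma> i" using frame_in_apartment_flag[OF \<sigma> i aN] a by simp
    ultimately have "v a \<notin> base (N - i)" using opp i unfolding opposite_def by blast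
    moreover have "{..<N - i} \<subseteq> {..N}" by auto
    ultimately have "a \<notin> {..<N - i}" using frame_mem_iff[OF aN] unfolding base_def by blast
    then show ?thesis using aN by auto
  qed
  then have "\<sigma> ` {..i} \<subseteq> {N - i..N}" by blast
  moreover have "card {N - i..N} = card (\<sigma> ` {..i})"
    using permutes_initial_subset(2)[OF \<sigma>, of i] i by simp
  ultimately have "\<sigma> ` {..i} = {N - i..N}" by (intro card_subset_eq) auto
  then show "\<sigma> ` {..i} = reversal ` {..i}" using reversal_image[of i] i by simp
qed

lemma lookup_apartment_sum:
  "Poly_Mapping.lookup apartment x = (\<Sum>\<sigma> | \<sigma> permutes {..N}. if apartment_flag \<sigma> = x then sign \<sigma> else 0)"
  unfolding apartment_def lookup_sum by (rule sum.cong) auto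

lemma lookup_apartment:
  assumes "\<rho> permutes {..N}"
  shows "Poly_Mapping.lookup apartment (apartment_flag \<rho>) = sign \<rho>"
proof -
  have "Poly_Mapping.lookup apartment (apartment_flag \<rho>) = (\<Sum>\<sigma> | \<sigma> permutes {..N}. if \<sigma> = \<rho> then sign \<rho> else 0)"
    unfolding lookup_apartment_sum using apartment_flag_inj assms by (intro sum.cong) auto
  then show ?thesis using assms by (simp add: finite_permutations)
qed

lemma apartment_support: "x \<in> Poly_Mapping.keys apartment \<Longrightarrow> \<exists>\<sigma>. \<sigma> permutes {..N} \<and> x = apartment_flag \<sigma>"
proof (rule ccontr)
  assume x: "x \<in> Poly_Mapping.keys apartment" and no: "\<not> (\<exists>\<sigma>. \<sigma> permutes {..N} \<and> x = apartment_flag \<sigma>)"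
  have "Poly_Mapping.lookup apartment x = 0"
    unfolding lookup_apartment_sum using no by (intro sum.neutral) auto
  then show False using x by (simp add: in_keys_iff)
qed

text \<open>Exchanging the values of a permutation at \<open>k\<close> and \<open>k + 1\<close> changes its sign and affects only
  the \<open>k\<close>th member of its flag, so that the terms of every face cancel in pairs.\<close>

lemma apartment_cycle: "apartment \<in> flag_cycles scale"
  unfolding flag_cycles_eq top_cycles_def
proof (intro CollectI conjI allI impI)
  show "Poly_Mapping.keys apartment \<subseteq> flags (subspace_rank scale) N (proper_subspaces scale)"
    using apartment_support apartment_flag_in unfolding full_flags_def by blast
  fix k assume k: "k < N"
  let ?\<tau> = "Transposition.transpose k (Suc k)" and ?P = "{\<sigma>. \<sigma> permutes {..N}}"
  let ?f = "\<lambda>\<sigma>. frag_cmul (sign \<sigma>) (frag_of (flag_face (N - 1) k (apartment_flag \<sigma>)))"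
  have \<tau>: "?\<tau> permutes {..N}" using k by (intro permutes_swap_id) auto
  have swap: "?f (\<sigma> \<circ> ?\<tau>) = - ?f \<sigma>" if \<sigma>: "\<sigma> permutes {..N}" for \<sigma>
  proof -
    have "?\<tau> ` {..i} = {..i}" if "i \<noteq> k" for i
    proof -
      have sub: "?\<tau> ` {..i} \<subseteq> {..i}" using that by (auto simp: Transposition.transpose_def)
      have "card (?\<tau> ` {..i}) = card {..i}"
        by (rule card_image[OF inj_on_subset[OF inj_transpose subset_UNIV]])
      then show ?thesis using sub by (intro card_subset_eq) auto
    qed
    then have im: "(\<sigma> \<circ> ?\<tau>) ` {..i} = \<sigma> ` {..i}" if "i \<noteq> k" for i
      using that by (metis image_comp)
    have "flag_face (N - 1) k (apartment_flag (\<sigma> \<circ> ?\<tau>)) = flag_face (N - 1) k (apartment_flag \<sigma>)"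
    proof
      fix i
      show "flag_face (N - 1) k (apartment_flag (\<sigma> \<circ> ?\<tau>)) i = flag_face (N - 1) k (apartment_flag \<sigma>) i"
        using im[of "if i < k then i else Suc i"] k
        by (auto simp: flag_face_def apartment_flag_def split: if_split_asm)
    qed
    moreover have "sign (\<sigma> \<circ> ?\<tau>) = - sign \<sigma>"
      using sign_compose[OF permutation_permutes[THEN iffD2] permutation_permutes[THEN iffD2], of \<sigma> ?\<tau>] \<sigma> \<tau>
      by (auto simp: sign_swap_id)
    ultimately show ?thesis by simp
  qed
  have fin: "finite ?P" by (rule finite_permutations) simp
  have face: "face_chain (N - 1) k apartment = sum ?f ?P"
    unfolding apartment_def face_chain_sum[OF fin] by (simp add: face_chain_cmul face_chain_of)
  have "sum ?f ?P = (\<Sum>\<sigma>\<in>?P. ?f (\<sigma> \<circ> ?\<tau>))"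
    by (rule sum_permutations_compose_right[OF \<tau>])
  also have "\<dots> = (\<Sum>\<sigma>\<in>?P. - ?f \<sigma>)"
    by (rule sum.cong) (use swap in auto)
  also have "\<dots> = - sum ?f ?P" by (rule sum_negf)
  finally have "face_chain (N - 1) k apartment = - face_chain (N - 1) k apartment" unfolding face .
  then have "Poly_Mapping.lookup (face_chain (N - 1) k apartment) y = - Poly_Mapping.lookup (face_chain (N - 1) k apartment) y" for y
    by (metis lookup_uminus)
  then show "face_chain (N - 1) k apartment = 0"
    by (intro poly_mapping_eqI) (simp add: eq_neg_iff_add_eq_0)
qed

section \<open>Moving frames\<close>

definition move_flag :: "('b \<Rightarrow> 'b) \<Rightarrow> (nat \<Rightarrow> 'b set) \<Rightarrow> nat \<Rightarrow> 'b set" where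
  "move_flag g x = restrict (\<lambda>i. g ` x i) {..<N}"

lemma move_flag_apply: "i < N \<Longrightarrow> move_flag g x i = g ` x i"
  by (simp add: move_flag_def)

lemma move_flags_eq: "move_flags N g c = frag_extend (frag_of \<circ> move_flag g) c"
  unfolding move_flags_def move_flag_def ..

lemma GL_facts:
  assumes "g \<in> GL scale"
  shows "bij g" "Vector_Spaces.linear scale scale g" "inj g"
  using assms by (auto simp: GL_def bij_is_inj)

lemma GL_dim_image:
  assumes g: "g \<in> GL scale" and S: "subspace S" shows "dim (g ` S) = dim S" "subspace (g ` S)"
proof -
  interpret g: Vector_Spaces.linear scale scale g by (rule GL_facts(2)[OF g])
  obtain C where C: "C \<subseteq> S" "independent C" "S \<subseteq> span C" "card C = dim S"
    using local.basis_exists[of S] by blast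
  have "span C = S" using C S by (metis span_minimal subset_antisym)
  then have "g ` S = span (g ` C)" using g.span_image[of C] by simp
  moreover have "independent (g ` C)"
    using g.independent_injective_image[OF C(2)] inj_on_subset[OF GL_facts(3)[OF g]] by simp
  moreover have "card (g ` C) = card C"
    by (rule card_image) (rule inj_on_subset[OF GL_facts(3)[OF g] subset_UNIV])
  ultimately show "dim (g ` S) = dim S" using C local.dim_span_eq_card_independent by simp
  show "subspace (g ` S)" by (rule g.subspace_image[OF S])
qed

lemma move_flag_in:
  assumes g: "g \<in> GL scale" and x: "x \<in> full_flags" shows "move_flag g x \<in> full_flags"
proof (rule flagI)
  show "move_flag g x i \<subseteq> move_flag g x j" if "i < j" "j < N" for i j
    using flagD(3)[OF x, of i j] that by (auto simp: move_flag_def)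
qed (use GL_dim_image[OF g flagD(1)[OF x]] flagD(2)[OF x] in \<open>auto simp: move_flag_def\<close>)

lemma move_flag_inj:
  assumes g: "g \<in> GL scale" and "x \<in> full_flags" "y \<in> full_flags" "move_flag g x = move_flag g y"
  shows "x = y"
proof
  fix i
  show "x i = y i"
  proof (cases "i < N")
    case True
    then have "g ` x i = g ` y i" using fun_cong[OF assms(4), of i] by (simp add: move_flag_def)
    then show ?thesis using inj_image_eq_iff[OF GL_facts(3)[OF g]] by blast
  next
    case False
    then show ?thesis using flag_extensional[OF assms(2)] flag_extensional[OF assms(3)]
      by (simp add: extensional_def)
  qed
qed

lemma lookup_move_flags:
  assumes g: "g \<in> GL scale" and c: "Poly_Mapping.keys c \<subseteq> full_flags" and x: "x \<in> full_flags"
  shows "Poly_Mapping.lookup (move_flags N g c) (move_flag g x) = Poly_Mapping.lookup c x"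
proof -
  have "Poly_Mapping.lookup (move_flags N g c) (move_flag g x)
      = (\<Sum>y \<in> Poly_Mapping.keys c. if y = x then Poly_Mapping.lookup c x else 0)"
    unfolding move_flags_eq lookup_frag_map
    using move_flag_inj[OF g _ x] c by (intro sum.cong) auto
  then show ?thesis by (simp add: in_keys_iff)
qed

lemma keys_move_flags: "Poly_Mapping.keys (move_flags N g c) \<subseteq> move_flag g ` Poly_Mapping.keys c"
  unfolding move_flags_eq using keys_frag_extend[of "frag_of \<circ> move_flag g" c] by auto

lemma move_flags_cycle:
  assumes g: "g \<in> GL scale" and c: "c \<in> flag_cycles scale"
  shows "move_flags N g c \<in> flag_cycles scale"
  unfolding flag_cycles_eq top_cycles_def
proof (intro CollectI conjI allI impI)
  show "Poly_Mapping.keys (move_flags N g c) \<subseteq> flags (subspace_rank scale) N (proper_subspaces scale)"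
    using keys_move_flags[of g c] flag_cyclesD(1)[OF c] move_flag_in[OF g] unfolding full_flags_def by blast
  fix k assume k: "k < N"
  have "flag_face (N - 1) k (move_flag g x) = restrict (\<lambda>i. g ` flag_face (N - 1) k x i) {..<N - 1}" for x
    using k by (intro ext) (auto simp: flag_face_def move_flag_def)
  then have "face_chain (N - 1) k (move_flags N g c) = move_flags (N - 1) g (face_chain (N - 1) k c)"
    unfolding move_flags_eq face_chain_def unfolding move_flags_def frag_extend_compose by (simp add: o_def)
  then show "face_chain (N - 1) k (move_flags N g c) = 0"
    using flag_cyclesD(2)[OF c k] by (simp add: move_flags_def)
qed

text \<open>
  The linear map is the one that takes the basis \<open>v\<close> to the basis \<open>u\<close>.
\<close>

lemma frame_map:
  assumes u: "inj_on u {..N}" "independent (u ` {..N})"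
  shows "\<exists>g \<in> GL scale. \<forall>S \<subseteq> {..N}. g ` span (v ` S) = span (u ` S)"
proof -
  interpret p: vector_space_pair scale scale by unfold_locales
  obtain g where lin: "Vector_Spaces.linear scale scale g"
    and gv: "\<forall>w \<in> v ` {..N}. g w = u (the_inv_into {..N} v w)"
    using p.linear_independent_extend[OF frame_independent, of "\<lambda>w. u (the_inv_into {..N} v w)"] by blast
  interpret g: Vector_Spaces.linear scale scale g by (rule lin)
  have gu: "g (v a) = u a" if "a \<le> N" for a
    using gv that the_inv_into_f_f[OF frame_inj, of a] by simp
  have im: "g ` span (v ` S) = span (u ` S)" if "S \<subseteq> {..N}" for S
  proof -
    have "g ` v ` S = u ` S" using gu that by (force simp: image_iff)
    then show ?thesis using g.span_image[of "v ` S"] by simp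
  qed
  have "span (u ` {..N}) = UNIV"
  proof (rule subspace_eqI)
    have "dim (span (u ` {..N})) = Suc N"
      using local.dim_span_eq_card_independent[OF u(2)] card_image[OF u(1)] by simp
    then show "dim (UNIV :: 'b set) \<le> dim (span (u ` {..N}))" using dim_eq by simp
  qed auto
  then have "g ` span (v ` {..N}) = UNIV" using im[of "{..N}"] by (simp only: subset_refl)
  moreover have "g ` span (v ` {..N}) \<subseteq> range g" by blast
  ultimately have "surj g" by (simp only: top.extremum_unique)
  moreover from this have "inj g" by (rule local.linear_surj_imp_inj[OF lin])
  ultimately have "g \<in> GL scale" using lin by (simp add: GL_def bij_def)
  then show ?thesis using im by blast
qed

text \<open>
  The vector \<open>u a\<close> is taken from the intersection of \<open>base (a + 1)\<close> with the member of dimension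
  \<open>N - a + 1\<close> of \<open>x\<close>, which is non-zero for dimension reasons. It is not in \<open>base a\<close>, because the two
  flags are opposite. Thus the vectors span the base flag from the front and \<open>x\<close> from the back.
\<close>

lemma adapted_frame:
  assumes x: "x \<in> full_flags" "opposite x"
  shows "\<exists>u. inj_on u {..N} \<and> independent (u ` {..N}) \<and>
    (\<forall>j \<le> Suc N. span (u ` {..<j}) = base j) \<and> (\<forall>i<N. span (u ` {N - i..N}) = x i)"
proof -
  \<comment> \<open>the flag prolonged by the whole space, which is needed for \<open>a = 0\<close>\<close>
  define lev where "lev i = (if i < N then x i else UNIV)" for i
  have "\<exists>w. w \<in> lev (N - a) \<and> w \<in> base (Suc a) \<and> w \<notin> base a" if a: "a \<le> N" for a
  proof -
    have lev: "subspace (lev (N - a))" "dim (lev (N - a)) = Suc (N - a)"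
      using flagD[OF x(1), of "N - a"] a dim_eq by (auto simp: lev_def)
    have "dim {p + q |p q. p \<in> lev (N - a) \<and> q \<in> base (Suc a)} \<le> Suc N"
      unfolding dim_eq[symmetric] by (rule local.dim_subset[OF subset_UNIV])
    then have "dim (lev (N - a) \<inter> base (Suc a)) \<noteq> 0"
      using local.dim_sums_Int[OF lev(1) subspace_base, of "Suc a"] lev(2) dim_base[of "Suc a"] a by linarith
    then have "\<not> lev (N - a) \<inter> base (Suc a) \<subseteq> {0}"
      using local.dim_eq_0[of "lev (N - a) \<inter> base (Suc a)"] by metis
    then obtain w where w: "w \<in> lev (N - a)" "w \<in> base (Suc a)" "w \<noteq> 0"
      by blast
    have "w \<notin> base a"
    proof (cases "a = 0")
      case False
      then have "N - a < N" using a by simp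
      then have "x (N - a) \<inter> base (N - (N - a)) = {0}" using x(2) unfolding opposite_def by blast
      moreover have "N - (N - a) = a" "lev (N - a) = x (N - a)" using a False by (auto simp: lev_def)
      ultimately show ?thesis using w by auto
    qed (use w base_0 in simp)
    then show ?thesis using w by blast
  qed
  then have "\<forall>a \<in> {..N}. \<exists>w. w \<in> lev (N - a) \<and> w \<in> base (Suc a) \<and> w \<notin> base a" by simp
  from bchoice[OF this] obtain u
    where u: "\<And>a. a \<le> N \<Longrightarrow> u a \<in> lev (N - a)" "\<And>a. a \<le> N \<Longrightarrow> u a \<in> base (Suc a)" "\<And>a. a \<le> N \<Longrightarrow> u a \<notin> base a"
    by auto
  have ind: "independent (u ` {..<j}) \<and> inj_on u {..<j} \<and> span (u ` {..<j}) = base j" if "j \<le> Suc N" for j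
    using that
  proof (induction j)
    case 0
    then show ?case by (simp add: base_0 independent_empty)
  next
    case (Suc j)
    then have IH: "independent (u ` {..<j})" "inj_on u {..<j}" "span (u ` {..<j}) = base j" by auto
    have j: "j \<le> N" using Suc.prems by simp
    have out: "u j \<notin> span (u ` {..<j})" using u(3)[OF j] IH(3) by simp
    have ins: "u ` {..<Suc j} = insert (u j) (u ` {..<j})" by (simp add: lessThan_Suc)
    have "span (insert (u j) (u ` {..<j})) = base (Suc j)"
    proof (rule subspace_eqI)
      have "u ` {..<j} \<subseteq> base j" unfolding IH(3)[symmetric] by (rule span_superset)
      then have "insert (u j) (u ` {..<j}) \<subseteq> base (Suc j)"
        using u(2)[OF j] base_mono[OF le_SucI[OF order_refl[of j]]] by simp
      then show "span (insert (u j) (u ` {..<j})) \<subseteq> base (Suc j)"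
        by (rule span_minimal[OF _ subspace_base])
      have "dim (span (u ` {..<j})) = j" using IH(3) dim_base[of j] j by simp
      then show "dim (base (Suc j)) \<le> dim (span (insert (u j) (u ` {..<j})))"
        using out dim_base[OF Suc.prems] by (simp add: local.dim_insert)
    qed (auto simp: subspace_base)
    moreover have "independent (insert (u j) (u ` {..<j}))"
      by (rule independent_insertI[OF out IH(1)])
    moreover have "inj_on u {..<Suc j}"
    proof -
      have "u j \<notin> u ` {..<j}" using out span_base[of "u j" "u ` {..<j}"] by (rule contrapos_nn)
      then show ?thesis using IH(2) by (simp add: lessThan_Suc)
    qed
    ultimately show ?case unfolding ins by blast
  qed
  have frame: "inj_on u {..N}" "independent (u ` {..N})"
    using ind[of "Suc N"] unfolding lessThan_Suc_atMost by auto
  have "span (u ` {N - i..N}) = x i" if i: "i < N" for i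
  proof (rule subspace_eqI)
    have "u a \<in> x i" if a: "a \<in> {N - i..N}" for a
    proof -
      have "N - a \<le> i" "N - a < N" using a i by auto
      then have "u a \<in> x (N - a)" using u(1)[of a] a by (simp add: lev_def)
      then show ?thesis
        using flagD(3)[OF x(1) \<open>N - a < N\<close>, of i] i \<open>N - a \<le> i\<close> by (cases "N - a = i") auto
    qed
    then show "span (u ` {N - i..N}) \<subseteq> x i" using flagD(1)[OF x(1) i] by (intro span_minimal) auto
    have "independent (u ` {N - i..N})" by (rule independent_mono[OF frame(2)]) auto
    then have "dim (span (u ` {N - i..N})) = card (u ` {N - i..N})"
      by (rule local.dim_span_eq_card_independent)
    also have "\<dots> = Suc i" using card_image[OF inj_on_subset[OF frame(1)], of "{N - i..N}"] i by simp
    finally show "dim (x i) \<le> dim (span (u ` {N - i..N}))" using flagD(2)[OF x(1) i] by simp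
  qed (use flagD(1)[OF x(1) i] in auto)
  then show ?thesis using frame ind by blast
qed

lemma apartment_flag_id: "i < N \<Longrightarrow> apartment_flag id i = base (Suc i)"
  by (simp add: apartment_flag_def base_def lessThan_Suc_atMost)

text \<open>
  The map that takes \<open>v\<close> to the basis adapted to the base flag and \<open>x\<close>.
\<close>

lemma opposite_transport:
  assumes x: "x \<in> full_flags" "opposite x"
  shows "\<exists>g \<in> GL scale. (\<forall>j \<le> Suc N. g ` base j = base j) \<and> move_flag g (apartment_flag reversal) = x"
proof -
  obtain u where u: "inj_on u {..N}" "independent (u ` {..N})"
    "\<And>j. j \<le> Suc N \<Longrightarrow> span (u ` {..<j}) = base j" "\<And>i. i < N \<Longrightarrow> span (u ` {N - i..N}) = x i"
    using adapted_frame[OF x] by blast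
  obtain g where g: "g \<in> GL scale" "\<And>S. S \<subseteq> {..N} \<Longrightarrow> g ` span (v ` S) = span (u ` S)"
    using frame_map[OF u(1,2)] by blast
  have "g ` base j = base j" if "j \<le> Suc N" for j
  proof -
    have "{..<j} \<subseteq> {..N}" using that by auto
    from g(2)[OF this] show ?thesis using u(3)[OF that] by (simp add: base_def)
  qed
  moreover have "move_flag g (apartment_flag reversal) = x"
  proof
    fix i
    show "move_flag g (apartment_flag reversal) i = x i"
    proof (cases "i < N")
      case True
      then show ?thesis
        using g(2)[of "{N - i..N}"] u(4)[OF True] reversal_image[of i] by (simp add: move_flag_def apartment_flag_def)
    next
      case False
      then show ?thesis using flag_extensional[OF x(1)] by (simp add: move_flag_def extensional_def)
    qed
  qed
  ultimately show ?thesis using g(1) by blast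
qed

lemma opposite_move_flag:
  assumes g: "g \<in> GL scale" "\<And>j. j \<le> Suc N \<Longrightarrow> g ` base j = base j"
    and y: "y \<in> full_flags" "opposite (move_flag g y)"
  shows "opposite y"
  unfolding opposite_def
proof (intro allI impI)
  fix i assume i: "i < N"
  interpret g: Vector_Spaces.linear scale scale g by (rule GL_facts(2)[OF g(1)])
  have "w = 0" if w: "w \<in> y i" "w \<in> base (N - i)" for w
  proof -
    have "g w \<in> move_flag g y i" using w i by (simp add: move_flag_def)
    moreover have "g w \<in> base (N - i)"
    proof -
      have "g w \<in> g ` base (N - i)" using w by blast
      then show ?thesis by (simp only: g(2)[OF le_SucI[OF diff_le_self]])
    qed
    ultimately have "g w = g 0" using y(2) i by (auto simp: opposite_def g.zero)
    then show "w = 0" by (rule injD[OF GL_facts(3)[OF g(1)]])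
  qed
  then show "y i \<inter> base (N - i) = {0}"
    using subspace_0[OF flagD(1)[OF y(1) i]] subspace_0[OF subspace_base] by blast
qed

lemma reversal_transport: "\<exists>w \<in> GL scale. move_flag w (apartment_flag reversal) = apartment_flag id"
proof -
  have im: "reversal ` {..N} = {..N}" by (rule permutes_image[OF reversal_permutes])
  have "inj_on (v \<circ> reversal) {..N}"
    using frame_inj permutes_inj_on[OF reversal_permutes] im by (intro comp_inj_on) auto
  moreover have "independent ((v \<circ> reversal) ` {..N})"
    unfolding image_comp[symmetric] im by (rule frame_independent)
  ultimately obtain w where w: "w \<in> GL scale" "\<And>S. S \<subseteq> {..N} \<Longrightarrow> w ` span (v ` S) = span ((v \<circ> reversal) ` S)"
    using frame_map by blast
  have rr: "reversal ` reversal ` S = S" for S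
  proof -
    have "reversal (reversal i) = i" for i by (simp add: reversal_def)
    then show ?thesis by (simp add: image_image)
  qed
  have "move_flag w (apartment_flag reversal) = apartment_flag id"
  proof
    fix i
    show "move_flag w (apartment_flag reversal) i = apartment_flag id i"
    proof (cases "i < N")
      case True
      have "w ` span (v ` reversal ` {..i}) = span ((v \<circ> reversal) ` reversal ` {..i})"
        by (rule w(2)) (use permutes_initial_subset(1)[OF reversal_permutes, of i] True in simp)
      also have "(v \<circ> reversal) ` reversal ` {..i} = v ` {..i}"
        unfolding image_comp[symmetric] rr ..
      finally show ?thesis using True by (simp add: move_flag_def apartment_flag_def)
    qed (simp add: move_flag_def apartment_flag_def)
  qed
  then show ?thesis using w(1) by blast
qed

lemma GL_inv: "g \<in> GL scale \<Longrightarrow> inv_into UNIV g \<in> GL scale"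
proof -
  assume g: "g \<in> GL scale"
  have b: "bij g" by (rule GL_facts(1)[OF g])
  have "Vector_Spaces.linear scale scale (inv_into UNIV g)"
    by (rule local.inj_linear_imp_inv_linear[OF GL_facts(2,3)[OF g]])
  then show ?thesis using bij_imp_bij_inv[OF b] by (simp add: GL_def)
qed

lemma GL_comp: "\<lbrakk>g \<in> GL scale; h \<in> GL scale\<rbrakk> \<Longrightarrow> g \<circ> h \<in> GL scale"
  by (auto simp: GL_def intro: Vector_Spaces.linear_compose bij_comp)

section \<open>Indecomposability of the Steinberg module\<close>

text \<open>
  The criterion applies with the coefficient at the base flag as functional. The translates \<open>a x\<close> of the
  apartment are indexed by the flags \<open>x\<close> opposite to the base flag, by elements \<open>b x\<close> that fix the base
  flag and take the reversed flag to \<open>x\<close>. The coefficient at \<open>x\<close> is the translate of the functional by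
  the inverse of \<open>b x\<close> followed by an element \<open>w\<close> that takes the reversed flag to the base flag.
\<close>

theorem steinberg_indecomposable:
  assumes R: "cring R" and conn: "connected_ring R"
  shows "group_ring_indecomposable (GL scale) R (tensor_module R (steinberg scale))
     (\<lambda>g. tensor_map R (steinberg scale) (steinberg_act scale g))"
proof -
  let ?St = "steinberg scale" and ?act = "steinberg_act scale" and ?Z = "flag_cycles scale"
  have "(UNIV :: 'b set) \<noteq> {0}"
  proof
    assume "(UNIV :: 'b set) = {0}"
    then have "dim (UNIV :: 'b set) = 0" by (simp add: local.dim_eq_0)
    then show False using dim_eq by simp
  qed
  from steinberg_flags[OF this] obtain \<Psi> where
    St: "comm_group ?St" and act: "\<And>g. ?act g \<in> hom ?St ?St"
    and bij: "bij_betw \<Psi> ?Z (carrier ?St)" and \<Psi>_add: "\<And>a b. \<Psi> (a + b) = \<Psi> a \<otimes>\<^bsub>?St\<^esub> \<Psi> b"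
    and \<Psi>_act: "\<And>g c. \<lbrakk>g \<in> GL scale; c \<in> ?Z\<rbrakk> \<Longrightarrow> ?act g (\<Psi> c) = \<Psi> (move_flags N g c)"
    unfolding dim_eq diff_Suc_1 by blast
  interpret scalar_extension R ?St
    using R St by (simp add: scalar_extension_def)
  define J where "J = {x \<in> full_flags. opposite x}"
  have "\<forall>x \<in> J. \<exists>g. g \<in> GL scale \<and> (\<forall>j \<le> Suc N. g ` base j = base j) \<and> move_flag g (apartment_flag reversal) = x"
    using opposite_transport by (auto simp: J_def)
  from bchoice[OF this] obtain b where b: "\<And>x. x \<in> J \<Longrightarrow> b x \<in> GL scale"
    "\<And>x j. x \<in> J \<Longrightarrow> j \<le> Suc N \<Longrightarrow> b x ` base j = base j"
    "\<And>x. x \<in> J \<Longrightarrow> move_flag (b x) (apartment_flag reversal) = x" by blast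
  obtain w where w: "w \<in> GL scale" "move_flag w (apartment_flag reversal) = apartment_flag id"
    using reversal_transport by blast
  let ?F = "apartment_flag id"
  have F: "?F \<in> full_flags" by (rule apartment_flag_in) simp
  have flagsZ: "\<And>c. c \<in> ?Z \<Longrightarrow> Poly_Mapping.keys c \<subseteq> full_flags" using flag_cyclesD(1) by blast
  define \<phi> where "\<phi> y = Poly_Mapping.lookup (the_inv_into ?Z \<Psi> y) ?F" for y
  have inv\<Psi>: "the_inv_into ?Z \<Psi> (\<Psi> c) = c" if "c \<in> ?Z" for c
    using bij that by (simp add: bij_betw_def the_inv_into_f_f)
  have \<phi>\<Psi>: "\<phi> (\<Psi> c) = Poly_Mapping.lookup c ?F" if "c \<in> ?Z" for c
    using inv\<Psi>[OF that] by (simp add: \<phi>_def)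
  have \<Psi>Z: "\<Psi> c \<in> carrier ?St" if "c \<in> ?Z" for c using bij that by (auto simp: bij_betw_def)
  have onto: "\<exists>c \<in> ?Z. y = \<Psi> c" if "y \<in> carrier ?St" for y using bij that by (auto simp: bij_betw_def)
  define a where "a x = move_flags N (b x) apartment" for x
  have aZ: "a x \<in> ?Z" if "x \<in> J" for x
    unfolding a_def by (rule move_flags_cycle[OF b(1)[OF that] apartment_cycle])
  define \<epsilon> where "\<epsilon> = sign reversal"
  have \<epsilon>: "\<epsilon> * \<epsilon> = 1" by (simp add: \<epsilon>_def)
  have rev: "apartment_flag reversal \<in> full_flags" by (rule apartment_flag_in[OF reversal_permutes])
  have dual: "Poly_Mapping.lookup (a y) x = (if x = y then \<epsilon> else 0)" if x: "x \<in> J" and y: "y \<in> J" for x y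
  proof (cases "x = y")
    case True
    then show ?thesis
      using lookup_move_flags[OF b(1)[OF y] flagsZ[OF apartment_cycle] rev] b(3)[OF y]
        lookup_apartment[OF reversal_permutes] by (simp add: a_def \<epsilon>_def)
  next
    case False
    have "x \<notin> Poly_Mapping.keys (a y)"
    proof
      assume "x \<in> Poly_Mapping.keys (a y)"
      then obtain \<sigma> where \<sigma>: "\<sigma> permutes {..N}" "x = move_flag (b y) (apartment_flag \<sigma>)"
        using keys_move_flags[of "b y" apartment] apartment_support unfolding a_def by blast
      have "opposite (apartment_flag \<sigma>)"
        using opposite_move_flag[OF b(1)[OF y] b(2)[OF y] apartment_flag_in[OF \<sigma>(1)]] x \<sigma>(2) by (simp add: J_def)
      then have "\<sigma> = reversal" by (rule opposite_apartment_flag[OF \<sigma>(1)])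
      then show False using \<sigma>(2) b(3)[OF y] False by simp
    qed
    then show ?thesis using False by (simp add: in_keys_iff)
  qed
  have fixF: "move_flag (b x) ?F = ?F" if "x \<in> J" for x
  proof
    fix i
    show "move_flag (b x) ?F i = ?F i"
      using b(2)[OF that, of "Suc i"] apartment_flag_id[of i]
      by (cases "i < N") (simp_all add: move_flag_def apartment_flag_def)
  qed
  show ?thesis
  proof (rule indecomposable_criterion[where J = J and \<phi> = \<phi> and ?e0.0 = "\<Psi> apartment" and e = "\<lambda>x. \<Psi> (a x)"
        and \<beta> = b and \<eta> = "\<lambda>x. w \<circ> inv_into UNIV (b x)" and \<epsilon> = \<epsilon>])
    show "connected_ring R" by (rule conn)
    show "?act g \<in> hom ?St ?St" for g by (rule act)
    show "\<phi> (y \<otimes>\<^bsub>?St\<^esub> z) = \<phi> y + \<phi> z" if yz: "y \<in> carrier ?St" "z \<in> carrier ?St" for y z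
    proof -
      obtain c d where cd: "c \<in> ?Z" "d \<in> ?Z" "y = \<Psi> c" "z = \<Psi> d" using onto yz by meson
      then show ?thesis
        using \<phi>\<Psi>[OF flag_cycles_add[OF cd(1,2)]] \<Psi>_add[of c d] by (simp add: \<phi>\<Psi> lookup_add)
    qed
    show "\<Psi> apartment \<in> carrier ?St" by (rule \<Psi>Z[OF apartment_cycle])
    show "\<phi> (\<Psi> apartment) = 1"
      using lookup_apartment[OF permutes_id[of "{..N}"]] by (simp add: \<phi>\<Psi>[OF apartment_cycle])
    show "\<Psi> (a x) \<in> carrier ?St" if "x \<in> J" for x by (rule \<Psi>Z[OF aZ[OF that]])
    show "b x \<in> GL scale \<and> ?act (b x) (\<Psi> apartment) = \<Psi> (a x)" if "x \<in> J" for x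
      using \<Psi>_act[OF b(1)[OF that] apartment_cycle] b(1)[OF that] by (simp add: a_def)
    show "\<phi> (?act (b x) y) = \<phi> y" if x: "x \<in> J" and y: "y \<in> carrier ?St" for x y
    proof -
      obtain c where c: "c \<in> ?Z" "y = \<Psi> c" using onto y by meson
      then show ?thesis
        using lookup_move_flags[OF b(1)[OF x] flagsZ[OF c(1)] F] fixF[OF x]
        by (simp add: \<Psi>_act[OF b(1)[OF x] c(1)] \<phi>\<Psi> move_flags_cycle[OF b(1)[OF x] c(1)])
    qed
    show \<eta>: "w \<circ> inv_into UNIV (b x) \<in> GL scale" if "x \<in> J" for x
      by (rule GL_comp[OF w(1) GL_inv[OF b(1)[OF that]]])
    show "\<epsilon> * \<epsilon> = 1" by (rule \<epsilon>)
    show "\<phi> (?act (w \<circ> inv_into UNIV (b x)) (\<Psi> (a y))) = (if x = y then \<epsilon> else 0)" if x: "x \<in> J" and y: "y \<in> J" for x y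
    proof -
      have xf: "x \<in> full_flags" using x by (simp add: J_def)
      have "move_flag (w \<circ> inv_into UNIV (b x)) x = ?F"
      proof
        fix i
        show "move_flag (w \<circ> inv_into UNIV (b x)) x i = ?F i"
        proof (cases "i < N")
          case True
          have "x i = b x ` apartment_flag reversal i"
            using fun_cong[OF b(3)[OF x], of i] True by (simp add: move_flag_def)
          then have "inv_into UNIV (b x) ` x i = apartment_flag reversal i"
            using GL_facts(3)[OF b(1)[OF x]] by (simp add: image_comp[symmetric] image_inv_f_f)
          moreover have "w ` apartment_flag reversal i = ?F i"
            using fun_cong[OF w(2), of i] by (simp only: move_flag_apply[OF True])
          ultimately show ?thesis by (simp only: move_flag_apply[OF True] image_comp[symmetric])
        qed (simp add: move_flag_def apartment_flag_def)
      qed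
      then have "Poly_Mapping.lookup (move_flags N (w \<circ> inv_into UNIV (b x)) (a y)) ?F = Poly_Mapping.lookup (a y) x"
        using lookup_move_flags[OF \<eta>[OF x] flagsZ[OF aZ[OF y]] xf] by simp
      then show ?thesis
        using dual[OF x y]
        by (simp add: \<Psi>_act[OF \<eta>[OF x] aZ[OF y]] \<phi>\<Psi> move_flags_cycle[OF \<eta>[OF x] aZ[OF y]])
    qed
    show "generate ?St ((\<lambda>x. \<Psi> (a x)) ` J) = carrier ?St"
    proof
      let ?H = "generate ?St ((\<lambda>x. \<Psi> (a x)) ` J)"
      have sub: "(\<lambda>x. \<Psi> (a x)) ` J \<subseteq> carrier ?St" using \<Psi>Z aZ by blast
      then show "?H \<subseteq> carrier ?St" by (rule A.generate_incl)
      have H: "subgroup ?H ?St" by (rule A.generate_is_subgroup[OF sub])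
      define Q where "Q c \<longleftrightarrow> c \<in> ?Z \<and> \<Psi> c \<in> ?H" for c
      have Q0: "Q 0"
      proof -
        have "\<Psi> 0 \<in> carrier ?St" "\<Psi> 0 = \<Psi> 0 \<otimes>\<^bsub>?St\<^esub> \<Psi> 0"
          using \<Psi>Z[OF flag_cycles_0] \<Psi>_add[of 0 0] by simp_all
        then have "\<Psi> 0 = \<one>\<^bsub>?St\<^esub>" by (metis A.l_cancel_one)
        then show ?thesis using subgroup.one_closed[OF H] flag_cycles_0 by (simp add: Q_def)
      qed
      have Q_diff: "Q (c - d)" if "Q c" "Q d" for c d
      proof -
        have cd: "c \<in> ?Z" "d \<in> ?Z" "\<Psi> c \<in> ?H" "\<Psi> d \<in> ?H" using that by (auto simp: Q_def)
        have "\<Psi> (c - d) \<otimes>\<^bsub>?St\<^esub> \<Psi> d = \<Psi> c" using \<Psi>_add[of "c - d" d] by simp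
        then have "\<Psi> (c - d) = \<Psi> c \<otimes>\<^bsub>?St\<^esub> inv\<^bsub>?St\<^esub> \<Psi> d"
          using \<Psi>Z[OF cd(1)] \<Psi>Z[OF cd(2)] \<Psi>Z[OF flag_cycles_diff[OF cd(1,2)]] by (metis A.inv_solve_right)
        then show ?thesis
          using cd flag_cycles_diff[OF cd(1,2)] subgroup.m_closed[OF H cd(3) subgroup.m_inv_closed[OF H cd(4)]]
          by (simp add: Q_def)
      qed
      have Q_add: "Q (c + d)" if "Q c" "Q d" for c d
        using Q_diff[OF that(1) Q_diff[OF Q0 that(2)]] by simp
      have Q_sum: "Q (\<Sum>x\<in>S. f x)" if "\<And>x. x \<in> S \<Longrightarrow> Q (f x)" for S and f :: "(nat \<Rightarrow> 'b set) \<Rightarrow> _"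
        using that by (induction S rule: infinite_finite_induct) (auto intro: Q0 Q_add)
      have Qa: "Q (frag_cmul k (a x))" if "x \<in> J" for k x
      proof (rule frag_closure_minus_cmul[where P = Q, OF Q0 Q_diff])
        show "Q (a x)" using that aZ by (auto simp: Q_def intro: generate.incl)
      qed
      show "carrier ?St \<subseteq> ?H"
      proof
        fix y assume "y \<in> carrier ?St"
        then obtain c where c: "c \<in> ?Z" "y = \<Psi> c" using onto by meson
        let ?S = "Poly_Mapping.keys c \<inter> J"
        \<comment> \<open>the only candidate with the same coefficients at opposite flags as \<open>c\<close>\<close>
        define d where "d = (\<Sum>x\<in>?S. frag_cmul (\<epsilon> * Poly_Mapping.lookup c x) (a x))"
        have Qd: "Q d" unfolding d_def by (rule Q_sum) (use Qa in auto)
        have "c - d = 0"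
        proof (rule cycle_vanishes)
          show "c - d \<in> ?Z" using c Qd by (auto simp: Q_def intro: flag_cycles_diff)
          fix x assume "x \<in> full_flags" "opposite x"
          then have x: "x \<in> J" by (simp add: J_def)
          have "Poly_Mapping.lookup d x = (\<Sum>y\<in>?S. if y = x then Poly_Mapping.lookup c x else 0)"
            unfolding d_def lookup_sum
          proof (rule sum.cong[OF refl])
            fix y assume "y \<in> ?S"
            then have "Poly_Mapping.lookup (a y) x = (if x = y then \<epsilon> else 0)" using dual[OF x] by simp
            then show "Poly_Mapping.lookup (frag_cmul (\<epsilon> * Poly_Mapping.lookup c y) (a y)) x
                = (if y = x then Poly_Mapping.lookup c x else 0)"
              using \<epsilon> by (auto simp: mult.commute mult.left_commute)
          qed
          also have "\<dots> = Poly_Mapping.lookup c x" using x by (simp add: in_keys_iff)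
          finally show "Poly_Mapping.lookup (c - d) x = 0" by (simp add: lookup_minus)
        qed
        then show "y \<in> ?H" using c Qd by (simp add: Q_def)
      qed
    qed
  qed
qed

end

theorem corollary4:
  fixes smul :: "'f::field \<Rightarrow> 'v::ab_group_add \<Rightarrow> 'v"
    and B :: "'v set"
    and R :: "('k, 'm) ring_scheme"
  assumes "finite_dimensional_vector_space smul B"
    and "(UNIV :: 'v set) \<noteq> {0}"
    and "cring R"
    and "connected_ring R"
  shows "group_ring_indecomposable (GL smul) R
           (tensor_module R (steinberg smul))
           (\<lambda>g. tensor_map R (steinberg smul) (steinberg_act smul g))"
proof -
  interpret finite_dimensional_vector_space smul B by fact
  have card: "card B = dim (UNIV :: 'v set)"
    using dim_UNIV by simp
  have "B \<noteq> {}" using assms(2) span_Basis by auto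
  then have "card B \<noteq> 0" using finite_Basis by simp
  then obtain N where N: "card B = Suc N" using not0_implies_Suc by blast
  obtain v where v: "bij_betw v {..<card B} B"
    using ex_bij_betw_nat_finite[OF finite_Basis] by (auto simp: atLeast0LessThan)
  interpret framed_space smul B v N
  proof
    show "dim (UNIV :: 'v set) = Suc N" using card N by simp
    show "inj_on v {..N}" "independent (v ` {..N})"
      using v independent_Basis unfolding N lessThan_Suc_atMost by (auto simp: bij_betw_def)
  qed
  show ?thesis by (rule steinberg_indecomposable[OF assms(3,4)])
qed

end
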